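(* Assume that $Q^{\mathrm{dyn}}$ has finite time range and that the global foliation $(\eta_t)_{t\in\mathbb R}$ satisfies the hyperbolicity condition. Let $I=[t_0,t_{\max}]$, $L=L_{t_0}^{t_{\max}}$, let $C=C(I)$ be the constant of the hyperbolicity condition and $\Gamma=2C^2(t_{\max}-t_0)$. Then for every $w\in L^2(L,SM)$ there is a solution $\psi\in L^2(L,SM)$ of the weak dynamical wave equation with zero initial data, $$\mathopen{<}Q^{\mathrm{dyn}}\phi\,|\,\psi\mathclose{>}_{\mathcal K_L}=\mathopen{<}\phi\,|\,w\mathclose{>}_{\mathcal K_L}\qquad\text{for all }\phi\in\overline C{}_0^{t_{\max}}(M,SM).$$ This solution is bounded by $\|\psi\|_{L^2(L)}\le\Gamma\,\|w\|_{L^2(L)}$.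
   Context: Let $(\mathcal H,\langle\cdot|\cdot\rangle_{\mathcal H})$ be a separable complex Hilbert space (scalar product antilinear in the first argument), $n\in\mathbb N$, $\mathcal F\subset\mathrm L(\mathcal H)$ a smooth finite-dimensional manifold of selfadjoint finite-rank operators having exactly $n$ positive and $n$ negative eigenvalues (counting multiplicities) and a fixed trace, $\rho$ a locally finite regular Borel measure on $\mathcal F$ and $M:=\operatorname{supp}\rho$ (spacetime). Past sets. With fixed $\kappa>0$ let $\mathcal L_\kappa(x,y)=\frac1{4n}\sum_{i,j=1}^{2n}(|\lambda_i|-|\lambda_j|)^2+\kappa(\sum_j|\lambda_j|)^2$, where $\lambda_1,\dots,\lambda_{2n}$ are the eigenvalues of $xy$ (non-zero ones with algebraic multiplicity, filled up with zeros). Fix a finite-dimensional subspace $\mathcal H^{\mathrm f}\subset\mathcal H$; for every selfadjoint $A$ with $A(\mathcal H^{\mathrm f})\subset\mathcal H^{\mathrm f}$ and $A|_{(\mathcal H^{\mathrm f})^\perp}=0$ consider the vector field $\mathscr C_A(x)=i[A,x]$ and set $g_A(x,y)=|(D_{1,\mathscr C_A}-D_{2,\mathscr C_A})\mathcal L_\kappa(x,y)|$, where $D_1,D_2$ are directional derivatives acting on the first resp. second argument. A Borel set $\Omega\subset M$ is surface layer finite if all $g_A$ are integrable over $\Omega\times(M\setminus\Omega)$; two such sets are causally equivalent if all $g_A$ are integrable over $K\times K$, with $K$ their symmetric difference. It is assumed that there are precisely four equivalence classes $[\varnothing],[M],[\Omega_0],[M\setminus\Omega_0]$ and that $[\Omega_0]$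 is distinguished; its elements are the past sets. Wave functions. $S_x:=x(\mathcal H)$ carries the spin inner product $\prec u|v\succ_x=-\langle u|xv\rangle_{\mathcal H}$ and the scalar product $\langle\!\langle u|v\rangle\!\rangle_x=\langle u|\,|x|\,v\rangle_{\mathcal H}$. A wave function is a map $\psi$ on $M$ with $\psi(x)\in S_x$; it is continuous if $x\mapsto\sqrt{|x|}\psi(x)\in\mathcal H$ is continuous; $C^0(M,SM)$ is the space of continuous wave functions. $C^{\mathrm{vary}}(M,SM)\subset C^0(M,SM)$ is a chosen linear subspace; $C^{\mathrm{vary}}_0$ are its compactly supported elements. Operator. $Q^{\mathrm{dyn}}(x,y):S_y\to S_x$ is a given kernel, symmetric in the sense $Q^{\mathrm{dyn}}(x,y)^*=Q^{\mathrm{dyn}}(y,x)$ (adjoints with respect to the spin inner products; a multiple of $\delta(x,y)$ on the diagonal is allowed), and $(Q^{\mathrm{dyn}}\psi)(x)=\int_MQ^{\mathrm{dyn}}(x,y)\psi(y)\,d\rho(y)$. Global foliation. $\eta\in C^\infty(\mathbb R\times M,\mathbb R)$, $0\le\eta\le1$, $\eta_t:=\eta(t,\cdot)$, $\theta_t:=\partial_t\eta(t,\cdot)$, such that for all $t$: (i) $\operatorname{supp}\eta_t$ is a past set; (ii) $\theta_t\ge0$; (iii) there are $t_0,t_1\in\mathbb R$ such that $\theta_t(x)\ne0$ implies $\eta_{t_0}(x)=0$ and $\eta_{t_1}(x)=1$; and (iv) $M=\bigcup_t\operatorname{supp}\theta_t$. Set $d\rho_t=\theta_t\,d\rho$. For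 $t_0<t_1$ the time strip is $L_{t_0}^{t_1}=\bigcup_{t\in[t_0,t_1]}\operatorname{supp}\theta_t$; with $\eta_I=\eta_{t_1}-\eta_{t_0}$ set $\langle\psi|\phi\rangle_{L^2(L)}=\int_M\langle\!\langle\psi|\phi\rangle\!\rangle_x\,\eta_I(x)\,d\rho(x)$, with Hilbert space $L^2(L,SM)$, and the Krein inner product $\mathopen{<}\psi|\phi\mathclose{>}_{\mathcal K_L}=\int_L\prec\psi|\phi\succ_x\eta_I(x)\,d\rho(x)$. $L^2_{\mathrm{loc,t}}(M,SM)$ denotes the wave functions which are in $L^2(L,SM)$ for every time strip $L$, and $C^{\mathrm{vary}}_{\mathrm{loc,t}}:=C^{\mathrm{vary}}\cap L^2_{\mathrm{loc,t}}$. Finite time range: there is $r>0$ with $Q^{\mathrm{dyn}}(x,y)=0$ whenever $x\in\operatorname{supp}\theta_{t_0}$, $y\in\operatorname{supp}\theta_{t_1}$ and $|t_1-t_0|>r$; and $Q^{\mathrm{dyn}}(L^2_{\mathrm{loc,t}}(M,SM))\subset L^2_{\mathrm{loc,t}}(M,SM)$. Softened surface layer form: $$\langle\psi|\phi\rangle^t_\rho=-2i\int_Md\rho(x)\int_Md\rho(y)\,\big(\eta_t(x)(1-\eta_t(y))-(1-\eta_t(x))\eta_t(y)\big)\prec\psi(x)|Q^{\mathrm{dyn}}(x,y)\phi(y)\succ_x .$$ By finite time range, only $x,y$ in a bounded time strip contribute, and the form is used for $\psi,\phi\in L^2_{\mathrm{loc,t}}(M,SM)$ (existence of the double integrals, interchange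 of the order of integration and differentiation in $t$ under the integrals being understood). $\|\psi\|^t_\rho:=\sqrt{\langle\psi|\psi\rangle^t_\rho}$. Hyperbolicity condition: for any compact interval $I=[t_0,t_{\max}]$ there is $C=C(I)>0$ such that for all $t\in I$ and all $\psi\in C^{\mathrm{vary}}_{\mathrm{loc,t}}(M,SM)$, $\langle\psi|\psi\rangle^t_\rho\ge\frac1{C^2}\int_M\langle\!\langle\psi(x)|\psi(x)\rangle\!\rangle_x\,d\rho_t(x)$. Test space: $\overline C{}_0^{t}(M,SM):=\{\psi\in C^{\mathrm{vary}}_0(M,SM)\,|\,(1-\eta_t)\psi=0\text{ and }\|\psi\|^{t'}_\rho=0\text{ for all }t'\ge t\}$. *)

theory Defs
  imports "HOL-Analysis.Analysis"
begin

section \<open>Separable complex Hilbert spaces\<close>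

text \<open>For a metric space, second countability is separability. The scalar product is antilinear in
  its first argument.\<close>

class separable_complex_hilbert = banach + second_countable_topology +
  fixes scaleC :: "complex \<Rightarrow> 'a \<Rightarrow> 'a"  (infixr \<open>*\<^sub>C\<close> 75)
    and cinner :: "'a \<Rightarrow> 'a \<Rightarrow> complex"
  assumes scaleC_add_right: "c *\<^sub>C (u + v) = c *\<^sub>C u + c *\<^sub>C v"
    and scaleC_add_left: "(c + d) *\<^sub>C u = c *\<^sub>C u + d *\<^sub>C u"
    and scaleC_scaleC: "c *\<^sub>C d *\<^sub>C u = (c * d) *\<^sub>C u"
    and scaleC_one: "1 *\<^sub>C u = u"
    and scaleR_scaleC: "scaleR a u = complex_of_real a *\<^sub>C u"
    and cinner_add_right: "cinner u (v + w) = cinner u v + cinner u w"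
    and cinner_scaleC_right: "cinner u (c *\<^sub>C v) = c * cinner u v"
    and cinner_commute: "cinner u v = cnj (cinner v u)"
    and cinner_self: "cinner u u = complex_of_real ((norm u)\<^sup>2)"

interpretation complex_vector:
  vector_space "scaleC :: complex \<Rightarrow> 'a \<Rightarrow> 'a::separable_complex_hilbert"
  by unfold_locales (simp_all add: scaleC_add_right scaleC_add_left scaleC_scaleC scaleC_one)

text \<open>Operators are bounded and a priori only real linear; selfadjointness with respect to
  \<^const>\<open>cinner\<close> entails complex linearity.\<close>

type_synonym 'a op = "'a \<Rightarrow>\<^sub>L 'a"

definition selfadjoint :: "'a::separable_complex_hilbert op \<Rightarrow> bool" where
  "selfadjoint T \<longleftrightarrow> (\<forall>u v. cinner (T u) v = cinner u (T v))"

definition positive_op :: "'a::separable_complex_hilbert op \<Rightarrow> bool" where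
  "positive_op T \<longleftrightarrow> selfadjoint T \<and> (\<forall>u. 0 \<le> Re (cinner u (T u)))"

definition op_sqrt :: "'a::separable_complex_hilbert op \<Rightarrow> 'a op" where
  "op_sqrt T = (THE S. positive_op S \<and> S o\<^sub>L S = T)"

text \<open>The absolute value of a selfadjoint operator.\<close>

definition op_abs :: "'a::separable_complex_hilbert op \<Rightarrow> 'a op" where
  "op_abs T = op_sqrt (T o\<^sub>L T)"

definition finite_rank :: "'a::separable_complex_hilbert op \<Rightarrow> bool" where
  "finite_rank T \<longleftrightarrow> (\<exists>B. finite B \<and> range (blinfun_apply T) \<subseteq> complex_vector.span B)"

text \<open>Algebraic multiplicity (zero if \<open>z\<close> is no eigenvalue).\<close>

definition alg_mult :: "'a::separable_complex_hilbert op \<Rightarrow> complex \<Rightarrow> nat" where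
  "alg_mult T z = complex_vector.dim {u. \<exists>k. ((\<lambda>v. T v - z *\<^sub>C v) ^^ k) u = 0}"

definition is_eigenvalue :: "'a::separable_complex_hilbert op \<Rightarrow> complex \<Rightarrow> bool" where
  "is_eigenvalue T z \<longleftrightarrow> (\<exists>u. u \<noteq> 0 \<and> T u = z *\<^sub>C u)"

definition num_pos_eigenvalues :: "'a::separable_complex_hilbert op \<Rightarrow> nat" where
  "num_pos_eigenvalues T =
     (\<Sum>l | 0 < l \<and> is_eigenvalue T (complex_of_real l). alg_mult T (complex_of_real l))"

definition num_neg_eigenvalues :: "'a::separable_complex_hilbert op \<Rightarrow> nat" where
  "num_neg_eigenvalues T =
     (\<Sum>l | l < 0 \<and> is_eigenvalue T (complex_of_real l). alg_mult T (complex_of_real l))"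

text \<open>Trace of a finite-rank operator, computed in an orthonormal system spanning a space that
  contains the range.\<close>

definition has_trace :: "'a::separable_complex_hilbert op \<Rightarrow> complex \<Rightarrow> bool" where
  "has_trace T c \<longleftrightarrow> (\<exists>B. finite B \<and> (\<forall>u\<in>B. \<forall>v\<in>B. cinner u v = (if u = v then 1 else 0)) \<and>
     range (blinfun_apply T) \<subseteq> complex_vector.span B \<and> c = (\<Sum>u\<in>B. cinner u (T u)))"


section \<open>Smoothness and submanifolds\<close>

text \<open>Iterated differentiability on open sets, phrased through Frechet differentiability and
  iterated directional derivatives. If the domain is a Banach space, then by the uniform boundedness
  principle \<^term>\<open>\<forall>k. Ck_on k f U\<close> is the usual notion of a smooth map.\<close>

primrec Ck_on :: "nat \<Rightarrow> ('b::real_normed_vector \<Rightarrow> 'c::real_normed_vector) \<Rightarrow> 'b set \<Rightarrow> bool" where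
  "Ck_on 0 f U \<longleftrightarrow> continuous_on U f"
| "Ck_on (Suc k) f U \<longleftrightarrow> (\<forall>p\<in>U. f differentiable (at p)) \<and>
     (\<forall>v. Ck_on k (\<lambda>p. frechet_derivative f (at p) v) U)"

definition smooth_on_open :: "('b::real_normed_vector \<Rightarrow> 'c::real_normed_vector) \<Rightarrow> 'b set \<Rightarrow> bool" where
  "smooth_on_open f U \<longleftrightarrow> open U \<and> (\<forall>k. Ck_on k f U)"

text \<open>Embedded \<open>k\<close>-dimensional submanifold of a Banach space, by slice charts.\<close>

definition smooth_submanifold :: "nat \<Rightarrow> 'b::real_normed_vector set \<Rightarrow> bool" where
  "smooth_submanifold k S \<longleftrightarrow> second_countable (top_of_set S) \<and>
     (\<forall>p\<in>S. \<exists>U V W. \<exists>\<Phi> :: 'b \<Rightarrow> 'b. \<exists>\<Psi>. p \<in> U \<and> smooth_on_open \<Phi> U \<and> smooth_on_open \<Psi> V \<and>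
        homeomorphism U V \<Phi> \<Psi> \<and> subspace W \<and> (\<exists>B. finite B \<and> W = span B) \<and> dim W = k \<and>
        \<Phi> ` (S \<inter> U) = W \<inter> V)"

text \<open>Smooth functions on an arbitrary subset: those which locally extend smoothly. For a
  subset of a submanifold it makes no difference whether one extends to the submanifold or, using
  slice charts, to the ambient space.\<close>

definition smooth_on_set :: "('b::real_normed_vector \<Rightarrow> 'c::real_normed_vector) \<Rightarrow> 'b set \<Rightarrow> bool" where
  "smooth_on_set f S \<longleftrightarrow>
     (\<forall>p\<in>S. \<exists>U g. p \<in> U \<and> smooth_on_open g U \<and> (\<forall>q\<in>S \<inter> U. g q = f q))"


section \<open>Spacetime\<close>

definition regular_borel :: "'b::topological_space measure \<Rightarrow> bool" where
  "regular_borel \<rho> \<longleftrightarrow> (\<forall>A\<in>sets \<rho>.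
     emeasure \<rho> A = (INF U\<in>{U. openin (top_of_set (space \<rho>)) U \<and> A \<subseteq> U}. emeasure \<rho> U) \<and>
     emeasure \<rho> A = (SUP K\<in>{K. compact K \<and> K \<subseteq> A}. emeasure \<rho> K))"

definition locally_finite :: "'b::topological_space measure \<Rightarrow> bool" where
  "locally_finite \<rho> \<longleftrightarrow>
     (\<forall>x\<in>space \<rho>. \<exists>U. open U \<and> x \<in> U \<and> emeasure \<rho> (U \<inter> space \<rho>) < \<infinity>)"

text \<open>\<open>\<rho>\<close> is a measure on the Borel sets of \<open>F\<close>, so \<open>space \<rho> = F\<close>.\<close>

definition causal_fermion_system ::
    "nat \<Rightarrow> 'a::separable_complex_hilbert op set \<Rightarrow> 'a op measure \<Rightarrow> bool" where
  "causal_fermion_system n F \<rho> \<longleftrightarrow> 1 \<le> n \<and> (\<exists>k. smooth_submanifold k F) \<and>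
     (\<forall>x\<in>F. selfadjoint x \<and> finite_rank x \<and>
        num_pos_eigenvalues x = n \<and> num_neg_eigenvalues x = n) \<and>
     (\<exists>c. \<forall>x\<in>F. has_trace x c) \<and>
     space \<rho> = F \<and> sets \<rho> = sets (restrict_space borel F) \<and> locally_finite \<rho> \<and> regular_borel \<rho>"

definition spacetime :: "'b::topological_space measure \<Rightarrow> 'b set" where
  "spacetime \<rho> = {x \<in> space \<rho>. \<forall>U. open U \<and> x \<in> U \<longrightarrow> 0 < emeasure \<rho> (U \<inter> space \<rho>)}"

text \<open>The measure \<open>\<rho>\<close> as a measure on \<open>M = supp \<rho>\<close>.\<close>

abbreviation on_M :: "'b::topological_space measure \<Rightarrow> 'b measure" where
  "on_M \<rho> \<equiv> restrict_space \<rho> (spacetime \<rho>)"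

definition support_M :: "'b::topological_space measure \<Rightarrow> ('b \<Rightarrow> 'c::zero) \<Rightarrow> 'b set" where
  "support_M \<rho> f = spacetime \<rho> \<inter> closure {x \<in> spacetime \<rho>. f x \<noteq> 0}"


section \<open>Past sets\<close>

definition eigenvalue_family :: "nat \<Rightarrow> 'a::separable_complex_hilbert op \<Rightarrow> (nat \<Rightarrow> complex) \<Rightarrow> bool" where
  "eigenvalue_family m T l \<longleftrightarrow> (\<forall>z. z \<noteq> 0 \<longrightarrow> card {j. j < m \<and> l j = z} = alg_mult T z)"

definition lagrangian ::
    "nat \<Rightarrow> real \<Rightarrow> 'a::separable_complex_hilbert op \<Rightarrow> 'a op \<Rightarrow> real" where
  "lagrangian n \<kappa> x y =
     (let l = (SOME l. eigenvalue_family (2 * n) (x o\<^sub>L y) l) in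
        1 / (4 * real n) * (\<Sum>i<2*n. \<Sum>j<2*n. (cmod (l i) - cmod (l j))\<^sup>2)
          + \<kappa> * (\<Sum>j<2*n. cmod (l j))\<^sup>2)"

definition commutator_field :: "'a::separable_complex_hilbert op \<Rightarrow> 'a op \<Rightarrow> 'a op" where
  "commutator_field A x = Blinfun (\<lambda>u. \<i> *\<^sub>C (A (x u) - x (A u)))"

text \<open>Derivative of \<open>f\<close> at \<open>x\<close> in the direction of the vector field \<open>X\<close>, taken along the integral
  curve of \<open>X\<close> through \<open>x\<close>. For \<^const>\<open>commutator_field\<close> this curve is the unitary orbit
  \<open>s \<mapsto> exp (\<i>sA) x exp (-\<i>sA)\<close>, along which the number of eigenvalues entering the Lagrangian
  remains bounded by \<open>2n\<close> (which need not be the case on the line \<open>x + sX(x)\<close>).\<close>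

definition has_field_direction_derivative ::
    "('b::real_normed_vector \<Rightarrow> 'b) \<Rightarrow> ('b \<Rightarrow> real) \<Rightarrow> 'b \<Rightarrow> real \<Rightarrow> bool" where
  "has_field_direction_derivative X f x d \<longleftrightarrow>
     (\<exists>\<gamma>::real \<Rightarrow> 'b. \<gamma> 0 = x \<and> (\<forall>s. (\<gamma> has_vector_derivative X (\<gamma> s)) (at s)) \<and>
        ((\<lambda>s. f (\<gamma> s)) has_real_derivative d) (at 0))"

definition is_g ::
    "nat \<Rightarrow> real \<Rightarrow> 'a::separable_complex_hilbert op \<Rightarrow> 'a op \<Rightarrow> 'a op \<Rightarrow> real \<Rightarrow> bool" where
  "is_g n \<kappa> A x y r \<longleftrightarrow> (\<exists>d1 d2.
     has_field_direction_derivative (commutator_field A) (\<lambda>x'. lagrangian n \<kappa> x' y) x d1 \<and>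
     has_field_direction_derivative (commutator_field A) (\<lambda>y'. lagrangian n \<kappa> x y') y d2 \<and>
     r = \<bar>d1 - d2\<bar>)"

text \<open>The Lagrangian need not be differentiable everywhere; as usual, integrability of \<open>g\<^sub>A\<close> over
  \<open>S \<subseteq> M \<times> M\<close> includes that it exists almost everywhere on \<open>S\<close>.\<close>

definition g_integrable_over ::
    "'a::separable_complex_hilbert op measure \<Rightarrow> nat \<Rightarrow> real \<Rightarrow> 'a op \<Rightarrow> ('a op \<times> 'a op) set \<Rightarrow> bool" where
  "g_integrable_over \<rho> n \<kappa> A S \<longleftrightarrow>
     (\<exists>g. set_integrable (on_M \<rho> \<Otimes>\<^sub>M on_M \<rho>) S g \<and>
          (AE p in on_M \<rho> \<Otimes>\<^sub>M on_M \<rho>. p \<in> S \<longrightarrow> is_g n \<kappa> A (fst p) (snd p) (g p)))"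

definition finite_dim_csubspace :: "'a::separable_complex_hilbert set \<Rightarrow> bool" where
  "finite_dim_csubspace V \<longleftrightarrow> (\<exists>B. finite B \<and> V = complex_vector.span B)"

definition symmetry_generators :: "'a::separable_complex_hilbert set \<Rightarrow> 'a op set" where
  "symmetry_generators Hf = {A. selfadjoint A \<and> blinfun_apply A ` Hf \<subseteq> Hf \<and>
     (\<forall>u. (\<forall>v\<in>Hf. cinner v u = 0) \<longrightarrow> A u = 0)}"

definition surface_layer_finite_sets ::
    "'a::separable_complex_hilbert op measure \<Rightarrow> nat \<Rightarrow> real \<Rightarrow> 'a set \<Rightarrow> 'a op set set" where
  "surface_layer_finite_sets \<rho> n \<kappa> Hf = {\<Omega> \<in> sets (on_M \<rho>).
     \<forall>A\<in>symmetry_generators Hf. g_integrable_over \<rho> n \<kappa> A (\<Omega> \<times> (spacetime \<rho> - \<Omega>))}"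

definition causal_equivalence ::
    "'a::separable_complex_hilbert op measure \<Rightarrow> nat \<Rightarrow> real \<Rightarrow> 'a set \<Rightarrow> ('a op set \<times> 'a op set) set" where
  "causal_equivalence \<rho> n \<kappa> Hf = {(\<Omega>, \<Omega>').
     \<Omega> \<in> surface_layer_finite_sets \<rho> n \<kappa> Hf \<and> \<Omega>' \<in> surface_layer_finite_sets \<rho> n \<kappa> Hf \<and>
     (let K = (\<Omega> - \<Omega>') \<union> (\<Omega>' - \<Omega>) in
        \<forall>A\<in>symmetry_generators Hf. g_integrable_over \<rho> n \<kappa> A (K \<times> K))}"

definition distinguished_past ::
    "'a::separable_complex_hilbert op measure \<Rightarrow> nat \<Rightarrow> real \<Rightarrow> 'a set \<Rightarrow> 'a op set \<Rightarrow> bool" where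
  "distinguished_past \<rho> n \<kappa> Hf \<Omega>0 \<longleftrightarrow> \<Omega>0 \<in> surface_layer_finite_sets \<rho> n \<kappa> Hf \<and>
     (let E = causal_equivalence \<rho> n \<kappa> Hf; M = spacetime \<rho>;
          classes = {E `` {{}}, E `` {M}, E `` {\<Omega>0}, E `` {M - \<Omega>0}} in
        surface_layer_finite_sets \<rho> n \<kappa> Hf // E = classes \<and> card classes = 4)"

definition past_sets ::
    "'a::separable_complex_hilbert op measure \<Rightarrow> nat \<Rightarrow> real \<Rightarrow> 'a set \<Rightarrow> 'a op set \<Rightarrow> 'a op set set" where
  "past_sets \<rho> n \<kappa> Hf \<Omega>0 = causal_equivalence \<rho> n \<kappa> Hf `` {\<Omega>0}"


section \<open>Wave functions\<close>

abbreviation spin_space :: "'a::separable_complex_hilbert op \<Rightarrow> 'a set" where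
  "spin_space x \<equiv> range (blinfun_apply x)"

definition spin_prod :: "'a::separable_complex_hilbert op \<Rightarrow> 'a \<Rightarrow> 'a \<Rightarrow> complex" where
  "spin_prod x u v = - cinner u (x v)"

definition spin_scal :: "'a::separable_complex_hilbert op \<Rightarrow> 'a \<Rightarrow> 'a \<Rightarrow> complex" where
  "spin_scal x u v = cinner u (op_abs x v)"

type_synonym 'a wave = "'a op \<Rightarrow> 'a"

text \<open>A map on \<open>M\<close> is represented by its extension by zero.\<close>

definition wave_functions :: "'a::separable_complex_hilbert op measure \<Rightarrow> 'a wave set" where
  "wave_functions \<rho> =
     {\<psi>. (\<forall>x\<in>spacetime \<rho>. \<psi> x \<in> spin_space x) \<and> (\<forall>x. x \<notin> spacetime \<rho> \<longrightarrow> \<psi> x = 0)}"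

definition continuous_waves :: "'a::separable_complex_hilbert op measure \<Rightarrow> 'a wave set" where
  "continuous_waves \<rho> =
     {\<psi> \<in> wave_functions \<rho>. continuous_on (spacetime \<rho>) (\<lambda>x. op_sqrt (op_abs x) (\<psi> x))}"

definition wave_subspace :: "'a::separable_complex_hilbert wave set \<Rightarrow> bool" where
  "wave_subspace V \<longleftrightarrow> (\<lambda>x. 0) \<in> V \<and> (\<forall>\<psi>\<in>V. \<forall>\<phi>\<in>V. (\<lambda>x. \<psi> x + \<phi> x) \<in> V) \<and>
     (\<forall>c. \<forall>\<psi>\<in>V. (\<lambda>x. c *\<^sub>C \<psi> x) \<in> V)"

definition compactly_supported ::
    "'a::separable_complex_hilbert op measure \<Rightarrow> 'a wave set \<Rightarrow> 'a wave set" where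
  "compactly_supported \<rho> V = {\<psi> \<in> V. compact (support_M \<rho> \<psi>)}"


section \<open>Global foliations and time strips\<close>

definition theta :: "(real \<Rightarrow> 'b \<Rightarrow> real) \<Rightarrow> real \<Rightarrow> 'b \<Rightarrow> real" where
  "theta \<eta> t x = deriv (\<lambda>s. \<eta> s x) t"

definition global_foliation ::
    "'a::separable_complex_hilbert op measure \<Rightarrow> 'a op set set \<Rightarrow> (real \<Rightarrow> 'a op \<Rightarrow> real) \<Rightarrow> bool" where
  "global_foliation \<rho> past \<eta> \<longleftrightarrow>
     smooth_on_set (\<lambda>(t, x). \<eta> t x) (UNIV \<times> spacetime \<rho>) \<and>
     (\<forall>t. \<forall>x\<in>spacetime \<rho>. 0 \<le> \<eta> t x \<and> \<eta> t x \<le> 1) \<and>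
     (\<forall>t. support_M \<rho> (\<eta> t) \<in> past) \<and>
     (\<forall>t. \<forall>x\<in>spacetime \<rho>. 0 \<le> theta \<eta> t x) \<and>
     (\<forall>t. \<exists>t0 t1. \<forall>x\<in>spacetime \<rho>. theta \<eta> t x \<noteq> 0 \<longrightarrow> \<eta> t0 x = 0 \<and> \<eta> t1 x = 1) \<and>
     spacetime \<rho> = (\<Union>t. support_M \<rho> (theta \<eta> t))"

definition rho_t ::
    "'b::topological_space measure \<Rightarrow> (real \<Rightarrow> 'b \<Rightarrow> real) \<Rightarrow> real \<Rightarrow> 'b measure" where
  "rho_t \<rho> \<eta> t = density (on_M \<rho>) (\<lambda>x. ennreal (theta \<eta> t x))"

definition time_strip ::
    "'b::topological_space measure \<Rightarrow> (real \<Rightarrow> 'b \<Rightarrow> real) \<Rightarrow> real \<Rightarrow> real \<Rightarrow> 'b set" where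
  "time_strip \<rho> \<eta> t0 t1 = (\<Union>t\<in>{t0..t1}. support_M \<rho> (theta \<eta> t))"

definition eta_strip :: "(real \<Rightarrow> 'b \<Rightarrow> real) \<Rightarrow> real \<Rightarrow> real \<Rightarrow> 'b \<Rightarrow> real" where
  "eta_strip \<eta> t0 t1 x = \<eta> t1 x - \<eta> t0 x"

text \<open>Elements of \<open>L\<^sup>2(L, SM)\<close> are represented by wave functions that are Borel measurable on \<open>M\<close>;
  classes modulo null functions are not formed.\<close>

definition L2_strip :: "'a::separable_complex_hilbert op measure \<Rightarrow> (real \<Rightarrow> 'a op \<Rightarrow> real) \<Rightarrow>
    real \<Rightarrow> real \<Rightarrow> 'a wave set" where
  "L2_strip \<rho> \<eta> t0 t1 = {\<psi> \<in> wave_functions \<rho>.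
     (\<lambda>x. op_sqrt (op_abs x) (\<psi> x)) \<in> borel_measurable (on_M \<rho>) \<and>
     integrable (on_M \<rho>) (\<lambda>x. spin_scal x (\<psi> x) (\<psi> x) * complex_of_real (eta_strip \<eta> t0 t1 x))}"

definition L2_inner :: "'a::separable_complex_hilbert op measure \<Rightarrow> (real \<Rightarrow> 'a op \<Rightarrow> real) \<Rightarrow>
    real \<Rightarrow> real \<Rightarrow> 'a wave \<Rightarrow> 'a wave \<Rightarrow> complex" where
  "L2_inner \<rho> \<eta> t0 t1 \<psi> \<phi> =
     (LINT x|on_M \<rho>. spin_scal x (\<psi> x) (\<phi> x) * complex_of_real (eta_strip \<eta> t0 t1 x))"

definition L2_norm :: "'a::separable_complex_hilbert op measure \<Rightarrow> (real \<Rightarrow> 'a op \<Rightarrow> real) \<Rightarrow>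
    real \<Rightarrow> real \<Rightarrow> 'a wave \<Rightarrow> real" where
  "L2_norm \<rho> \<eta> t0 t1 \<psi> = sqrt (Re (L2_inner \<rho> \<eta> t0 t1 \<psi> \<psi>))"

definition krein_inner :: "'a::separable_complex_hilbert op measure \<Rightarrow> (real \<Rightarrow> 'a op \<Rightarrow> real) \<Rightarrow>
    real \<Rightarrow> real \<Rightarrow> 'a wave \<Rightarrow> 'a wave \<Rightarrow> complex" where
  "krein_inner \<rho> \<eta> t0 t1 \<psi> \<phi> =
     (LINT x:time_strip \<rho> \<eta> t0 t1|on_M \<rho>.
        spin_prod x (\<psi> x) (\<phi> x) * complex_of_real (eta_strip \<eta> t0 t1 x))"

definition L2_loc_t ::
    "'a::separable_complex_hilbert op measure \<Rightarrow> (real \<Rightarrow> 'a op \<Rightarrow> real) \<Rightarrow> 'a wave set" where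
  "L2_loc_t \<rho> \<eta> = {\<psi>. \<forall>t0 t1. t0 < t1 \<longrightarrow> \<psi> \<in> L2_strip \<rho> \<eta> t0 t1}"


section \<open>The operator and the softened surface layer form\<close>

text \<open>The distributional kernel is \<open>Q(x,y) = q(x,y) + c \<delta>(x,y)\<close> with a function \<open>q\<close> and a constant
  \<open>c\<close>, where \<open>\<integral>\<^sub>M \<delta>(x,y) \<psi>(y) d\<rho>(y) = \<psi>(x)\<close>. By symmetry, \<open>c\<close> is real.\<close>

type_synonym 'a kernel = "'a op \<Rightarrow> 'a op \<Rightarrow> 'a \<Rightarrow> 'a"

definition symmetric_kernel ::
    "'a::separable_complex_hilbert op measure \<Rightarrow> 'a kernel \<Rightarrow> bool" where
  "symmetric_kernel \<rho> q \<longleftrightarrow> (\<forall>x\<in>spacetime \<rho>. \<forall>y\<in>spacetime \<rho>.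
     (\<forall>v\<in>spin_space y. q x y v \<in> spin_space x) \<and>
     (\<forall>v\<in>spin_space y. \<forall>w\<in>spin_space y. q x y (v + w) = q x y v + q x y w) \<and>
     (\<forall>a. \<forall>v\<in>spin_space y. q x y (a *\<^sub>C v) = a *\<^sub>C q x y v) \<and>
     (\<forall>u\<in>spin_space x. \<forall>v\<in>spin_space y. spin_prod x u (q x y v) = spin_prod y (q y x u) v))"

definition kernel_vanishes ::
    "'a::separable_complex_hilbert kernel \<Rightarrow> real \<Rightarrow> 'a op \<Rightarrow> 'a op \<Rightarrow> bool" where
  "kernel_vanishes q c x y \<longleftrightarrow> (\<forall>v\<in>spin_space y. q x y v = 0) \<and> (c \<noteq> 0 \<longrightarrow> x \<noteq> y)"

definition Q_apply ::
    "'a::separable_complex_hilbert op measure \<Rightarrow> 'a kernel \<Rightarrow> real \<Rightarrow> 'a wave \<Rightarrow> 'a wave" where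
  "Q_apply \<rho> q c \<psi> x =
     (if x \<in> spacetime \<rho> then (LINT y|on_M \<rho>. q x y (\<psi> y)) + c *\<^sub>R \<psi> x else 0)"

text \<open>The inclusion of \<open>Q(L\<^sup>2\<^sub>l\<^sub>o\<^sub>c\<^sub>,\<^sub>t)\<close> in \<open>L\<^sup>2\<^sub>l\<^sub>o\<^sub>c\<^sub>,\<^sub>t\<close> comprises that the integral defining \<open>Q\<psi>\<close> exists
  almost everywhere.\<close>

definition finite_time_range :: "'a::separable_complex_hilbert op measure \<Rightarrow>
    (real \<Rightarrow> 'a op \<Rightarrow> real) \<Rightarrow> 'a kernel \<Rightarrow> real \<Rightarrow> bool" where
  "finite_time_range \<rho> \<eta> q c \<longleftrightarrow>
     (\<exists>r>0. \<forall>t0 t1. \<forall>x\<in>support_M \<rho> (theta \<eta> t0). \<forall>y\<in>support_M \<rho> (theta \<eta> t1).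
        \<bar>t1 - t0\<bar> > r \<longrightarrow> kernel_vanishes q c x y) \<and>
     (\<forall>\<psi>\<in>L2_loc_t \<rho> \<eta>.
        (AE x in on_M \<rho>. integrable (on_M \<rho>) (\<lambda>y. q x y (\<psi> y))) \<and>
        Q_apply \<rho> q c \<psi> \<in> L2_loc_t \<rho> \<eta>)"

text \<open>\<open>-2i \<integral>\<integral> a(x,y) \<prec>\<psi>(x) | Q(x,y) \<phi>(y)\<succ>\<^sub>x d\<rho>(y) d\<rho>(x)\<close> for a weight \<open>a\<close>. The weights used below
  vanish on the diagonal, so that the \<open>\<delta>\<close>-contribution is zero.\<close>

definition weighted_form :: "'a::separable_complex_hilbert op measure \<Rightarrow> 'a kernel \<Rightarrow> real \<Rightarrow>
    ('a op \<Rightarrow> 'a op \<Rightarrow> real) \<Rightarrow> 'a wave \<Rightarrow> 'a wave \<Rightarrow> complex" where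
  "weighted_form \<rho> q c a \<psi> \<phi> = - 2 * \<i> *
     (LINT x|on_M \<rho>. (LINT y|on_M \<rho>. complex_of_real (a x y) * spin_prod x (\<psi> x) (q x y (\<phi> y)))
        + complex_of_real (c * a x x) * spin_prod x (\<psi> x) (\<phi> x))"

definition soft_weight :: "(real \<Rightarrow> 'b \<Rightarrow> real) \<Rightarrow> real \<Rightarrow> 'b \<Rightarrow> 'b \<Rightarrow> real" where
  "soft_weight \<eta> t x y = \<eta> t x * (1 - \<eta> t y) - (1 - \<eta> t x) * \<eta> t y"

definition surface_form :: "'a::separable_complex_hilbert op measure \<Rightarrow> (real \<Rightarrow> 'a op \<Rightarrow> real) \<Rightarrow>
    'a kernel \<Rightarrow> real \<Rightarrow> real \<Rightarrow> 'a wave \<Rightarrow> 'a wave \<Rightarrow> complex" where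
  "surface_form \<rho> \<eta> q c t \<psi> \<phi> = weighted_form \<rho> q c (soft_weight \<eta> t) \<psi> \<phi>"

definition surface_norm :: "'a::separable_complex_hilbert op measure \<Rightarrow> (real \<Rightarrow> 'a op \<Rightarrow> real) \<Rightarrow>
    'a kernel \<Rightarrow> real \<Rightarrow> real \<Rightarrow> 'a wave \<Rightarrow> real" where
  "surface_norm \<rho> \<eta> q c t \<psi> = sqrt (Re (surface_form \<rho> \<eta> q c t \<psi> \<psi>))"

text \<open>The analytic facts understood whenever the form is used: the double integrals defining it and
  those arising by differentiating the weight exist (absolutely, so that the order of integration
  may be interchanged), and one may differentiate in \<open>t\<close> under the integrals. Since
  \<open>\<partial>\<^sub>t\<close> of the weight is \<open>\<theta>\<^sub>t(x) - \<theta>\<^sub>t(y)\<close> and the kernel is symmetric, it suffices to demand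
  existence with the weight \<open>\<theta>\<^sub>t(x)\<close>.\<close>

definition surface_form_regular :: "'a::separable_complex_hilbert op measure \<Rightarrow>
    (real \<Rightarrow> 'a op \<Rightarrow> real) \<Rightarrow> 'a kernel \<Rightarrow> real \<Rightarrow> bool" where
  "surface_form_regular \<rho> \<eta> q c \<longleftrightarrow> (\<forall>\<psi>\<in>L2_loc_t \<rho> \<eta>. \<forall>\<phi>\<in>L2_loc_t \<rho> \<eta>. \<forall>t.
     integrable (on_M \<rho> \<Otimes>\<^sub>M on_M \<rho>)
       (\<lambda>(x, y). complex_of_real (soft_weight \<eta> t x y) * spin_prod x (\<psi> x) (q x y (\<phi> y))) \<and>
     integrable (on_M \<rho> \<Otimes>\<^sub>M on_M \<rho>)
       (\<lambda>(x, y). complex_of_real (theta \<eta> t x) * spin_prod x (\<psi> x) (q x y (\<phi> y))) \<and>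
     ((\<lambda>s. surface_form \<rho> \<eta> q c s \<psi> \<phi>) has_vector_derivative
       weighted_form \<rho> q c (\<lambda>x y. deriv (\<lambda>s. soft_weight \<eta> s x y) t) \<psi> \<phi>) (at t))"

text \<open>\<open>C\<close> is an admissible constant in the hyperbolicity condition on the interval \<open>I\<close>. Finiteness of
  the right hand side is part of the inequality.\<close>

definition hyperbolicity_constant :: "'a::separable_complex_hilbert op measure \<Rightarrow>
    (real \<Rightarrow> 'a op \<Rightarrow> real) \<Rightarrow> 'a kernel \<Rightarrow> real \<Rightarrow> 'a wave set \<Rightarrow> real set \<Rightarrow> real \<Rightarrow> bool" where
  "hyperbolicity_constant \<rho> \<eta> q c Cvary I C \<longleftrightarrow> 0 < C \<and>
     (\<forall>t\<in>I. \<forall>\<psi>\<in>Cvary \<inter> L2_loc_t \<rho> \<eta>.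
        integrable (rho_t \<rho> \<eta> t) (\<lambda>x. Re (spin_scal x (\<psi> x) (\<psi> x))) \<and>
        Re (surface_form \<rho> \<eta> q c t \<psi> \<psi>)
          \<ge> 1 / C\<^sup>2 * (LINT x|rho_t \<rho> \<eta> t. Re (spin_scal x (\<psi> x) (\<psi> x))))"

definition hyperbolicity_condition :: "'a::separable_complex_hilbert op measure \<Rightarrow>
    (real \<Rightarrow> 'a op \<Rightarrow> real) \<Rightarrow> 'a kernel \<Rightarrow> real \<Rightarrow> 'a wave set \<Rightarrow> bool" where
  "hyperbolicity_condition \<rho> \<eta> q c Cvary \<longleftrightarrow>
     (\<forall>t0 t1. t0 \<le> t1 \<longrightarrow> (\<exists>C. hyperbolicity_constant \<rho> \<eta> q c Cvary {t0..t1} C))"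

definition test_space :: "'a::separable_complex_hilbert op measure \<Rightarrow> (real \<Rightarrow> 'a op \<Rightarrow> real) \<Rightarrow>
    'a kernel \<Rightarrow> real \<Rightarrow> 'a wave set \<Rightarrow> real \<Rightarrow> 'a wave set" where
  "test_space \<rho> \<eta> q c Cvary t = {\<psi> \<in> compactly_supported \<rho> Cvary.
     (\<forall>x\<in>spacetime \<rho>. (1 - \<eta> t x) *\<^sub>R \<psi> x = 0) \<and>
     (\<forall>t'\<ge>t. surface_norm \<rho> \<eta> q c t' \<psi> = 0)}"

end

theory Submission
  imports Defs "HOL-Computational_Algebra.Fundamental_Theorem_Algebra"
begin

text \<open>Differentiating the softened surface layer form in time and using the symmetry of the kernel
  shows that the energy \<open>E(t) = \<langle>\<phi>|\<phi>\<rangle>\<^sup>t\<close> satisfies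
  \<open>E' = 4 Im \<integral> \<prec>\<phi>|Q\<phi>\<succ> d\<rho>\<^sub>t\<close>. Test functions have zero energy at \<open>tmax\<close>, so that
  integrating backwards in time and using hyperbolicity, one obtains
  \<open>\<parallel>\<phi>\<parallel> \<le> \<Gamma> \<parallel>Q\<phi>\<parallel>\<close> in \<open>L\<^sup>2(L, SM)\<close>. Hence \<open>Q\<phi> \<mapsto> <\<phi>|w>\<close> is a bounded
  functional, and the Riesz representation theorem yields a solution after composing with the
  signature operators, which relate the spin inner product to the scalar product.

  A wave function \<open>\<psi>\<close> is
  represented by the Hilbert space valued section \<open>x \<mapsto> |x|\<^sup>1\<^sup>/\<^sup>2 \<psi>(x)\<close>.\<close>

section \<open>Complex Hilbert spaces\<close>

text \<open>Origin of \<open>\<Gamma>\<close>: let u and v be the squared norms of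
  \<open>\<phi>\<close> and \<open>Q \<phi>\<close> with respect to \<open>d\<rho>\<^sub>t\<close>,
  T = tmax - t0, and V the time integral of v. The flux formula and hyperbolicity give |E'| \<le> 4
  sqrt(u v) \<le> 4 C sqrt(E v), so formally sqrt(E) \<le> 2 C sqrt(T V). Integrating u \<le> C^2 E
  over time yields (2 C^2 T)^2 V. Time integrals of u and v are strip norms, because the weights
  \<open>\<theta>\<^sub>t\<close> integrate to \<open>eta_strip\<close>. Riesz needs a linear
  domain, whereas the condition on test functions is quadratic. The functional is set up on the
  larger set \<open>null_waves\<close> of waves with zero energy at \<open>tmax\<close>;
  nonnegativity of the energy makes it a complex vector space. \<open>Q \<phi>\<close> is an
  integral known to exist only at almost every point, so it is linear up to null sets and the
  functional becomes a relation. Roots and signs of the operators are computed in orthonormal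
  eigensystems, which exist by finite rank; the remaining difficulty is their measurable dependence
  on the point.\<close>

lemma cinner_add_left: "cinner (u + v) w = cinner u w + cinner v w"
  by (metis cinner_add_right cinner_commute complex_cnj_add)

lemma cinner_scaleC_left: "cinner (c *\<^sub>C u) v = cnj c * cinner u v"
  by (metis cinner_commute cinner_scaleC_right complex_cnj_mult)

lemma cinner_scaleR_right: "cinner u (scaleR a v) = scaleR a (cinner u v)"
  by (simp add: scaleR_scaleC cinner_scaleC_right scaleR_conv_of_real)

lemma cinner_scaleR_left: "cinner (scaleR a u) v = scaleR a (cinner u v)"
  by (simp add: scaleR_scaleC cinner_scaleC_left scaleR_conv_of_real)

lemma norm_scaleC: "norm (c *\<^sub>C u) = cmod c * norm u"
proof -
  have "complex_of_real ((norm (c *\<^sub>C u))\<^sup>2) = cnj c * c * complex_of_real ((norm u)\<^sup>2)"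
    by (simp only: cinner_self [symmetric] cinner_scaleC_left cinner_scaleC_right mult_ac)
  also have "\<dots> = complex_of_real ((cmod c * norm u)\<^sup>2)"
    by (simp only: complex_norm_square power_mult_distrib of_real_mult mult.commute)
  finally have "(norm (c *\<^sub>C u))\<^sup>2 = (cmod c * norm u)\<^sup>2"
    using of_real_eq_iff by blast
  then show ?thesis
    by (simp add: power2_eq_iff_nonneg)
qed

lemma cmod_cinner_le: "cmod (cinner u v) \<le> norm u * norm v"
proof (cases "u = 0")
  case True
  then show ?thesis
    using cinner_scaleC_left[of 0 0 v] by simp
next
  case False
  define a where "a = cinner u v / complex_of_real ((norm u)\<^sup>2)"
  define w where "w = v + (- a) *\<^sub>C u"
  have a: "a * complex_of_real ((norm u)\<^sup>2) = cinner u v"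
    using False by (simp add: a_def)
  have uw: "cinner u w = 0"
    using a by (simp only: w_def cinner_add_right cinner_scaleC_right cinner_self) simp
  have "v = w + a *\<^sub>C u"
    unfolding w_def by (simp add: add.assoc scaleC_add_left [symmetric])
  then have "cinner v v = cinner w w + cnj a * a * cinner u u"
    using uw cinner_commute[of w u]
    by (simp add: cinner_add_left cinner_add_right cinner_scaleC_left cinner_scaleC_right)
  then have "complex_of_real ((norm v)\<^sup>2) = complex_of_real ((norm w)\<^sup>2 + (cmod a)\<^sup>2 * (norm u)\<^sup>2)"
    by (simp only: cinner_self of_real_add of_real_mult complex_norm_square mult.commute)
  then have "(norm v)\<^sup>2 = (norm w)\<^sup>2 + (cmod a)\<^sup>2 * (norm u)\<^sup>2"
    using of_real_eq_iff by blast
  then have "(cmod a * norm u)\<^sup>2 \<le> (norm v)\<^sup>2"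
    by (simp add: power_mult_distrib)
  then have "cmod a * norm u \<le> norm v"
    by (meson norm_ge_zero power2_le_imp_le)
  moreover have "cmod (cinner u v) = cmod a * norm u * norm u"
    unfolding a [symmetric] by (simp add: norm_mult power2_eq_square)
  ultimately show ?thesis
    by (metis mult.commute mult_left_mono norm_ge_zero)
qed

lemma bounded_bilinear_cinner: "bounded_bilinear cinner"
  by (rule bounded_bilinear.intro)
    (auto simp: cinner_add_left cinner_add_right cinner_scaleR_left cinner_scaleR_right
      intro!: exI[of _ 1] cmod_cinner_le)

interpretation cinner: bounded_bilinear cinner
  by (rule bounded_bilinear_cinner)

declare cinner.zero_left [simp] cinner.zero_right [simp]

lemma bounded_linear_scaleC: "bounded_linear (\<lambda>u. c *\<^sub>C u)"
  by (rule bounded_linear_intro[where K = "cmod c"])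
    (auto simp: scaleC_add_right scaleR_scaleC scaleC_scaleC mult.commute norm_scaleC)

lemma cinner_eqI: "(\<And>w. cinner w u = cinner w v) \<Longrightarrow> u = v"
proof -
  assume "\<And>w. cinner w u = cinner w v"
  then have "cinner (u - v) (u - v) = 0"
    by (simp add: cinner.diff_right)
  then show "u = v"
    by (simp add: cinner_self)
qed

lemma Re_cinner_self: "Re (cinner u u) = (norm u)\<^sup>2"
  by (simp add: cinner_self)

text \<open>Operators are a priori only real linear. Complex linearity follows by testing against
  every vector, because the scalar product is complex linear in its second argument.\<close>

lemma selfadjoint_scaleC:
  assumes "selfadjoint T" shows "T (a *\<^sub>C u) = a *\<^sub>C T u"
  using assms unfolding selfadjoint_def
  by (intro cinner_eqI) (metis cinner_scaleC_right)

section \<open>Diagonalisation of selfadjoint operators of finite rank\<close>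

definition orthonormal :: "'a::separable_complex_hilbert set \<Rightarrow> bool" where
  "orthonormal B \<longleftrightarrow> (\<forall>e\<in>B. \<forall>f\<in>B. cinner e f = (if e = f then 1 else 0))"

lemma orthonormal_independent:
  assumes "orthonormal B"
  shows "complex_vector.independent B"
proof (rule ccontr)
  assume "\<not> complex_vector.independent B"
  then obtain S u v where S: "finite S" "S \<subseteq> B" "(\<Sum>v\<in>S. u v *\<^sub>C v) = 0" "v \<in> S" "u v \<noteq> 0"
    unfolding complex_vector.dependent_explicit by auto
  have "cinner v (\<Sum>w\<in>S. u w *\<^sub>C w) = (\<Sum>w\<in>S. if w = v then u v else 0)"
    unfolding cinner.sum_right
  proof (rule sum.cong[OF refl])
    fix w assume "w \<in> S"
    then have "cinner v w = (if v = w then 1 else 0)"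
      using assms S unfolding orthonormal_def by (meson subsetD)
    then show "cinner v (u w *\<^sub>C w) = (if w = v then u v else 0)"
      by (simp add: cinner_scaleC_right split: if_splits)
  qed
  also have "\<dots> = u v"
    using S by simp
  finally show False
    using S by simp
qed

section \<open>Polynomials of an operator and existence of eigenvectors\<close>

definition krylov_eval :: "'a::separable_complex_hilbert op \<Rightarrow> complex poly \<Rightarrow> 'a \<Rightarrow> 'a" where
  "krylov_eval T p u = (\<Sum>i\<le>degree p. coeff p i *\<^sub>C (blinfun_apply T ^^ i) u)"

lemma krylov_eval_upto:
  assumes "degree p \<le> N"
  shows "krylov_eval T p u = (\<Sum>i\<le>N. coeff p i *\<^sub>C (blinfun_apply T ^^ i) u)"
  unfolding krylov_eval_def
  by (rule sum.mono_neutral_left) (use assms in \<open>auto simp: coeff_eq_0\<close>)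

lemma funpow_op_add:
  fixes T :: "'a::separable_complex_hilbert op"
  shows "(blinfun_apply T ^^ i) (u + v) = (blinfun_apply T ^^ i) u + (blinfun_apply T ^^ i) v"
  by (induction i) (simp_all add: blinfun.add_right)

lemma funpow_op_scaleC:
  assumes "selfadjoint T"
  shows "(blinfun_apply T ^^ i) (a *\<^sub>C u) = a *\<^sub>C (blinfun_apply T ^^ i) u"
  by (induction i) (auto simp: selfadjoint_scaleC[OF assms])

text \<open>\<open>krylov_eval T p u\<close> is p(T) u. One linear factor moves from the polynomial
  to the vector, which makes an induction on the degree possible; pulling z through the iterates
  uses complex linearity of \<open>T\<close>.\<close>

lemma krylov_eval_linear_factor:
  assumes "selfadjoint T"
  shows "krylov_eval T ([:- z, 1:] * r) u = krylov_eval T r (T u + (- z) *\<^sub>C u)"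
proof -
  let ?N = "degree r"
  let ?p = "[:- z, 1:] * r"
  let ?x = "\<lambda>i. (blinfun_apply T ^^ i) u"
  have deg: "degree ?p \<le> Suc ?N"
    using degree_mult_le[of "[:- z, 1:]" r] by simp
  have p: "?p = smult (- z) r + pCons 0 r"
    by simp
  have "krylov_eval T ?p u = (\<Sum>i\<le>Suc ?N. coeff ?p i *\<^sub>C ?x i)"
    by (rule krylov_eval_upto[OF deg])
  also have "\<dots> = (\<Sum>i\<le>Suc ?N. (- z * coeff r i) *\<^sub>C ?x i) + (\<Sum>i\<le>Suc ?N. coeff (pCons 0 r) i *\<^sub>C ?x i)"
    unfolding p by (simp only: coeff_add coeff_smult scaleC_add_left sum.distrib)
  also have "(\<Sum>i\<le>Suc ?N. (- z * coeff r i) *\<^sub>C ?x i) = (\<Sum>i\<le>?N. coeff r i *\<^sub>C (- z) *\<^sub>C ?x i)"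
    by (simp add: coeff_eq_0 scaleC_scaleC mult.commute)
  also have "(\<Sum>i\<le>Suc ?N. coeff (pCons 0 r) i *\<^sub>C ?x i) = (\<Sum>i\<le>?N. coeff r i *\<^sub>C ?x (Suc i))"
    by (subst sum.atMost_Suc_shift) simp
  also have "(\<Sum>i\<le>?N. coeff r i *\<^sub>C (- z) *\<^sub>C ?x i) + \<dots> = krylov_eval T r (T u + (- z) *\<^sub>C u)"
    unfolding krylov_eval_def
    by (simp add: sum.distrib [symmetric] scaleC_add_right funpow_op_add funpow_op_scaleC[OF assms]
        funpow_swap1 add.commute del: complex_vector.scale_minus_left)
  finally show ?thesis .
qed

lemma krylov_eval_const: "krylov_eval T [:a:] u = a *\<^sub>C u"
  by (simp add: krylov_eval_def)

text \<open>Roots are split off one at a time. If z is a root of p, then either u is an eigenvector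
  to z, or (T - z) u is a non-zero vector annihilated by a polynomial of smaller degree. Staying in
  the range serves \<open>ex_eigenvector\<close>, where it excludes the eigenvalue zero.\<close>

lemma eigenvector_in_range:
  assumes T: "selfadjoint T"
  shows "p \<noteq> 0 \<Longrightarrow> krylov_eval T p u = 0 \<Longrightarrow> u \<noteq> 0 \<Longrightarrow> u \<in> range (blinfun_apply T)
    \<Longrightarrow> \<exists>v z. v \<noteq> 0 \<and> v \<in> range (blinfun_apply T) \<and> T v = z *\<^sub>C v"
proof (induction "degree p" arbitrary: p u rule: less_induct)
  case less
  show ?case
  proof (cases "degree p = 0")
    case True
    then obtain a where "p = [:a:]"
      using degree_eq_zeroE by blast
    then have "a *\<^sub>C u = 0" "a \<noteq> 0"
      using less by (auto simp: krylov_eval_const)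
    then show ?thesis
      using less.prems complex_vector.scale_eq_0_iff by blast
  next
    case False
    then have "\<not> constant (poly p)"
      by (simp add: constant_degree)
    then obtain z where "poly p z = 0"
      using fundamental_theorem_of_algebra by blast
    then obtain r where r: "p = [:- z, 1:] * r"
      by (meson dvdE poly_eq_0_iff_dvd)
    have r0: "r \<noteq> 0"
      using less.prems r by auto
    have "degree p = Suc (degree r)"
      unfolding r by (subst degree_mult_eq) (use r0 in auto)
    then have deg: "degree r < degree p"
      by simp
    let ?u = "T u + (- z) *\<^sub>C u"
    show ?thesis
    proof (cases "?u = 0")
      case True
      then have "T u = z *\<^sub>C u"
        by (metis add.inverse_inverse add_eq_0_iff complex_vector.scale_minus_left)
      then show ?thesis
        using less.prems by blast
    next
      case False
      obtain w where w: "u = T w"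
        using less.prems by auto
      \<comment> \<open>T - z commutes with T and therefore maps the range into itself.\<close>
      have "?u = T (T w + (- z) *\<^sub>C w)"
        unfolding w by (simp only: blinfun.add_right selfadjoint_scaleC[OF T])
      then have "?u \<in> range (blinfun_apply T)"
        by blast
      moreover have "krylov_eval T r ?u = 0"
        using krylov_eval_linear_factor[OF T] less.prems r by metis
      ultimately show ?thesis
        using less.hyps[OF deg r0] False by blast
    qed
  qed
qed

text \<open>\<open>card B + 1\<close> iterates in the span of \<open>B\<close> satisfy a linear
  relation, whose coefficients form p. Linear dependence is a statement about sets and misses
  coinciding iterates, so these are treated separately with p = X^i - X^j.\<close>

lemma krylov_annihilator:
  assumes T: "selfadjoint T" and fin: "finite B" "range (blinfun_apply T) \<subseteq> complex_vector.span B"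
    and u: "u \<in> range (blinfun_apply T)"
  shows "\<exists>p. p \<noteq> 0 \<and> krylov_eval T p u = 0"
proof -
  let ?x = "\<lambda>i. (blinfun_apply T ^^ i) u"
  let ?m = "card B"
  have ran: "?x i \<in> complex_vector.span B" for i
    using u fin by (cases i) auto
  show ?thesis
  proof (cases "inj_on ?x {..?m}")
    case True
    then have card: "card (?x ` {..?m}) = Suc ?m"
      by (simp add: card_image)
    have "\<not> complex_vector.independent (?x ` {..?m})"
      using complex_vector.independent_span_bound[OF fin(1)] ran card by (metis image_subsetI not_less_eq_eq order_refl)
    then obtain c v where c: "(\<Sum>v\<in>?x ` {..?m}. c v *\<^sub>C v) = 0" and v: "v \<in> ?x ` {..?m}" "c v \<noteq> 0"
      using complex_vector.dependent_finite[of "?x ` {..?m}"] by auto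
    define p where "p = (\<Sum>i\<le>?m. monom (c (?x i)) i)"
    have coeff: "coeff p i = (if i \<le> ?m then c (?x i) else 0)" for i
      unfolding p_def by (simp add: coeff_sum)
    have "degree p \<le> ?m"
      by (rule degree_le) (simp add: coeff)
    then have "krylov_eval T p u = (\<Sum>i\<le>?m. c (?x i) *\<^sub>C ?x i)"
      by (simp add: krylov_eval_upto coeff)
    also have "\<dots> = 0"
      using c by (simp add: sum.reindex[OF True])
    finally have "krylov_eval T p u = 0" .
    moreover have "p \<noteq> 0"
      using v coeff by (metis (mono_tags, lifting) atMost_iff coeff_0 image_iff)
    ultimately show ?thesis by blast
  next
    case False
    then obtain i j where ij: "i < j" "?x i = ?x j"
      unfolding inj_on_def by (metis linorder_neqE_nat)
    define p :: "complex poly" where "p = monom 1 i - monom 1 j"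
    have coeff: "coeff p k = (if k = i then 1 else 0) - (if k = j then 1 else 0)" for k
      unfolding p_def by (auto)
    have "degree p \<le> j"
      by (rule degree_le) (use ij in \<open>auto simp: coeff\<close>)
    then have "krylov_eval T p u = (\<Sum>k\<le>j. ((if k = i then 1 else 0) - (if k = j then 1 else 0)) *\<^sub>C ?x k)"
      by (simp add: krylov_eval_upto coeff)
    also have "\<dots> = (\<Sum>k\<le>j. (if k = i then ?x k else 0) - (if k = j then ?x k else 0))"
      by (rule sum.cong) (auto simp: scaleC_one complex_vector.scale_minus_left)
    also have "\<dots> = 0"
      using ij by (simp add: sum_subtractf)
    finally have "krylov_eval T p u = 0" .
    moreover have "p \<noteq> 0"
      using coeff[of i] ij by auto
    ultimately show ?thesis by blast
  qed
qed

lemma selfadjoint_real_eigenvalue: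
  assumes T: "selfadjoint T" and "T v = z *\<^sub>C v" "v \<noteq> 0"
  shows "z = complex_of_real (Re z)"
proof -
  have "cinner (T v) v = cinner v (T v)"
    using T unfolding selfadjoint_def by simp
  then have "cnj z * cinner v v = z * cinner v v"
    by (simp add: assms cinner_scaleC_left cinner_scaleC_right)
  then have "cnj z = z"
    using assms by (simp add: cinner_self)
  then show ?thesis
    by (simp add: complex_eq_iff)
qed

text \<open>An eigenvector v = T y with eigenvalue zero would satisfy <v|v> = <y|T v> = 0, so the
  search inside the range produces a non-zero eigenvalue.\<close>

lemma ex_eigenvector:
  assumes T: "selfadjoint T" and fin: "finite B" "range (blinfun_apply T) \<subseteq> complex_vector.span B"
    and nz: "T w \<noteq> 0"
  obtains e l where "norm e = 1" "l \<noteq> 0" "T e = complex_of_real l *\<^sub>C e"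
proof -
  obtain p where "p \<noteq> 0" "krylov_eval T p (T w) = 0"
    using krylov_annihilator[OF T fin] by blast
  then obtain v z where v: "v \<noteq> 0" "v \<in> range (blinfun_apply T)" "T v = z *\<^sub>C v"
    using eigenvector_in_range[OF T] nz by blast
  have z: "z = complex_of_real (Re z)"
    using selfadjoint_real_eigenvalue[OF T] v by blast
  have "z \<noteq> 0"
  proof
    assume "z = 0"
    then have "T v = 0" using v by simp
    moreover obtain y where "v = T y" using v by blast
    ultimately have "cinner v v = 0"
      using T unfolding selfadjoint_def by (metis cinner.zero_right)
    then show False using v by (simp add: cinner_self)
  qed
  define e where "e = complex_of_real (1 / norm v) *\<^sub>C v"
  have "norm e = 1"
    using v by (simp add: e_def norm_scaleC norm_divide)
  moreover have "T e = complex_of_real (Re z) *\<^sub>C e"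
    unfolding e_def selfadjoint_scaleC[OF T] v z[symmetric] by (simp add: scaleC_scaleC mult.commute)
  ultimately show ?thesis
    using that z \<open>z \<noteq> 0\<close> by (metis of_real_0)
qed

section \<open>Operators diagonal in a finite orthonormal system\<close>

definition diag :: "'a::separable_complex_hilbert set \<Rightarrow> ('a \<Rightarrow> real) \<Rightarrow> 'a op" where
  "diag B h = Blinfun (\<lambda>u. \<Sum>e\<in>B. (complex_of_real (h e) * cinner e u) *\<^sub>C e)"

lemma diag_apply: "diag B h u = (\<Sum>e\<in>B. (complex_of_real (h e) * cinner e u) *\<^sub>C e)"
proof -
  have "bounded_linear (\<lambda>u. \<Sum>e\<in>B. (complex_of_real (h e) * cinner e u) *\<^sub>C e)"
  proof (rule bounded_linear_sum)
    fix e
    show "bounded_linear (\<lambda>u. (complex_of_real (h e) * cinner e u) *\<^sub>C e)"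
    proof (rule bounded_linear_intro[where K = "\<bar>h e\<bar> * norm e * norm e"])
      fix u
      have "\<bar>h e\<bar> * cmod (cinner e u) * norm e \<le> \<bar>h e\<bar> * (norm e * norm u) * norm e"
        by (intro mult_right_mono mult_left_mono cmod_cinner_le) auto
      then show "norm ((complex_of_real (h e) * cinner e u) *\<^sub>C e) \<le> norm u * (\<bar>h e\<bar> * norm e * norm e)"
        by (simp add: norm_scaleC norm_mult mult_ac)
    qed (simp_all add: cinner.add_right cinner_scaleC_right distrib_left scaleC_add_left scaleR_scaleC
        scaleC_scaleC scaleR_conv_of_real mult_ac)
  qed
  then show ?thesis
    unfolding diag_def by (simp add: bounded_linear_Blinfun_apply)
qed

lemma selfadjoint_diag: "selfadjoint (diag B h)"
  unfolding selfadjoint_def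
proof (intro allI)
  fix u v
  have "cinner (diag B h u) v = (\<Sum>e\<in>B. complex_of_real (h e) * cinner u e * cinner e v)"
    unfolding diag_apply cinner.sum_left
    by (rule sum.cong) (auto simp: cinner_scaleC_left cinner_commute[of u])
  also have "\<dots> = cinner u (diag B h v)"
    unfolding diag_apply cinner.sum_right
    by (rule sum.cong) (auto simp: cinner_scaleC_right)
  finally show "cinner (diag B h u) v = cinner u (diag B h v)" .
qed

lemma cinner_diag:
  assumes "finite B" "orthonormal B" "e \<in> B"
  shows "cinner e (diag B h u) = complex_of_real (h e) * cinner e u"
proof -
  have "cinner e (diag B h u) = (\<Sum>f\<in>B. if f = e then complex_of_real (h e) * cinner e u else 0)"
    unfolding diag_apply cinner.sum_right
    using assms unfolding orthonormal_def by (intro sum.cong) (auto simp: cinner_scaleC_right)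
  then show ?thesis
    using assms by simp
qed

lemma diag_diag:
  assumes "finite B" "orthonormal B"
  shows "diag B h (diag B k u) = diag B (\<lambda>e. h e * k e) u"
  unfolding diag_apply[of B h] diag_apply[of B "\<lambda>e. h e * k e"]
  by (rule sum.cong) (auto simp: cinner_diag[OF assms] mult_ac)

lemma diag_eqI:
  assumes "finite B" "orthonormal B" "\<And>e. e \<in> B \<Longrightarrow> h e = k e"
  shows "diag B h = diag B k"
  by (rule blinfun_eqI) (auto simp: diag_apply assms intro!: sum.cong)

text \<open>\<open>B\<close> spans the range of \<open>T\<close>, and \<open>diag\<close> vanishes
  on its orthogonal complement. Excluding the eigenvalue zero allows division by \<open>l e\<close>
  and keeps \<open>B\<close> finite in infinite dimensions.\<close>

definition eigensystem :: "'a::separable_complex_hilbert op \<Rightarrow> 'a set \<Rightarrow> ('a \<Rightarrow> real) \<Rightarrow> bool" where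
  "eigensystem T B l \<longleftrightarrow> finite B \<and> orthonormal B \<and> (\<forall>e\<in>B. l e \<noteq> 0) \<and> T = diag B l"

text \<open>A maximal orthonormal set of eigenvectors to non-zero eigenvalues exhausts the range, because
  otherwise the remainder of the operator has a further eigenvector.\<close>

lemma ex_eigensystem:
  assumes T: "selfadjoint T" and "finite_rank T"
  shows "\<exists>B l. eigensystem T B l"
proof -
  obtain A where A: "finite A" "range (blinfun_apply T) \<subseteq> complex_vector.span A"
    using assms unfolding finite_rank_def by blast
  define P where "P B \<longleftrightarrow> finite B \<and> orthonormal B \<and> (\<forall>e\<in>B. \<exists>l::real. l \<noteq> 0 \<and> T e = complex_of_real l *\<^sub>C e)" for B
  \<comment> \<open>Eigenvectors to non-zero eigenvalues lie in the range. Orthonormality makes them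
    independent, so \<open>card A\<close> bounds the size of such systems and a largest one
    exists.\<close>
  have span_eig: "e \<in> complex_vector.span A" if "l \<noteq> 0" "T e = complex_of_real l *\<^sub>C e" for e l
  proof -
    have "T (complex_of_real (1/l) *\<^sub>C e) = e"
      using that by (simp add: selfadjoint_scaleC[OF T] scaleC_scaleC scaleC_one)
    then show ?thesis
      using A by (metis rangeI subsetD)
  qed
  have card: "card B \<le> card A" if "P B" for B
    using that span_eig orthonormal_independent complex_vector.independent_span_bound[OF A(1)]
    unfolding P_def by (metis subsetI)
  have "P {}"
    by (simp add: P_def orthonormal_def)
  then obtain B where B: "P B" and max: "\<And>B'. P B' \<Longrightarrow> card B' \<le> card B"
    using ex_has_greatest_nat[of P "{}" card "Suc (card A)"] card
    by (metis le_imp_less_Suc)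
  then obtain l where l: "\<And>e. e \<in> B \<Longrightarrow> l e \<noteq> 0 \<and> T e = complex_of_real (l e) *\<^sub>C e"
    unfolding P_def by metis
  have fB: "finite B" and oB: "orthonormal B"
    using B unfolding P_def by auto
  \<comment> \<open>Deflation: \<open>Y\<close> annihilates \<open>B\<close>, so by selfadjointness
    an eigenvector of \<open>Y\<close> to a non-zero eigenvalue is orthogonal to \<open>B\<close>.
    There \<open>diag B l\<close> vanishes, which makes it an eigenvector of \<open>T\<close> as
    well.\<close>
  define Y where "Y = T - diag B l"
  have Y_apply: "Y u = T u - diag B l u" for u
    by (simp add: Y_def blinfun.diff_left)
  have Y: "selfadjoint Y"
    using T selfadjoint_diag[of B l] unfolding selfadjoint_def Y_apply
    by (simp add: cinner.diff_left cinner.diff_right)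
  have Ye: "Y e = 0" if "e \<in> B" for e
  proof -
    have "diag B l e = (\<Sum>f\<in>B. if f = e then complex_of_real (l e) *\<^sub>C e else 0)"
      unfolding diag_apply using oB that unfolding orthonormal_def by (intro sum.cong) auto
    also have "\<dots> = complex_of_real (l e) *\<^sub>C e"
      using that fB by simp
    finally show ?thesis using l that Y_apply by simp
  qed
  have ran: "range (blinfun_apply Y) \<subseteq> complex_vector.span A"
  proof
    fix v assume "v \<in> range (blinfun_apply Y)"
    then obtain u where v: "v = T u - diag B l u" using Y_apply by auto
    have "diag B l u \<in> complex_vector.span A"
      unfolding diag_apply by (intro complex_vector.span_sum complex_vector.span_scale) (use l span_eig in blast)
    then show "v \<in> complex_vector.span A"
      unfolding v using A by (auto intro: complex_vector.span_diff)
  qed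
  have "Y w = 0" for w
  proof (rule ccontr)
    assume "Y w \<noteq> 0"
    then obtain e m where e: "norm e = 1" "m \<noteq> 0" "Y e = complex_of_real m *\<^sub>C e"
      using ex_eigenvector[OF Y A(1) ran] by metis
    have orth: "cinner f e = 0" if "f \<in> B" for f
    proof -
      have "complex_of_real m * cinner f e = cinner f (Y e)"
        using e by (simp add: cinner_scaleC_right)
      also have "\<dots> = cinner (Y f) e"
        using Y unfolding selfadjoint_def by simp
      finally show ?thesis using Ye that e by (simp add: cinner.zero_left)
    qed
    have orth': "cinner e f = 0" if "f \<in> B" for f
      using orth[OF that] cinner_commute[of e f] by simp
    have ee: "cinner e e = 1"
      using e by (simp add: cinner_self)
    have eB: "e \<notin> B"
      using orth ee by auto
    have "diag B l e = 0"
      unfolding diag_apply using orth by simp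
    then have "T e = complex_of_real m *\<^sub>C e"
      using e Y_apply[of e] by simp
    then have "P (insert e B)"
      using B ee orth orth' e eB unfolding P_def orthonormal_def by auto
    then have "card (insert e B) \<le> card B"
      by (rule max)
    then show False
      using eB fB by simp
  qed
  then have "Y = 0"
    by (intro blinfun_eqI) simp
  then have "T = diag B l"
    unfolding Y_def by simp
  then show ?thesis
    unfolding eigensystem_def using fB oB l by blast
qed

section \<open>Absolute value, square root and sign of an operator\<close>

lemma diag_unit:
  assumes "finite B" "orthonormal B" "e \<in> B"
  shows "diag B h e = complex_of_real (h e) *\<^sub>C e"
proof -
  have "diag B h e = (\<Sum>f\<in>B. if f = e then complex_of_real (h e) *\<^sub>C e else 0)"
    unfolding diag_apply
    using assms unfolding orthonormal_def by (intro sum.cong) auto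
  then show ?thesis
    using assms by simp
qed

lemma diag_comp:
  assumes "finite B" "orthonormal B"
  shows "diag B h o\<^sub>L diag B k = diag B (\<lambda>e. h e * k e)"
  by (rule blinfun_eqI) (simp add: diag_diag[OF assms])

lemma diag_scaleR: "r *\<^sub>R diag B h = diag B (\<lambda>e. r * h e)"
  by (rule blinfun_eqI)
    (simp add: diag_apply blinfun.scaleR_left scaleR_scaleC complex_vector.scale_sum_right scaleC_scaleC mult.assoc)

lemma diag_diff: "diag B h - diag B k = diag B (\<lambda>e. h e - k e)"
  by (rule blinfun_eqI)
    (simp add: diag_apply blinfun.diff_left sum_subtractf [symmetric] left_diff_distrib
      complex_vector.scale_left_diff_distrib)

lemma positive_diag:
  assumes "finite B" "orthonormal B" "\<And>e. e \<in> B \<Longrightarrow> 0 \<le> h e"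
  shows "positive_op (diag B h)"
proof -
  have "diag B h = diag B (\<lambda>e. sqrt (h e)) o\<^sub>L diag B (\<lambda>e. sqrt (h e))"
    unfolding diag_comp[OF assms(1,2)] by (rule diag_eqI) (use assms in auto)
  then have "cinner u (diag B h u) = cinner (diag B (\<lambda>e. sqrt (h e)) u) (diag B (\<lambda>e. sqrt (h e)) u)" for u
    using selfadjoint_diag[of B "\<lambda>e. sqrt (h e)"] unfolding selfadjoint_def by simp
  then show ?thesis
    by (simp add: positive_op_def selfadjoint_diag Re_cinner_self)
qed

text \<open>With m = sqrt (h e), the equation (S + m)(S - m) e = 0 shows that v = S e - m e
  satisfies S v = - m v, and positivity of S leaves only v = 0. On vectors orthogonal to
  \<open>B\<close> the square of S vanishes, hence so does S by selfadjointness. Uniqueness is what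
  turns the definite description \<open>op_sqrt\<close> into an explicit operator.\<close>

lemma positive_sqrt_unique:
  assumes B: "finite B" "orthonormal B" and h: "\<And>e. e \<in> B \<Longrightarrow> 0 < h e"
    and S: "positive_op S" "S o\<^sub>L S = diag B h"
  shows "S = diag B (\<lambda>e. sqrt (h e))"
proof (rule blinfun_eqI)
  fix u
  have sa: "selfadjoint S" using S unfolding positive_op_def by simp
  have SS: "S (S v) = diag B h v" for v
    using S(2) by (metis blinfun_apply_blinfun_compose)
  have Se: "S e = complex_of_real (sqrt (h e)) *\<^sub>C e" if "e \<in> B" for e
  proof -
    define m where "m = sqrt (h e)"
    have m: "m > 0" "m * m = h e"
      using h[OF that] by (auto simp: m_def)
    define v where "v = S e - complex_of_real m *\<^sub>C e"
    have "S v = diag B h e - complex_of_real m *\<^sub>C S e"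
      unfolding v_def by (simp add: blinfun.diff_right selfadjoint_scaleC[OF sa] SS)
    also have "diag B h e = complex_of_real m *\<^sub>C complex_of_real m *\<^sub>C e"
      unfolding diag_unit[OF B that] scaleC_scaleC by (simp add: m of_real_mult [symmetric] del: of_real_mult)
    finally have "S v = - (complex_of_real m *\<^sub>C v)"
      unfolding v_def by (simp add: complex_vector.scale_right_diff_distrib)
    then have "Re (cinner v (S v)) = - m * (norm v)\<^sup>2"
      by (simp add: cinner.minus_right cinner_scaleC_right cinner_self)
    moreover have "0 \<le> Re (cinner v (S v))"
      using S(1) unfolding positive_op_def by simp
    ultimately have "v = 0"
      using m by (simp add: mult_le_0_iff)
    then show ?thesis
      unfolding v_def m_def by simp
  qed
  define k where "k = u - (\<Sum>e\<in>B. cinner e u *\<^sub>C e)"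
  have orth: "cinner e k = 0" if "e \<in> B" for e
    using cinner_diag[OF B that, of "\<lambda>_. 1" u] unfolding diag_apply k_def by (simp add: cinner.diff_right)
  have "diag B h k = 0"
    unfolding diag_apply using orth by simp
  then have "cinner (S k) (S k) = 0"
    using sa SS[of k] unfolding selfadjoint_def by simp
  then have "S k = 0"
    by (simp add: cinner_self)
  have "S u = S k + S (\<Sum>e\<in>B. cinner e u *\<^sub>C e)"
    unfolding k_def blinfun.add_right [symmetric] by simp
  also have "\<dots> = (\<Sum>e\<in>B. cinner e u *\<^sub>C S e)"
    using \<open>S k = 0\<close> by (simp add: blinfun.sum_right selfadjoint_scaleC[OF sa])
  also have "\<dots> = diag B (\<lambda>e. sqrt (h e)) u"
    unfolding diag_apply by (rule sum.cong) (auto simp: Se scaleC_scaleC mult.commute)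
  finally show "S u = diag B (\<lambda>e. sqrt (h e)) u" .
qed

lemma op_sqrt_diag:
  assumes B: "finite B" "orthonormal B" and h: "\<And>e. e \<in> B \<Longrightarrow> 0 < h e"
  shows "op_sqrt (diag B h) = diag B (\<lambda>e. sqrt (h e))"
  unfolding op_sqrt_def
proof (rule the_equality)
  have "diag B (\<lambda>e. sqrt (h e)) o\<^sub>L diag B (\<lambda>e. sqrt (h e)) = diag B h"
    unfolding diag_comp[OF B] by (rule diag_eqI) (use B h in \<open>auto simp: less_imp_le\<close>)
  then show "positive_op (diag B (\<lambda>e. sqrt (h e))) \<and> diag B (\<lambda>e. sqrt (h e)) o\<^sub>L diag B (\<lambda>e. sqrt (h e)) = diag B h"
    using positive_diag[OF B] h by (simp add: less_imp_le)
next
  fix S :: "'a op"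
  assume "positive_op S \<and> S o\<^sub>L S = diag B h"
  then show "S = diag B (\<lambda>e. sqrt (h e))"
    using positive_sqrt_unique[OF B, of h S] h by blast
qed

abbreviation sqrt_abs :: "'a::separable_complex_hilbert op \<Rightarrow> 'a op" where
  "sqrt_abs x \<equiv> op_sqrt (op_abs x)"

lemma eigensystem_op_abs:
  assumes "eigensystem x B l"
  shows "op_abs x = diag B (\<lambda>e. \<bar>l e\<bar>)"
proof -
  have B: "finite B" "orthonormal B" and l: "\<And>e. e \<in> B \<Longrightarrow> l e \<noteq> 0" and x: "x = diag B l"
    using assms unfolding eigensystem_def by auto
  have "x o\<^sub>L x = diag B (\<lambda>e. (l e)\<^sup>2)"
    by (rule blinfun_eqI) (simp add: x diag_diag[OF B] power2_eq_square)
  then show ?thesis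
    unfolding op_abs_def using op_sqrt_diag[OF B, of "\<lambda>e. (l e)\<^sup>2"] l by simp
qed

lemma eigensystem_sqrt_abs:
  assumes "eigensystem x B l"
  shows "sqrt_abs x = diag B (\<lambda>e. sqrt \<bar>l e\<bar>)"
  unfolding eigensystem_op_abs[OF assms]
  using assms by (intro op_sqrt_diag) (auto simp: eigensystem_def)

text \<open>The signature operator is obtained as the strong limit of the Newton iteration for the sign
  function. Being a limit of polynomials in \<open>x\<close>, it preserves measurability of sections.\<close>

primrec newton_sgn :: "nat \<Rightarrow> real \<Rightarrow> real" where
  "newton_sgn 0 t = t"
| "newton_sgn (Suc k) t = (3 * newton_sgn k t - newton_sgn k t ^ 3) / 2"

lemma newton_sgn_minus: "newton_sgn k (- t) = - newton_sgn k t"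
  by (induction k) (simp_all add: field_simps)

text \<open>The iteration is increasing and bounded by 1, so it converges. The limit is a fixed
  point of s \<mapsto> (3 s - s^3) / 2, that is 0, 1 or -1, and the lower bound t > 0 leaves only
  1.\<close>

lemma newton_sgn_pos:
  assumes "0 < t" "t \<le> 1"
  shows "(\<lambda>k. newton_sgn k t) \<longlonglongrightarrow> 1"
proof -
  let ?s = "\<lambda>k. newton_sgn k t"
  have step: "s \<le> (3 * s - s ^ 3) / 2 \<and> (3 * s - s ^ 3) / 2 \<le> 1" if "0 < s" "s \<le> 1" for s :: real
  proof
    have "(3 * s - s ^ 3) / 2 - s = s * (1 - s * s) / 2"
      by (simp add: field_simps power3_eq_cube)
    also have "\<dots> \<ge> 0"
      using that by (simp add: mult_le_one)
    finally show "s \<le> (3 * s - s ^ 3) / 2" by simp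
    have "1 - (3 * s - s ^ 3) / 2 = (1 - s)\<^sup>2 * (2 + s) / 2"
      by (simp add: field_simps power3_eq_cube power2_eq_square)
    also have "\<dots> \<ge> 0"
      using that by simp
    finally show "(3 * s - s ^ 3) / 2 \<le> 1" by simp
  qed
  have bnd: "t \<le> ?s k \<and> ?s k \<le> 1" for k
  proof (induction k)
    case (Suc k)
    then show ?case using step[of "?s k"] assms by auto
  qed (use assms in auto)
  have "incseq ?s"
    using bnd step assms by (intro incseq_SucI) (simp, smt (verit, best))
  then obtain L where L: "?s \<longlonglongrightarrow> L"
    using incseq_convergent[of ?s 1] bnd by blast
  have tL: "t \<le> L" "L \<le> 1"
    using LIMSEQ_le_const[OF L] LIMSEQ_le_const2[OF L] bnd by blast+
  have "(\<lambda>k. ?s (Suc k)) \<longlonglongrightarrow> (3 * L - L ^ 3) / 2"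
    unfolding newton_sgn.simps by (intro tendsto_intros L) simp
  then have "(3 * L - L ^ 3) / 2 = L"
    using LIMSEQ_unique LIMSEQ_Suc[OF L] by blast
  then have "L * (1 - L * L) = 0"
    by (simp add: field_simps power3_eq_cube)
  then have "L * L = 1"
    using tL assms by simp
  then have "L = 1"
    using tL assms by (metis abs_of_pos abs_one abs_square_eq_1 less_le_trans power2_eq_square)
  then show "?s \<longlonglongrightarrow> 1"
    using L by simp
qed

lemma newton_sgn_tendsto:
  assumes "t \<noteq> 0" "\<bar>t\<bar> \<le> 1"
  shows "(\<lambda>k. newton_sgn k t) \<longlonglongrightarrow> sgn t"
proof (cases "0 < t")
  case True
  then show ?thesis using newton_sgn_pos assms by simp
next
  case False
  then have "(\<lambda>k. newton_sgn k (- t)) \<longlonglongrightarrow> 1"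
    using newton_sgn_pos assms by simp
  then have "(\<lambda>k. - newton_sgn k t) \<longlonglongrightarrow> 1"
    by (simp add: newton_sgn_minus)
  from tendsto_minus[OF this] show ?thesis
    using False assms by simp
qed

text \<open>Dividing by \<open>1 + norm x\<close> brings all eigenvalues into [-1, 1], where the
  iteration converges; unlike division by the norm, this is continuous at \<open>x = 0\<close>
  too.\<close>

primrec newton_op :: "nat \<Rightarrow> 'a::separable_complex_hilbert op \<Rightarrow> 'a op" where
  "newton_op 0 x = (1 / (1 + norm x)) *\<^sub>R x"
| "newton_op (Suc k) x = (3/2) *\<^sub>R newton_op k x - (1/2) *\<^sub>R (newton_op k x o\<^sub>L newton_op k x o\<^sub>L newton_op k x)"

definition sgn_op :: "'a::separable_complex_hilbert op \<Rightarrow> 'a \<Rightarrow> 'a" where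
  "sgn_op x u = lim (\<lambda>k. newton_op k x u)"

lemma newton_op_diag:
  assumes B: "finite B" "orthonormal B"
  shows "newton_op k (diag B l) = diag B (\<lambda>e. newton_sgn k (l e / (1 + norm (diag B l))))"
proof (induction k)
  case 0
  show ?case
    by (simp add: diag_scaleR)
next
  case (Suc k)
  show ?case
    unfolding newton_op.simps Suc diag_comp[OF B] diag_scaleR diag_diff
    by (rule diag_eqI[OF B]) (simp add: field_simps power3_eq_cube)
qed

lemma eigensystem_bound:
  assumes "eigensystem x B l" "e \<in> B"
  shows "\<bar>l e\<bar> \<le> norm x"
proof -
  have B: "finite B" "orthonormal B" and x: "x = diag B l"
    using assms unfolding eigensystem_def by auto
  have "cinner e e = 1"
    using B assms unfolding orthonormal_def by auto
  then have "norm e = 1"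
    using Re_cinner_self[of e] power2_eq_iff_nonneg[of "norm e" 1] by simp
  then have "norm (x e) = \<bar>l e\<bar>"
    unfolding x diag_unit[OF B assms(2)] by (simp add: norm_scaleC)
  then show ?thesis
    using norm_blinfun[of x e] \<open>norm e = 1\<close> by simp
qed

text \<open>In a fixed eigensystem the iteration acts on each eigenvalue separately, and a finite
  sum with convergent coefficients converges. The positive rescaling does not change the
  sign.\<close>

lemma newton_op_tendsto_diag:
  assumes "eigensystem x B l"
  shows "(\<lambda>k. newton_op k x u) \<longlonglongrightarrow> diag B (\<lambda>e. sgn (l e)) u"
proof -
  have B: "finite B" "orthonormal B" and l: "\<And>e. e \<in> B \<Longrightarrow> l e \<noteq> 0" and x: "x = diag B l"
    using assms unfolding eigensystem_def by auto
  have lim: "(\<lambda>k. newton_sgn k (l e / (1 + norm x))) \<longlonglongrightarrow> sgn (l e)" if "e \<in> B" for e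
  proof -
    have "1 + norm x > 0"
      using norm_ge_zero[of x] by linarith
    moreover have "sgn (l e / (1 + norm x)) = sgn (l e)"
      using \<open>1 + norm x > 0\<close> by (simp add: sgn_divide)
    moreover have "\<bar>l e / (1 + norm x)\<bar> \<le> 1"
      using eigensystem_bound[OF assms that] \<open>1 + norm x > 0\<close> by (simp add: abs_divide divide_simps)
    ultimately show ?thesis
      using newton_sgn_tendsto[of "l e / (1 + norm x)"] l[OF that] by simp
  qed
  have ap: "newton_op k x u = (\<Sum>e\<in>B. newton_sgn k (l e / (1 + norm x)) *\<^sub>R cinner e u *\<^sub>C e)" for k
    using newton_op_diag[OF B, of k l] unfolding x [symmetric]
    by (simp add: diag_apply scaleR_scaleC scaleC_scaleC)
  have "(\<lambda>k. newton_op k x u) \<longlonglongrightarrow> (\<Sum>e\<in>B. sgn (l e) *\<^sub>R cinner e u *\<^sub>C e)"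
    unfolding ap by (intro tendsto_sum tendsto_scaleR lim tendsto_const)
  then show ?thesis
    by (simp add: diag_apply scaleR_scaleC scaleC_scaleC)
qed

lemma eigensystem_sgn_op:
  assumes "eigensystem x B l"
  shows "sgn_op x u = diag B (\<lambda>e. sgn (l e)) u"
  unfolding sgn_op_def by (rule limI[OF newton_op_tendsto_diag[OF assms]])

lemma eigensystem_in_range:
  assumes "eigensystem x B l"
  shows "diag B k u \<in> spin_space x"
proof -
  have B: "finite B" "orthonormal B" and l: "\<And>e. e \<in> B \<Longrightarrow> l e \<noteq> 0" and x: "x = diag B l"
    using assms unfolding eigensystem_def by auto
  have "diag B k u = x (diag B (\<lambda>e. k e / l e) u)"
    unfolding x diag_diag[OF B] using l by (auto simp: diag_apply intro!: sum.cong)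
  then show ?thesis by simp
qed

section \<open>Spin inner product and scalar product at a single point\<close>

locale regular_point =
  fixes x :: "'a::separable_complex_hilbert op"
  assumes sa: "selfadjoint x" and fr: "finite_rank x"
begin

lemma spin_scal_eq: "spin_scal x u v = cinner (sqrt_abs x u) (sqrt_abs x v)"
proof -
  obtain B l where E: "eigensystem x B l" using ex_eigensystem[OF sa fr] by blast
  then have B: "finite B" "orthonormal B" unfolding eigensystem_def by auto
  have "cinner (sqrt_abs x u) (sqrt_abs x v) = cinner u (diag B (\<lambda>e. sqrt \<bar>l e\<bar>) (diag B (\<lambda>e. sqrt \<bar>l e\<bar>) v))"
    using selfadjoint_diag unfolding eigensystem_sqrt_abs[OF E] selfadjoint_def by blast
  then show ?thesis
    unfolding diag_diag[OF B] spin_scal_def eigensystem_op_abs[OF E] by simp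
qed

text \<open>x = |x|^(1/2) sgn(x) |x|^(1/2), since all factors are diagonal in the same system. The
  minus sign comes from the definition of the spin inner product.\<close>

lemma spin_prod_eq: "spin_prod x u v = - cinner (sqrt_abs x u) (sgn_op x (sqrt_abs x v))"
proof -
  obtain B l where E: "eigensystem x B l" using ex_eigensystem[OF sa fr] by blast
  then have B: "finite B" "orthonormal B" and x: "x = diag B l" unfolding eigensystem_def by auto
  have "cinner (sqrt_abs x u) (sgn_op x (sqrt_abs x v))
    = cinner u (diag B (\<lambda>e. sqrt \<bar>l e\<bar>) (diag B (\<lambda>e. sgn (l e)) (diag B (\<lambda>e. sqrt \<bar>l e\<bar>) v)))"
    using selfadjoint_diag unfolding eigensystem_sqrt_abs[OF E] eigensystem_sgn_op[OF E] selfadjoint_def by blast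
  also have "\<dots> = cinner u (diag B l v)"
    unfolding diag_diag[OF B]
    by (rule arg_cong[where f = "\<lambda>T. cinner u (blinfun_apply T v)"], rule diag_eqI[OF B])
      (simp add: sgn_if)
  finally show ?thesis
    unfolding spin_prod_def x by simp
qed

lemma sqrt_abs_in: "sqrt_abs x u \<in> spin_space x"
  using ex_eigensystem[OF sa fr] eigensystem_in_range eigensystem_sqrt_abs by metis

lemma sgn_op_in: "sgn_op x u \<in> spin_space x"
  using ex_eigensystem[OF sa fr] eigensystem_in_range eigensystem_sgn_op by metis

text \<open>This is what turns a Hilbert space valued section back into a wave function.\<close>

lemma sqrt_abs_surj:
  assumes "f \<in> spin_space x"
  obtains v where "v \<in> spin_space x" "sqrt_abs x v = f"
proof -
  obtain B l where E: "eigensystem x B l" using ex_eigensystem[OF sa fr] by blast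
  then have B: "finite B" "orthonormal B" and l: "\<And>e. e \<in> B \<Longrightarrow> l e \<noteq> 0" and x: "x = diag B l"
    unfolding eigensystem_def by auto
  obtain w where w: "f = diag B l w" using assms x by auto
  \<comment> \<open>The preimage is |x|^(-1/2) f, with f = x w inserted.\<close>
  have "sqrt_abs x (diag B (\<lambda>e. l e / sqrt \<bar>l e\<bar>) w) = f"
    unfolding eigensystem_sqrt_abs[OF E] w diag_diag[OF B]
    by (rule arg_cong[where f = "\<lambda>T. blinfun_apply T w"], rule diag_eqI[OF B]) (use l in simp)
  then show ?thesis
    using that eigensystem_in_range[OF E] by blast
qed

lemma sgn_op_sgn_op:
  assumes "f \<in> spin_space x"
  shows "sgn_op x (sgn_op x f) = f"
proof -
  obtain B l where E: "eigensystem x B l" using ex_eigensystem[OF sa fr] by blast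
  then have B: "finite B" "orthonormal B" and l: "\<And>e. e \<in> B \<Longrightarrow> l e \<noteq> 0" and x: "x = diag B l"
    unfolding eigensystem_def by auto
  obtain w where w: "f = diag B l w" using assms x by auto
  show ?thesis
    unfolding eigensystem_sgn_op[OF E] w diag_diag[OF B]
    by (rule arg_cong[where f = "\<lambda>T. blinfun_apply T w"], rule diag_eqI[OF B]) (use l in \<open>simp add: sgn_if\<close>)
qed

lemma sgn_op_selfadjoint: "cinner (sgn_op x u) v = cinner u (sgn_op x v)"
proof -
  obtain B l where E: "eigensystem x B l" using ex_eigensystem[OF sa fr] by blast
  show ?thesis
    using selfadjoint_diag unfolding eigensystem_sgn_op[OF E] selfadjoint_def by blast
qed

lemma sgn_op_minus: "sgn_op x (- u) = - sgn_op x u"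
proof -
  obtain B l where E: "eigensystem x B l" using ex_eigensystem[OF sa fr] by blast
  show ?thesis
    unfolding eigensystem_sgn_op[OF E] by (rule blinfun.minus_right)
qed

text \<open>\<open>sgn_op x\<close> is a partial isometry. Its square is the identity on the spin
  space, where it therefore preserves norms, and the Cauchy-Schwarz inequality for <u|sgn sgn u>
  gives the bound elsewhere.\<close>

lemma norm_sgn_op_le: "norm (sgn_op x u) \<le> norm u"
proof -
  have "(norm (sgn_op x u))\<^sup>2 = cmod (cinner (sgn_op x u) (sgn_op x u))"
    by (simp add: cinner_self norm_power)
  also have "\<dots> = cmod (cinner u (sgn_op x (sgn_op x u)))"
    by (simp add: sgn_op_selfadjoint)
  also have "\<dots> \<le> norm u * norm (sgn_op x (sgn_op x u))"
    by (rule cmod_cinner_le)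
  also have "norm (sgn_op x (sgn_op x u)) = norm (sgn_op x u)"
  proof -
    have "cinner (sgn_op x (sgn_op x u)) (sgn_op x (sgn_op x u)) = cinner (sgn_op x u) (sgn_op x u)"
      by (metis sgn_op_selfadjoint sgn_op_sgn_op sgn_op_in)
    then show ?thesis
      by (simp add: cinner_self power2_eq_iff_nonneg flip: of_real_power)
  qed
  finally have "norm (sgn_op x u) * norm (sgn_op x u) \<le> norm u * norm (sgn_op x u)"
    by (simp add: power2_eq_square)
  then show ?thesis
    by (cases "norm (sgn_op x u) = 0") (auto simp: mult_le_cancel_right)
qed

lemma newton_op_tendsto: "(\<lambda>k. newton_op k x u) \<longlonglongrightarrow> sgn_op x u"
  using ex_eigensystem[OF sa fr] newton_op_tendsto_diag eigensystem_sgn_op by metis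

lemma sqrt_abs_scaleC: "sqrt_abs x (a *\<^sub>C u) = a *\<^sub>C sqrt_abs x u"
  using ex_eigensystem[OF sa fr] eigensystem_sqrt_abs selfadjoint_scaleC selfadjoint_diag by metis

end

section \<open>Square integrable functions and the Riesz representation theorem\<close>

definition sq_integrable :: "'b measure \<Rightarrow> ('b \<Rightarrow> 'a::separable_complex_hilbert) \<Rightarrow> bool" where
  "sq_integrable M f \<longleftrightarrow> f \<in> borel_measurable M \<and> integrable M (\<lambda>x. (norm (f x))\<^sup>2)"

text \<open>Only the real part is kept, so that the representation theorem is one over the reals;
  the complex identity is recovered by inserting multiples by \<open>\<i>\<close>. On functions,
  without passing to classes, the form is only semidefinite.\<close>

definition l2_ip :: "'b measure \<Rightarrow> ('b \<Rightarrow> 'a) \<Rightarrow> ('b \<Rightarrow> 'a::separable_complex_hilbert) \<Rightarrow> real" where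
  "l2_ip M f g = (LINT x|M. Re (cinner (f x) (g x)))"

lemma borel_measurable_cinner [measurable]:
  assumes "f \<in> borel_measurable M" "g \<in> borel_measurable M"
  shows "(\<lambda>x. cinner (f x) (g x)) \<in> borel_measurable M"
  using assms by (rule borel_measurable_continuous_Pair)
    (intro cinner.continuous_on continuous_on_fst continuous_on_snd continuous_on_id)

lemma sq_integrable_cinner:
  assumes "sq_integrable M f" "sq_integrable M g"
  shows "integrable M (\<lambda>x. cinner (f x) (g x))"
proof (rule Bochner_Integration.integrable_bound[where f = "\<lambda>x. (norm (f x))\<^sup>2 + (norm (g x))\<^sup>2"])
  show "integrable M (\<lambda>x. (norm (f x))\<^sup>2 + (norm (g x))\<^sup>2)"
    using assms unfolding sq_integrable_def by simp
  show "(\<lambda>x. cinner (f x) (g x)) \<in> borel_measurable M"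
    using assms unfolding sq_integrable_def by (intro borel_measurable_cinner) auto
  have "cmod (cinner (f x) (g x)) \<le> (norm (f x))\<^sup>2 + (norm (g x))\<^sup>2" for x
  proof -
    have "2 * norm (f x) * norm (g x) \<le> (norm (f x))\<^sup>2 + (norm (g x))\<^sup>2"
      by (rule sum_squares_bound)
    moreover have "0 \<le> norm (f x) * norm (g x)" by simp
    ultimately show ?thesis
      using cmod_cinner_le[of "f x" "g x"] by linarith
  qed
  then show "AE x in M. norm (cinner (f x) (g x)) \<le> norm ((norm (f x))\<^sup>2 + (norm (g x))\<^sup>2)"
    by (auto intro!: AE_I2 order_trans[OF _ abs_ge_self])
qed

lemma sq_integrable_Re_cinner:
  assumes "sq_integrable M f" "sq_integrable M g"
  shows "integrable M (\<lambda>x. Re (cinner (f x) (g x)))"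
  using sq_integrable_cinner[OF assms] by (rule integrable_Re)

lemma norm_add_square:
  fixes u v :: "'a::separable_complex_hilbert"
  shows "(norm (u + v))\<^sup>2 = (norm u)\<^sup>2 + 2 * Re (cinner u v) + (norm v)\<^sup>2"
proof -
  have "Re (cinner v u) = Re (cinner u v)"
    by (metis cinner_commute cnj.simps(1))
  then show ?thesis
    by (simp add: Re_cinner_self [symmetric] cinner.add_left cinner.add_right)
qed

lemma sq_integrable_add:
  assumes "sq_integrable M f" "sq_integrable M g"
  shows "sq_integrable M (\<lambda>x. f x + g x)"
  using assms sq_integrable_Re_cinner[OF assms] unfolding sq_integrable_def norm_add_square
  by (auto intro: borel_measurable_add)

lemma sq_integrable_scaleR:
  assumes "sq_integrable M f"
  shows "sq_integrable M (\<lambda>x. c *\<^sub>R f x)"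
  using assms unfolding sq_integrable_def
  by (auto simp: power_mult_distrib intro: borel_measurable_scaleR)

lemma sq_integrable_diff:
  assumes "sq_integrable M f" "sq_integrable M g"
  shows "sq_integrable M (\<lambda>x. f x - g x)"
  using sq_integrable_add[OF assms(1) sq_integrable_scaleR[OF assms(2), of "-1"]] by simp

lemma l2_ip_self: "l2_ip M f f = (LINT x|M. (norm (f x))\<^sup>2)"
  unfolding l2_ip_def Re_cinner_self ..

lemma l2_ip_self_nonneg: "0 \<le> l2_ip M f f"
  unfolding l2_ip_self by simp

lemma l2_ip_scaleR: "l2_ip M (\<lambda>x. c *\<^sub>R f x) g = c * l2_ip M f g"
  unfolding l2_ip_def by (simp add: cinner_scaleR_left)

lemma l2_ip_commute: "l2_ip M f g = l2_ip M g f"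
  unfolding l2_ip_def by (metis cinner_commute cnj.simps(1))

lemma l2_ip_diff:
  assumes "sq_integrable M f" "sq_integrable M g" "sq_integrable M h"
  shows "l2_ip M (\<lambda>x. f x - g x) h = l2_ip M f h - l2_ip M g h"
  unfolding l2_ip_def cinner.diff_left using assms by (simp add: sq_integrable_Re_cinner)

lemma l2_ip_add_scaleR_self:
  assumes "sq_integrable M f" "sq_integrable M g"
  shows "l2_ip M (\<lambda>x. f x + s *\<^sub>R g x) (\<lambda>x. f x + s *\<^sub>R g x) = l2_ip M f f + 2 * s * l2_ip M f g + s\<^sup>2 * l2_ip M g g"
proof -
  have "l2_ip M (\<lambda>x. f x + s *\<^sub>R g x) (\<lambda>x. f x + s *\<^sub>R g x)
     = (LINT x|M. (norm (f x))\<^sup>2 + 2 * s * Re (cinner (f x) (g x)) + s\<^sup>2 * (norm (g x))\<^sup>2)"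
    unfolding l2_ip_self norm_add_square
    by (simp add: cinner_scaleR_right power_mult_distrib mult.assoc)
  also have "\<dots> = l2_ip M f f + 2 * s * l2_ip M f g + s\<^sup>2 * l2_ip M g g"
    using assms sq_integrable_Re_cinner[OF assms] unfolding l2_ip_self unfolding l2_ip_def sq_integrable_def by simp
  finally show ?thesis .
qed

text \<open>The case \<open>c = 0\<close> has to be covered because \<open>l2_ip\<close> is only
  semidefinite. With \<open>a = 0\<close> the conclusion reads \<open>b = 0\<close>, the first-order
  condition at a minimum.\<close>

lemma quadratic_nonneg_imp_discriminant:
  fixes a b c :: real
  assumes "\<And>s. 0 \<le> a + 2 * s * b + s\<^sup>2 * c" "0 \<le> c"
  shows "b\<^sup>2 \<le> a * c"
proof (cases "c = 0")
  case True
  have "b = 0"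
  proof (rule ccontr)
    assume "b \<noteq> 0"
    \<comment> \<open>For \<open>c = 0\<close> the expression is affine in s; this choice of s gives
      it the value -1.\<close>
    have "0 \<le> a + 2 * (- (a + 1) / (2 * b)) * b"
      using assms(1)[of "- (a + 1) / (2 * b)"] True by simp
    also have "\<dots> = - 1"
      using \<open>b \<noteq> 0\<close> by (simp add: field_simps)
    finally show False by simp
  qed
  then show ?thesis using True by simp
next
  case False
  then have "0 \<le> a + 2 * (- b / c) * b + (- b / c)\<^sup>2 * c"
    using assms by blast
  also have "\<dots> = (a * c - b\<^sup>2) / c"
    using False by (simp add: field_simps power2_eq_square)
  finally show ?thesis
    using False assms(2) by (simp add: zero_le_divide_iff)
qed

lemma l2_Cauchy_Schwarz:
  assumes "sq_integrable M f" "sq_integrable M g"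
  shows "\<bar>l2_ip M f g\<bar> \<le> sqrt (l2_ip M f f) * sqrt (l2_ip M g g)"
proof -
  have "(l2_ip M f g)\<^sup>2 \<le> l2_ip M f f * l2_ip M g g"
    using l2_ip_add_scaleR_self[OF assms, symmetric] l2_ip_self_nonneg
    by (intro quadratic_nonneg_imp_discriminant) (simp_all)
  then show ?thesis
    by (metis real_sqrt_abs real_sqrt_le_mono real_sqrt_mult)
qed

text \<open>By the inequality of arithmetic and geometric means,
  \<open>2 ^ n * (d n)\<^sup>2 + (1/2) ^ n\<close> dominates \<open>d n\<close>.\<close>

lemma summable_of_weighted_squares:
  fixes d :: "nat \<Rightarrow> real"
  assumes "summable (\<lambda>n. 2 ^ n * (d n)\<^sup>2)" "\<And>n. 0 \<le> d n"
  shows "summable d"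
proof (rule summable_comparison_test')
  show "summable (\<lambda>n. 2 ^ n * (d n)\<^sup>2 + (1/2) ^ n)"
    using assms(1) by (intro summable_add summable_geometric) auto
  fix n
  have "2 * (sqrt (2 ^ n) * d n) * sqrt ((1/2) ^ n) \<le> (sqrt (2 ^ n) * d n)\<^sup>2 + (sqrt ((1/2) ^ n))\<^sup>2"
    by (rule sum_squares_bound)
  also have "(sqrt (2 ^ n) * d n)\<^sup>2 + (sqrt ((1/2) ^ n))\<^sup>2 = 2 ^ n * (d n)\<^sup>2 + (1/2) ^ n"
    by (simp add: power_mult_distrib)
  also have "2 * (sqrt (2 ^ n) * d n) * sqrt ((1/2) ^ n) = 2 * d n * sqrt (2 ^ n * (1/2) ^ n)"
    unfolding real_sqrt_mult by simp
  also have "(2::real) ^ n * (1/2) ^ n = 1"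
    by (simp add: power_mult_distrib [symmetric])
  finally show "norm (d n) \<le> 2 ^ n * (d n)\<^sup>2 + (1/2) ^ n"
    using assms(2)[of n] by simp
qed

text \<open>The rate (1/4)^n survives the weights 2^n: the weighted squared increments have finite
  total integral, so almost everywhere the increments are summable and the sequence converges.
  Fatou's lemma carries the rate over to the limit. Minimising sequences can be selected with this
  rate, so no subsequences occur.\<close>

lemma l2_complete:
  fixes f :: "nat \<Rightarrow> 'b \<Rightarrow> 'a::separable_complex_hilbert"
  assumes f: "\<And>n. sq_integrable M (f n)"
    and cauchy: "\<And>n m. n \<le> m \<Longrightarrow> l2_ip M (\<lambda>x. f m x - f n x) (\<lambda>x. f m x - f n x) \<le> (1/4) ^ n"
  obtains V where "sq_integrable M V" "(\<lambda>n. l2_ip M (\<lambda>x. f n x - V x) (\<lambda>x. f n x - V x)) \<longlonglongrightarrow> 0"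
proof -
  have [measurable]: "f n \<in> borel_measurable M" for n
    using f unfolding sq_integrable_def by simp
  \<comment> \<open>Where no limit exists, \<open>lim\<close> has an unspecified value;
    \<open>V\<close> is measurable all the same, and the exceptional points form a null set.\<close>
  define V where "V x = lim (\<lambda>n. f n x)" for x
  have [measurable]: "V \<in> borel_measurable M"
    unfolding V_def by measurable
  have nn: "(\<integral>\<^sup>+x. ennreal ((norm (f m x - f n x))\<^sup>2) \<partial>M) \<le> ennreal ((1/4) ^ n)" if "n \<le> m" for n m
  proof -
    have "integrable M (\<lambda>x. (norm (f m x - f n x))\<^sup>2)"
      using sq_integrable_diff[OF f f] unfolding sq_integrable_def by blast
    then have "(\<integral>\<^sup>+x. ennreal ((norm (f m x - f n x))\<^sup>2) \<partial>M) = ennreal (LINT x|M. (norm (f m x - f n x))\<^sup>2)"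
      by (intro nn_integral_eq_integral) auto
    then show ?thesis
      using cauchy[OF that] unfolding l2_ip_self by (simp add: ennreal_leI)
  qed
  have "(\<integral>\<^sup>+x. (\<Sum>n. ennreal (2 ^ n * (norm (f (Suc n) x - f n x))\<^sup>2)) \<partial>M)
      = (\<Sum>n. \<integral>\<^sup>+x. ennreal (2 ^ n * (norm (f (Suc n) x - f n x))\<^sup>2) \<partial>M)"
    by (rule nn_integral_suminf) simp
  also have "\<dots> \<le> (\<Sum>n. ennreal ((1/2) ^ n))"
  proof (intro suminf_le allI)
    fix n
    have "(\<integral>\<^sup>+x. ennreal (2 ^ n * (norm (f (Suc n) x - f n x))\<^sup>2) \<partial>M)
       = ennreal (2 ^ n) * (\<integral>\<^sup>+x. ennreal ((norm (f (Suc n) x - f n x))\<^sup>2) \<partial>M)"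
      by (subst nn_integral_cmult [symmetric]) (auto simp: ennreal_mult')
    also have "\<dots> \<le> ennreal (2 ^ n) * ennreal ((1/4) ^ n)"
      by (intro mult_left_mono nn) auto
    also have "\<dots> = ennreal ((1/2) ^ n)"
      by (simp add: ennreal_mult' [symmetric] power_mult_distrib [symmetric])
    finally show "(\<integral>\<^sup>+x. ennreal (2 ^ n * (norm (f (Suc n) x - f n x))\<^sup>2) \<partial>M) \<le> ennreal ((1/2) ^ n)" .
  qed auto
  also have "\<dots> < \<infinity>"
    using summable_geometric[of "1/2 :: real"]
    by (subst suminf_ennreal2) auto
  finally have "AE x in M. (\<Sum>n. ennreal (2 ^ n * (norm (f (Suc n) x - f n x))\<^sup>2)) \<noteq> \<infinity>"
    by (intro nn_integral_PInf_AE) auto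
  then have lim: "AE x in M. (\<lambda>n. f n x) \<longlonglongrightarrow> V x"
  proof eventually_elim
    case (elim x)
    then have "summable (\<lambda>n. 2 ^ n * (norm (f (Suc n) x - f n x))\<^sup>2)"
      by (intro summable_suminf_not_top) auto
    then have "summable (\<lambda>n. norm (f (Suc n) x - f n x))"
      by (rule summable_of_weighted_squares) simp
    then have "summable (\<lambda>n. f (Suc n) x - f n x)"
      by (rule summable_norm_cancel)
    then have "convergent (\<lambda>n. (\<Sum>i<n. f (Suc i) x - f i x))"
      by (simp add: summable_iff_convergent)
    then have "convergent (\<lambda>n. f n x - f 0 x)"
      unfolding sum_lessThan_telescope[of "\<lambda>i. f i x"] .
    then have "convergent (\<lambda>n. (f n x - f 0 x) + f 0 x)"
      by (intro convergent_add convergent_const)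
    then show ?case
      unfolding V_def by (simp add: convergent_LIMSEQ_iff)
  qed
  have fatou: "(\<integral>\<^sup>+x. ennreal ((norm (V x - f n x))\<^sup>2) \<partial>M) \<le> ennreal ((1/4) ^ n)" for n
  proof -
    have "(\<integral>\<^sup>+x. ennreal ((norm (V x - f n x))\<^sup>2) \<partial>M)
        = (\<integral>\<^sup>+x. liminf (\<lambda>m. ennreal ((norm (f m x - f n x))\<^sup>2)) \<partial>M)"
    proof (rule nn_integral_cong_AE)
      show "AE x in M. ennreal ((norm (V x - f n x))\<^sup>2) = liminf (\<lambda>m. ennreal ((norm (f m x - f n x))\<^sup>2))"
        using lim
      proof eventually_elim
        case (elim x)
        then have "(\<lambda>m. ennreal ((norm (f m x - f n x))\<^sup>2)) \<longlonglongrightarrow> ennreal ((norm (V x - f n x))\<^sup>2)"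
          by (intro tendsto_ennrealI tendsto_intros)
        then show ?case
          by (rule lim_imp_Liminf[OF trivial_limit_sequentially, symmetric])
      qed
    qed
    also have "\<dots> \<le> liminf (\<lambda>m. \<integral>\<^sup>+x. ennreal ((norm (f m x - f n x))\<^sup>2) \<partial>M)"
      by (rule nn_integral_liminf) simp
    also have "\<dots> \<le> liminf (\<lambda>m. ennreal ((1/4) ^ n))"
      by (rule Liminf_mono) (use nn in \<open>auto simp: eventually_sequentially\<close>)
    also have "\<dots> = ennreal ((1/4) ^ n)"
      by (simp add: Liminf_const)
    finally show ?thesis .
  qed
  have diff: "sq_integrable M (\<lambda>x. V x - f n x)" for n
    unfolding sq_integrable_def
  proof
    show "integrable M (\<lambda>x. (norm (V x - f n x))\<^sup>2)"
      using fatou[of n] by (intro integrableI_bounded) (auto intro: le_less_trans)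
  qed measurable
  have V: "sq_integrable M V"
    using sq_integrable_add[OF diff[of 0] f[of 0]] by simp
  have "l2_ip M (\<lambda>x. f n x - V x) (\<lambda>x. f n x - V x) \<le> (1/4) ^ n" for n
  proof -
    have "ennreal (LINT x|M. (norm (V x - f n x))\<^sup>2) = (\<integral>\<^sup>+x. ennreal ((norm (V x - f n x))\<^sup>2) \<partial>M)"
      using diff[of n] unfolding sq_integrable_def by (intro nn_integral_eq_integral [symmetric]) auto
    then have "ennreal (LINT x|M. (norm (V x - f n x))\<^sup>2) \<le> ennreal ((1/4) ^ n)"
      using fatou[of n] by simp
    then show ?thesis
      unfolding l2_ip_self by (simp add: norm_minus_commute)
  qed
  then have "(\<lambda>n. l2_ip M (\<lambda>x. f n x - V x) (\<lambda>x. f n x - V x)) \<longlonglongrightarrow> 0"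
    by (intro tendsto_sandwich[OF _ _ tendsto_const LIMSEQ_power_zero[of "1/4 :: real"]] always_eventually allI
        l2_ip_self_nonneg) simp_all
  with V show ?thesis using that by blast
qed

text \<open>The functional is given by its graph \<open>G\<close>, which avoids passing to equivalence classes of
  functions. The representing vector is the limit of a minimising sequence of
  \<open>\<parallel>f\<parallel>\<^sup>2 - 2 l\<close> on \<open>G\<close>.\<close>

lemma l2_Riesz:
  fixes G :: "(('b \<Rightarrow> 'a::separable_complex_hilbert) \<times> real) set"
  assumes ne: "(f0, l0) \<in> G"
    and sq: "\<And>f l. (f, l) \<in> G \<Longrightarrow> sq_integrable M f"
    and lin: "\<And>f l g m a b. (f, l) \<in> G \<Longrightarrow> (g, m) \<in> G \<Longrightarrow> (\<lambda>x. a *\<^sub>R f x + b *\<^sub>R g x, a * l + b * m) \<in> G"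
    and bound: "\<And>f l. (f, l) \<in> G \<Longrightarrow> l \<le> K * sqrt (l2_ip M f f)" and K: "0 \<le> K"
  shows "\<exists>V. sq_integrable M V \<and> (\<forall>f l. (f, l) \<in> G \<longrightarrow> l2_ip M f V = l) \<and> sqrt (l2_ip M V V) \<le> K"
proof -
  define J where "J p = l2_ip M (fst p) (fst p) - 2 * snd p" for p :: "('b \<Rightarrow> 'a) \<times> real"
  \<comment> \<open>Completing the square: a^2 - 2 K a \<ge> - K^2.\<close>
  have Jb: "- (K\<^sup>2) \<le> J p" if "p \<in> G" for p
  proof -
    obtain f l where p: "p = (f, l)" by force
    define a where "a = sqrt (l2_ip M f f)"
    have "l \<le> K * a" "l2_ip M f f = a\<^sup>2"
      using bound that p l2_ip_self_nonneg[of M f] by (auto simp: a_def)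
    moreover have "0 \<le> (a - K)\<^sup>2" by simp
    ultimately show ?thesis
      unfolding J_def p by (simp add: power2_eq_square algebra_simps)
  qed
  define i where "i = Inf (J ` G)"
  have bdd: "bdd_below (J ` G)"
    using Jb by (intro bdd_belowI) auto
  have iJ: "i \<le> J p" if "p \<in> G" for p
    unfolding i_def using that bdd by (intro cInf_lower) auto
  \<comment> \<open>The slack is made for the parallelogram law, which bounds the squared distance
    of two members by twice the sum of their slacks. For n \<le> m this is at most (1/4)^n, the rate
    asked for by \<open>l2_complete\<close>.\<close>
  have "\<exists>p\<in>G. J p \<le> i + (1/4) ^ n / 4" for n
  proof -
    have "\<exists>y\<in>J ` G. y < i + (1/4) ^ n / 4"
      unfolding i_def by (rule cInf_lessD) (use ne in auto)
    then show ?thesis by (auto intro: less_imp_le)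
  qed
  then obtain p where p: "\<And>n. p n \<in> G" "\<And>n. J (p n) \<le> i + (1/4) ^ n / 4"
    by metis
  define f where "f n = fst (p n)" for n
  define l where "l n = snd (p n)" for n
  have fl: "(f n, l n) \<in> G" for n
    using p unfolding f_def l_def by simp
  have fs: "sq_integrable M (f n)" for n
    using sq fl by blast
  have Jfl: "J (f n, l n) \<le> i + (1/4) ^ n / 4" for n
    using p unfolding f_def l_def by simp
  have "l2_ip M (\<lambda>x. f m x - f n x) (\<lambda>x. f m x - f n x) \<le> (1/4) ^ n" if "n \<le> m" for n m
  proof -
    have mid: "(\<lambda>x. (1/2) *\<^sub>R f m x + (1/2) *\<^sub>R f n x, 1/2 * l m + 1/2 * l n) \<in> G"
      by (rule lin[OF fl fl])
    have "l2_ip M (\<lambda>x. (1/2) *\<^sub>R f m x + (1/2) *\<^sub>R f n x) (\<lambda>x. (1/2) *\<^sub>R f m x + (1/2) *\<^sub>R f n x)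
       = l2_ip M (\<lambda>x. (1/2) *\<^sub>R (f m x + 1 *\<^sub>R f n x)) (\<lambda>x. (1/2) *\<^sub>R (f m x + 1 *\<^sub>R f n x))"
      by (simp add: scaleR_add_right)
    also have "\<dots> = (1/4) * l2_ip M (\<lambda>x. f m x + 1 *\<^sub>R f n x) (\<lambda>x. f m x + 1 *\<^sub>R f n x)"
      unfolding l2_ip_scaleR by (subst l2_ip_commute, unfold l2_ip_scaleR) simp
    also have "\<dots> = (1/4) * (l2_ip M (f m) (f m) + 2 * l2_ip M (f m) (f n) + l2_ip M (f n) (f n))"
      using l2_ip_add_scaleR_self[OF fs fs, where s = 1] by simp
    finally have "4 * i \<le> l2_ip M (f m) (f m) + 2 * l2_ip M (f m) (f n) + l2_ip M (f n) (f n) - 4 * (l m + l n)"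
      using iJ[OF mid] unfolding J_def by simp
    moreover have "l2_ip M (\<lambda>x. f m x - f n x) (\<lambda>x. f m x - f n x)
        = l2_ip M (f m) (f m) - 2 * l2_ip M (f m) (f n) + l2_ip M (f n) (f n)"
      using l2_ip_add_scaleR_self[OF fs fs, where s = "-1"] by simp
    moreover have "(1/4) ^ m \<le> (1/4 :: real) ^ n"
      using that by (intro power_decreasing) auto
    moreover have "D \<le> e'" if "4 * i \<le> a + 2 * b + c - 4 * (k + k')" "D = a - 2 * b + c" "e \<le> e'"
      "a - 2 * k \<le> i + e / 4" "c - 2 * k' \<le> i + e' / 4" for a b c k k' D e e' :: real
      using that by (simp add: algebra_simps)
    ultimately show ?thesis
      using Jfl[of m] Jfl[of n] unfolding J_def fst_conv snd_conv by blast
  qed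
  from l2_complete[OF fs this] obtain V where V: "sq_integrable M V"
    and lim: "(\<lambda>n. l2_ip M (\<lambda>x. f n x - V x) (\<lambda>x. f n x - V x)) \<longlonglongrightarrow> 0"
    by blast
  have weak: "(\<lambda>n. l2_ip M (f n) g) \<longlonglongrightarrow> l2_ip M V g" if g: "sq_integrable M g" for g
  proof -
    have "(\<lambda>n. l2_ip M (\<lambda>x. f n x - V x) g) \<longlonglongrightarrow> 0"
    proof (rule Lim_null_comparison)
      show "\<forall>\<^sub>F n in sequentially. norm (l2_ip M (\<lambda>x. f n x - V x) g)
          \<le> sqrt (l2_ip M (\<lambda>x. f n x - V x) (\<lambda>x. f n x - V x)) * sqrt (l2_ip M g g)"
        using l2_Cauchy_Schwarz[OF sq_integrable_diff[OF fs V] g] by simp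
      show "(\<lambda>n. sqrt (l2_ip M (\<lambda>x. f n x - V x) (\<lambda>x. f n x - V x)) * sqrt (l2_ip M g g)) \<longlonglongrightarrow> 0"
        using tendsto_mult[OF tendsto_real_sqrt[OF lim] tendsto_const[of "sqrt (l2_ip M g g)"]] by simp
    qed
    then have "(\<lambda>n. l2_ip M (f n) g - l2_ip M V g) \<longlonglongrightarrow> 0"
      unfolding l2_ip_diff[OF fs V g] .
    then show ?thesis
      by (rule LIM_zero_cancel)
  qed
  have rep: "l2_ip M g V = m" if gm: "(g, m) \<in> G" for g m
  proof -
    have g: "sq_integrable M g" using sq gm by blast
    define c where "c = l2_ip M V g - m"
    define N where "N = l2_ip M g g"
    have N: "0 \<le> N" unfolding N_def by (rule l2_ip_self_nonneg)
    \<comment> \<open>Moving from \<open>f n\<close> by s in the direction g cannot push J below its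
      infimum. Letting n tend to infinity removes the slack and leaves a quadratic in s without
      constant term, so its linear coefficient vanishes.\<close>
    have "0 \<le> 2 * s * c + s\<^sup>2 * N" for s
    proof (rule LIMSEQ_le[OF tendsto_const])
      show "\<exists>k. \<forall>n\<ge>k. 0 \<le> (1/4) ^ n / 4 + 2 * s * (l2_ip M (f n) g - m) + s\<^sup>2 * N"
      proof (intro exI allI impI)
        fix n
        have "(\<lambda>x. 1 *\<^sub>R f n x + s *\<^sub>R g x, 1 * l n + s * m) \<in> G"
          by (rule lin[OF fl gm])
        from iJ[OF this] have "i \<le> l2_ip M (f n) (f n) + 2 * s * l2_ip M (f n) g + s\<^sup>2 * N - 2 * (l n + s * m)"
          unfolding J_def N_def using l2_ip_add_scaleR_self[OF fs g] by simp
        then show "0 \<le> (1/4) ^ n / 4 + 2 * s * (l2_ip M (f n) g - m) + s\<^sup>2 * N"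
          using Jfl[of n] unfolding J_def by (simp add: algebra_simps)
      qed
      have "(\<lambda>n. (1/4) ^ n / 4 + 2 * s * (l2_ip M (f n) g - m) + s\<^sup>2 * N) \<longlonglongrightarrow> 0 / 4 + 2 * s * c + s\<^sup>2 * N"
        unfolding c_def by (intro tendsto_intros weak[OF g] LIMSEQ_power_zero) auto
      then show "(\<lambda>n. (1/4) ^ n / 4 + 2 * s * (l2_ip M (f n) g - m) + s\<^sup>2 * N) \<longlonglongrightarrow> 2 * s * c + s\<^sup>2 * N"
        by simp
    qed
    then have "c\<^sup>2 \<le> 0 * N"
      using N by (intro quadratic_nonneg_imp_discriminant) auto
    then show ?thesis
      unfolding c_def by (simp add: l2_ip_commute)
  qed
  \<comment> \<open>\<open>V\<close> need not occur in the graph. The bound is applied to the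
    approximants, whose functional values are their products with \<open>V\<close>, and then passes
    to the limit.\<close>
  have "l2_ip M V V \<le> K * sqrt (l2_ip M V V)"
  proof (rule LIMSEQ_le)
    show "(\<lambda>n. l2_ip M (f n) V) \<longlonglongrightarrow> l2_ip M V V"
      by (rule weak[OF V])
    have "l2_ip M (f n) (f n) = l2_ip M (\<lambda>x. f n x - V x) (\<lambda>x. f n x - V x) + 2 * l2_ip M (f n) V - l2_ip M V V" for n
      using l2_ip_add_scaleR_self[OF fs V, where s = "-1"] by simp
    then have "(\<lambda>n. l2_ip M (f n) (f n)) \<longlonglongrightarrow> 0 + 2 * l2_ip M V V - l2_ip M V V"
      by (simp only:) (intro tendsto_intros lim weak[OF V])
    then have lim': "(\<lambda>n. l2_ip M (f n) (f n)) \<longlonglongrightarrow> l2_ip M V V"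
      by simp
    show "(\<lambda>n. K * sqrt (l2_ip M (f n) (f n))) \<longlonglongrightarrow> K * sqrt (l2_ip M V V)"
      by (intro tendsto_intros lim')
    show "\<exists>N. \<forall>n\<ge>N. l2_ip M (f n) V \<le> K * sqrt (l2_ip M (f n) (f n))"
      using rep[OF fl] bound[OF fl] by auto
  qed
  then have "sqrt (l2_ip M V V) * sqrt (l2_ip M V V) \<le> K * sqrt (l2_ip M V V)"
    using l2_ip_self_nonneg[of M V] by simp
  then have "sqrt (l2_ip M V V) \<le> K"
    using l2_ip_self_nonneg[of M V] K mult_right_le_imp_le[of "sqrt (l2_ip M V V)" "sqrt (l2_ip M V V)" K]
    by (cases "l2_ip M V V = 0") auto
  then show ?thesis
    using V rep by blast
qed

section \<open>Spacetime and the time function\<close>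

locale cfs =
  fixes n :: nat and F :: "'a::separable_complex_hilbert op set" and \<rho> :: "'a op measure"
  assumes cfs: "causal_fermion_system n F \<rho>"
begin

abbreviation "S \<equiv> spacetime \<rho>"
abbreviation "M \<equiv> on_M \<rho>"

lemma space_rho: "space \<rho> = F"
  and sets_rho: "sets \<rho> = sets (restrict_space borel F)"
  and locally_finite_rho: "locally_finite \<rho>"
  and submanifold_F: "\<exists>k. smooth_submanifold k F"
  and F_ops: "\<forall>x\<in>F. selfadjoint x \<and> finite_rank x \<and> num_pos_eigenvalues x = n \<and> num_neg_eigenvalues x = n"
  using cfs unfolding causal_fermion_system_def by blast+

lemma spacetime_subset: "S \<subseteq> F"
  unfolding spacetime_def space_rho by auto

lemma regular_point: "x \<in> S \<Longrightarrow> regular_point x"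
  using F_ops spacetime_subset by (intro regular_point.intro) blast+

text \<open>Within \<open>F\<close>, the complement of \<open>S\<close> is covered by the open sets
  that meet \<open>F\<close> in measure zero, so \<open>S\<close> is relatively closed.\<close>

lemma spacetime_sets: "S \<in> sets \<rho>"
proof -
  define \<O> where "\<O> = {U. open U \<and> emeasure \<rho> (U \<inter> space \<rho>) = 0}"
  have "S = F \<inter> (- \<Union>\<O>)"
    unfolding spacetime_def \<O>_def space_rho by (auto simp: zero_less_iff_neq_zero)
  moreover have "open (\<Union>\<O>)"
    unfolding \<O>_def by auto
  ultimately show ?thesis
    unfolding sets_rho sets_restrict_space by auto
qed

lemma space_M [simp]: "space M = S"
  using spacetime_subset by (simp add: space_restrict_space space_rho Int_absorb2)

lemma sets_M: "sets M = sets (restrict_space borel S)"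
  using sets_restrict_space_cong[OF sets_rho, of S] sets_restrict_restrict_space[of borel F S] spacetime_subset
  by (simp add: Int_absorb1)

lemma borel_measurable_M_continuous:
  fixes f :: "'a op \<Rightarrow> 'b::topological_space"
  assumes "continuous_on S f"
  shows "f \<in> borel_measurable M"
  unfolding measurable_cong_sets[OF sets_M refl] using assms by (rule borel_measurable_continuous_on_restrict)

text \<open>A submanifold is second countable, hence Lindelof, so countably many of the
  neighbourhoods of finite measure cover \<open>F\<close>. This makes the theorems of Fubini and
  Tonelli available.\<close>

lemma sigma_finite_rho: "sigma_finite_measure \<rho>"
proof
  have "Lindelof_space (top_of_set F)"
    using submanifold_F unfolding smooth_submanifold_def
    by (blast intro: second_countable_imp_Lindelof_space)
  moreover define \<U> where "\<U> = {V. \<exists>U. open U \<and> V = U \<inter> F \<and> emeasure \<rho> V < \<infinity>}"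
  have "\<forall>V\<in>\<U>. openin (top_of_set F) V"
    unfolding \<U>_def openin_open by auto
  moreover have "\<Union>\<U> = F"
    using locally_finite_rho unfolding locally_finite_def \<U>_def space_rho by blast
  ultimately obtain \<V> where V: "countable \<V>" "\<V> \<subseteq> \<U>" "\<Union>\<V> = F"
    unfolding Lindelof_space_def by (metis topspace_euclidean_subtopology)
  have "\<U> \<subseteq> sets \<rho>"
    unfolding \<U>_def sets_rho sets_restrict_space by auto
  moreover have "\<forall>a\<in>\<V>. emeasure \<rho> a \<noteq> \<infinity>"
    using V(2) unfolding \<U>_def by fastforce
  ultimately show "\<exists>A. countable A \<and> A \<subseteq> sets \<rho> \<and> \<Union> A = space \<rho> \<and> (\<forall>a\<in>A. emeasure \<rho> a \<noteq> \<infinity>)"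
    unfolding space_rho using V by (intro exI[of _ \<V>] conjI) (assumption | blast)+
qed

lemma sigma_finite_M: "sigma_finite_measure M"
  by (rule sigma_finite_measure_restrict_space[OF sigma_finite_rho spacetime_sets])

sublocale M: sigma_finite_measure M
  by (rule sigma_finite_M)

sublocale MM: pair_sigma_finite M M ..

text \<open>Operators with the norm topology are in general not separable, so the Borel sets of a
  product need not be generated by rectangles and joint continuity of (x, u) \<mapsto> x u does not
  settle the matter. For a simple function in place of g, only the continuous maps x \<mapsto> x v
  with fixed v occur.\<close>

lemma measurable_apply_section:
  assumes g: "g \<in> borel_measurable M"
  shows "(\<lambda>x. blinfun_apply x (g x)) \<in> borel_measurable M"
proof -
  from borel_measurable_implies_sequence_metric[OF g, of 0] obtain s
    where s: "\<And>i. simple_function M (s i)" "\<And>x. x \<in> space M \<Longrightarrow> (\<lambda>i. s i x) \<longlonglongrightarrow> g x"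
    by metis
  show ?thesis
  proof (rule borel_measurable_LIMSEQ_metric)
    fix i
    have fin: "finite (s i ` space M)" and pre: "\<And>v. v \<in> s i ` space M \<Longrightarrow> s i -` {v} \<inter> space M \<in> sets M"
      using s(1)[of i] unfolding simple_function_def by auto
    show "(\<lambda>x. blinfun_apply x (s i x)) \<in> borel_measurable M"
    proof (rule measurable_compose_countable'[where I = "s i ` space M" and f = "\<lambda>v x. blinfun_apply x v"])
      show "s i \<in> measurable M (count_space (s i ` space M))"
        using pre by (subst measurable_count_space_eq2[OF fin]) auto
      show "countable (s i ` space M)"
        using fin by (rule countable_finite)
      fix v
      have "continuous_on S (\<lambda>x. blinfun_apply x v)"
        by (intro continuous_intros)
      then show "(\<lambda>x. blinfun_apply x v) \<in> borel_measurable M"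
        by (rule borel_measurable_M_continuous)
    qed
  next
    fix x assume "x \<in> space M"
    then show "(\<lambda>i. blinfun_apply x (s i x)) \<longlonglongrightarrow> blinfun_apply x (g x)"
      using s by (intro blinfun.tendsto tendsto_const) auto
  qed
qed

lemma measurable_newton_section:
  "g \<in> borel_measurable M \<Longrightarrow> (\<lambda>x. blinfun_apply (newton_op k x) (g x)) \<in> borel_measurable M"
proof (induction k arbitrary: g)
  case 0
  have "continuous_on S (\<lambda>x. 1 / (1 + norm x))"
    by (intro continuous_intros) (metis add_nonneg_eq_0_iff norm_ge_zero zero_le_one zero_neq_one)
  from borel_measurable_M_continuous[OF this] measurable_apply_section[OF 0]
  show ?case
    unfolding newton_op.simps blinfun.scaleR_left by (rule borel_measurable_scaleR)
next
  case (Suc k)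
  show ?case
    unfolding newton_op.simps blinfun.diff_left blinfun.scaleR_left blinfun_apply_blinfun_compose
    by (intro borel_measurable_diff borel_measurable_scaleR borel_measurable_const Suc)
qed

lemma measurable_sgn_section:
  assumes "g \<in> borel_measurable M"
  shows "(\<lambda>x. sgn_op x (g x)) \<in> borel_measurable M"
proof (rule borel_measurable_LIMSEQ_metric)
  show "(\<lambda>x. blinfun_apply (newton_op k x) (g x)) \<in> borel_measurable M" for k
    by (rule measurable_newton_section[OF assms])
  show "(\<lambda>k. blinfun_apply (newton_op k x) (g x)) \<longlonglongrightarrow> sgn_op x (g x)" if "x \<in> space M" for x
    using regular_point.newton_op_tendsto regular_point that by auto
qed

end

locale foliated_cfs = cfs n F \<rho>
  for n :: nat and F :: "'a::separable_complex_hilbert op set" and \<rho> :: "'a op measure" +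
  fixes past :: "'a op set set" and \<eta> :: "real \<Rightarrow> 'a op \<Rightarrow> real"
  assumes foliation: "global_foliation \<rho> past \<eta>"
begin

lemma eta_local:
  assumes "x \<in> S"
  obtains U g where "(t, x) \<in> U" "open U" "\<And>p. p \<in> U \<Longrightarrow> g differentiable (at p)"
    "\<And>v. continuous_on U (\<lambda>p. frechet_derivative g (at p) v)" "\<And>s y. y \<in> S \<Longrightarrow> (s, y) \<in> U \<Longrightarrow> \<eta> s y = g (s, y)"
proof -
  have "(t, x) \<in> UNIV \<times> S"
    using assms by simp
  then obtain U g where U: "(t, x) \<in> U" "smooth_on_open g U" "\<forall>q\<in>(UNIV \<times> S) \<inter> U. g q = (\<lambda>(t, x). \<eta> t x) q"
    using foliation unfolding global_foliation_def smooth_on_set_def by meson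
  then have "Ck_on (Suc 0) g U" "open U"
    unfolding smooth_on_open_def by auto
  then show ?thesis
    using U by (intro that[of U g]) auto
qed

text \<open>The line s \<mapsto> (s, x) stays in \<open>UNIV \<times> S\<close>, so near time t the
  foliation function coincides with the local smooth extension g, and its time derivative is a
  partial derivative of g.\<close>

lemma eta_C1:
  assumes "x \<in> S"
  shows "((\<lambda>s. \<eta> s x) has_real_derivative theta \<eta> t x) (at t)" and "isCont (\<lambda>s. theta \<eta> s x) t"
proof -
  obtain U g where U: "(t, x) \<in> U" "open U" "\<And>p. p \<in> U \<Longrightarrow> g differentiable (at p)"
    "\<And>v. continuous_on U (\<lambda>p. frechet_derivative g (at p) v)" "\<And>s y. y \<in> S \<Longrightarrow> (s, y) \<in> U \<Longrightarrow> \<eta> s y = g (s, y)"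
    using eta_local[OF assms] by metis
  define I where "I = (\<lambda>s. (s, x)) -` U"
  have I: "open I" "t \<in> I"
    unfolding I_def using U by (auto intro!: open_vimage continuous_intros)
  have der: "((\<lambda>s. \<eta> s x) has_real_derivative frechet_derivative g (at (s, x)) (1, 0)) (at s)" if "s \<in> I" for s
  proof -
    have gd: "(g has_derivative frechet_derivative g (at (s, x))) (at (s, x))"
      using U(3)[of "(s, x)"] that frechet_derivative_works unfolding I_def by auto
    then have "((\<lambda>s. g (s, x)) has_derivative (\<lambda>h. frechet_derivative g (at (s, x)) (h, 0))) (at s)"
      by (intro has_derivative_compose[where g = g and f = "\<lambda>s. (s, x)"] derivative_eq_intros) auto
    moreover have "frechet_derivative g (at (s, x)) (h, 0) = frechet_derivative g (at (s, x)) (1, 0) * h" for h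
    proof -
      have "frechet_derivative g (at (s, x)) (h *\<^sub>R (1, 0)) = h *\<^sub>R frechet_derivative g (at (s, x)) (1, 0)"
        using linear_cmul[OF has_derivative_linear[OF gd]] by blast
      then show ?thesis by simp
    qed
    then have "(\<lambda>h. frechet_derivative g (at (s, x)) (h, 0)) = (*) (frechet_derivative g (at (s, x)) (1, 0))"
      by (rule ext)
    ultimately have "((\<lambda>s. g (s, x)) has_real_derivative frechet_derivative g (at (s, x)) (1, 0)) (at s)"
      unfolding has_field_derivative_def by metis
    then show ?thesis
      by (rule DERIV_cong_ev[OF refl _ refl, THEN iffD2, rotated])
        (use I that U(5)[OF assms] in \<open>auto simp: eventually_nhds I_def\<close>)
  qed
  have th: "theta \<eta> s x = frechet_derivative g (at (s, x)) (1, 0)" if "s \<in> I" for s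
    unfolding theta_def by (rule DERIV_imp_deriv[OF der[OF that]])
  show "((\<lambda>s. \<eta> s x) has_real_derivative theta \<eta> t x) (at t)"
    using der th I by simp
  have "continuous_on I (\<lambda>s. frechet_derivative g (at (s, x)) (1, 0))"
    by (rule continuous_on_compose2[OF U(4)]) (auto simp: I_def intro!: continuous_intros)
  then have "continuous_on I (\<lambda>s. theta \<eta> s x)"
    by (rule continuous_on_eq) (simp add: th)
  then show "isCont (\<lambda>s. theta \<eta> s x) t"
    using I continuous_on_eq_continuous_at by blast
qed

lemma eta_continuous: "continuous_on S (\<eta> t)"
  unfolding continuous_on_eq_continuous_within
proof
  fix x assume x: "x \<in> S"
  obtain U g where U: "(t, x) \<in> U" "open U" "\<And>p. p \<in> U \<Longrightarrow> g differentiable (at p)"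
    "\<And>v. continuous_on U (\<lambda>p. frechet_derivative g (at p) v)" "\<And>s y. y \<in> S \<Longrightarrow> (s, y) \<in> U \<Longrightarrow> \<eta> s y = g (s, y)"
    using eta_local[OF x] by metis
  define I where "I = (\<lambda>y. (t, y)) -` U"
  have I: "open I" "x \<in> I"
    unfolding I_def using U by (auto intro!: open_vimage continuous_intros)
  have "isCont g (t, x)"
    using U differentiable_imp_continuous_within by blast
  then have "isCont (\<lambda>y. g (t, y)) x"
    using isCont_o2[of x "Pair t" g] isCont_Pair[OF continuous_const continuous_ident, of x t] by simp
  then have "((\<lambda>y. g (t, y)) \<longlongrightarrow> g (t, x)) (at x within S)"
    using isContD tendsto_mono[OF at_le] by blast
  moreover have "\<forall>\<^sub>F y in at x within S. g (t, y) = \<eta> t y"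
    unfolding eventually_at_topological using I U(5) unfolding I_def by (intro exI[of _ I]) (auto simp: I_def)
  ultimately have "(\<eta> t \<longlongrightarrow> g (t, x)) (at x within S)"
    by (rule Lim_transform_eventually)
  then show "continuous (at x within S) (\<eta> t)"
    using U(5)[OF x U(1)] by (simp add: continuous_within)
qed

lemma eta_range: "\<forall>t. \<forall>x\<in>S. 0 \<le> \<eta> t x \<and> \<eta> t x \<le> 1"
  and theta_nonneg_all: "\<forall>t. \<forall>x\<in>S. 0 \<le> theta \<eta> t x"
  using foliation unfolding global_foliation_def by metis+

lemma theta_nonneg: "x \<in> S \<Longrightarrow> 0 \<le> theta \<eta> t x"
  using theta_nonneg_all by blast

lemma eta_strip_nonneg:
  assumes x: "x \<in> S" and ab: "a \<le> b"
  shows "0 \<le> eta_strip \<eta> a b x"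
proof -
  have "\<eta> a x \<le> \<eta> b x"
    by (rule DERIV_nonneg_imp_nondecreasing[OF ab]) (use eta_C1(1)[OF x] theta_nonneg[OF x] in blast)
  then show ?thesis
    unfolding eta_strip_def by simp
qed

lemma eta_strip_le_1:
  assumes "x \<in> S"
  shows "eta_strip \<eta> a b x \<le> 1"
proof -
  have "\<eta> b x \<le> 1" "0 \<le> \<eta> a x"
    using eta_range assms by blast+
  then show ?thesis
    unfolding eta_strip_def by simp
qed

section \<open>Measurability and integration over the time parameter\<close>

lemma measurable_eta [measurable]: "\<eta> t \<in> borel_measurable M"
  by (rule borel_measurable_M_continuous[OF eta_continuous])

lemma measurable_eta_strip [measurable]: "eta_strip \<eta> a b \<in> borel_measurable M"
  unfolding eta_strip_def [abs_def] by measurable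

lemma measurable_theta [measurable]: "theta \<eta> t \<in> borel_measurable M"
proof (rule borel_measurable_LIMSEQ_metric)
  show "(\<lambda>x. (\<eta> (t + inverse (real (Suc n))) x - \<eta> t x) / inverse (real (Suc n))) \<in> borel_measurable M" for n
    by measurable
  fix x assume "x \<in> space M"
  then have "((\<lambda>h. (\<eta> (t + h) x - \<eta> t x) / h) \<longlongrightarrow> theta \<eta> t x) (at 0)"
    using eta_C1(1)[of x t] by (simp add: DERIV_def)
  moreover have "filterlim (\<lambda>n. inverse (real (Suc n))) (at 0) sequentially"
    unfolding filterlim_at using LIMSEQ_inverse_real_of_nat by simp
  ultimately show "(\<lambda>n. (\<eta> (t + inverse (real (Suc n))) x - \<eta> t x) / inverse (real (Suc n))) \<longlonglongrightarrow> theta \<eta> t x"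
    by (rule filterlim_compose)
qed

text \<open>The function is measurable in x and continuous in t. Rounding t down to a grid of mesh 1
  / (n + 1) leaves only countably many times, and continuity permits the limit.\<close>

lemma measurable_theta_pair: "(\<lambda>(t :: real, x). theta \<eta> t x) \<in> borel_measurable (lborel \<Otimes>\<^sub>M M)"
proof (rule borel_measurable_LIMSEQ_metric)
  show "(\<lambda>(t :: real, x). theta \<eta> (of_int \<lfloor>real (Suc n) * t\<rfloor> / real (Suc n)) x) \<in> borel_measurable (lborel \<Otimes>\<^sub>M M)" for n
  proof -
    have "(\<lambda>p. theta \<eta> (of_int \<lfloor>real (Suc n) * fst p\<rfloor> / real (Suc n)) (snd p)) \<in> borel_measurable (lborel \<Otimes>\<^sub>M M)"
      by (rule measurable_compose_countable[where f = "\<lambda>(i::int) p. theta \<eta> (of_int i / real (Suc n)) (snd p)"])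
        measurable
    then show ?thesis
      by (simp add: case_prod_beta')
  qed
  fix p assume "p \<in> space ((lborel :: real measure) \<Otimes>\<^sub>M M)"
  then obtain t x where p: "p = (t, x)" "x \<in> S"
    by (auto simp: space_pair_measure)
  have "(\<lambda>n. of_int \<lfloor>real (Suc n) * t\<rfloor> / real (Suc n)) \<longlonglongrightarrow> t"
  proof (rule tendsto_sandwich[where f = "\<lambda>n. t - inverse (real (Suc n))" and h = "\<lambda>_. t"])
    show "\<forall>\<^sub>F n in sequentially. t - inverse (real (Suc n)) \<le> of_int \<lfloor>real (Suc n) * t\<rfloor> / real (Suc n)"
    proof (intro always_eventually allI)
      fix n
      have "real (Suc n) * t - 1 \<le> of_int \<lfloor>real (Suc n) * t\<rfloor>"
        by linarith
      then have "(real (Suc n) * t - 1) / real (Suc n) \<le> of_int \<lfloor>real (Suc n) * t\<rfloor> / real (Suc n)"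
        by (rule divide_right_mono) simp
      then show "t - inverse (real (Suc n)) \<le> of_int \<lfloor>real (Suc n) * t\<rfloor> / real (Suc n)"
        by (simp add: diff_divide_distrib inverse_eq_divide)
    qed
    show "\<forall>\<^sub>F n in sequentially. of_int \<lfloor>real (Suc n) * t\<rfloor> / real (Suc n) \<le> t"
    proof (intro always_eventually allI)
      fix n
      have "of_int \<lfloor>real (Suc n) * t\<rfloor> / real (Suc n) \<le> real (Suc n) * t / real (Suc n)"
        by (intro divide_right_mono) simp_all
      then show "of_int \<lfloor>real (Suc n) * t\<rfloor> / real (Suc n) \<le> t"
        by simp
    qed
    show "(\<lambda>n. t - inverse (real (Suc n))) \<longlonglongrightarrow> t"
      using tendsto_diff[OF tendsto_const LIMSEQ_inverse_real_of_nat] by simp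
  qed simp
  then have "(\<lambda>n. theta \<eta> (of_int \<lfloor>real (Suc n) * t\<rfloor> / real (Suc n)) x) \<longlonglongrightarrow> theta \<eta> t x"
    by (rule isCont_tendsto_compose[OF eta_C1(2)[OF p(2)]])
  then show "(\<lambda>n. case p of (t, x) \<Rightarrow> theta \<eta> (of_int \<lfloor>real (Suc n) * t\<rfloor> / real (Suc n)) x) \<longlonglongrightarrow> (case p of (t, x) \<Rightarrow> theta \<eta> t x)"
    unfolding p by simp
qed

lemma nn_integral_theta:
  assumes "x \<in> S" "a \<le> b"
  shows "(\<integral>\<^sup>+t. ennreal (theta \<eta> t x) * indicator {a..b} t \<partial>lborel) = ennreal (eta_strip \<eta> a b x)"
  unfolding eta_strip_def
proof (rule nn_integral_FTC_Icc[OF _ eta_C1(1)[OF assms(1)] theta_nonneg[OF assms(1)] assms(2)])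
  show "(\<lambda>t. theta \<eta> t x) \<in> borel_measurable borel"
    using eta_C1(2)[OF assms(1)] by (intro borel_measurable_continuous_onI continuous_at_imp_continuous_on) auto
qed

text \<open>Since \<open>\<theta>\<^sub>t\<close> integrates over [a, b] to
  \<open>eta_strip\<close>, Tonelli's theorem identifies the time integral of the integrals against
  \<open>\<rho>\<^sub>t\<close> with an integral over the strip. The inner integral may be infinite
  on a null set of times, where \<open>enn2real\<close> returns 0.\<close>

lemma foliation_Tonelli:
  fixes u :: "'a op \<Rightarrow> real"
  assumes u [measurable]: "u \<in> borel_measurable M" and u0: "\<And>x. 0 \<le> u x" and ab: "a \<le> b"
    and int: "integrable M (\<lambda>x. u x * eta_strip \<eta> a b x)"
  defines "N \<equiv> \<lambda>t. \<integral>\<^sup>+x. ennreal (theta \<eta> t x * u x) \<partial>M"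
  shows "AE t in lborel. t \<in> {a..b} \<longrightarrow> N t < \<infinity>"
    and "((\<lambda>t. enn2real (N t)) has_integral (LINT x|M. u x * eta_strip \<eta> a b x)) {a..b}"
proof -
  interpret P: pair_sigma_finite lborel M ..
  have [measurable]: "(\<lambda>(t :: real, x). theta \<eta> t x) \<in> borel_measurable (lborel \<Otimes>\<^sub>M M)"
    by (rule measurable_theta_pair)
  have [measurable]: "(\<lambda>p. theta \<eta> (fst p) (snd p)) \<in> borel_measurable (lborel \<Otimes>\<^sub>M M)"
    using measurable_theta_pair by (simp add: case_prod_beta')
  have meas: "(\<lambda>(t, x). ennreal (theta \<eta> t x * u x)) \<in> borel_measurable (lborel \<Otimes>\<^sub>M M)"
    unfolding case_prod_beta' by measurable
  have N [measurable]: "N \<in> borel_measurable lborel"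
    unfolding N_def using M.borel_measurable_nn_integral[OF meas] by simp
  have "(\<integral>\<^sup>+t. N t * indicator {a..b} t \<partial>lborel)
      = (\<integral>\<^sup>+t. \<integral>\<^sup>+x. ennreal (theta \<eta> t x * u x) * indicator {a..b} t \<partial>M \<partial>lborel)"
    unfolding N_def by (intro nn_integral_cong nn_integral_multc [symmetric]) measurable
  also have "\<dots> = (\<integral>\<^sup>+x. \<integral>\<^sup>+t. ennreal (theta \<eta> t x * u x) * indicator {a..b} t \<partial>lborel \<partial>M)"
    by (rule P.Fubini' [symmetric]) (unfold case_prod_beta', measurable)
  also have "\<dots> = (\<integral>\<^sup>+x. ennreal (u x * eta_strip \<eta> a b x) \<partial>M)"
  proof (rule nn_integral_cong)
    fix x assume "x \<in> space M"
    then have x: "x \<in> S" by simp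
    have [measurable]: "(\<lambda>t. theta \<eta> t x) \<in> borel_measurable borel"
      using eta_C1(2)[OF x] by (intro borel_measurable_continuous_onI continuous_at_imp_continuous_on) auto
    have "(\<integral>\<^sup>+t. ennreal (theta \<eta> t x * u x) * indicator {a..b} t \<partial>lborel)
        = (\<integral>\<^sup>+t. ennreal (u x) * (ennreal (theta \<eta> t x) * indicator {a..b} t) \<partial>lborel)"
      using u0 theta_nonneg[OF x] by (intro nn_integral_cong) (simp add: ennreal_mult mult_ac)
    also have "\<dots> = ennreal (u x) * ennreal (eta_strip \<eta> a b x)"
      by (subst nn_integral_cmult) (simp_all add: nn_integral_theta[OF x ab])
    finally show "(\<integral>\<^sup>+t. ennreal (theta \<eta> t x * u x) * indicator {a..b} t \<partial>lborel) = ennreal (u x * eta_strip \<eta> a b x)"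
      using u0 eta_strip_nonneg[OF x ab] by (simp add: ennreal_mult)
  qed
  also have "\<dots> = ennreal (LINT x|M. u x * eta_strip \<eta> a b x)"
    using u0 eta_strip_nonneg[OF _ ab] by (intro nn_integral_eq_integral int AE_I2) simp
  finally have total: "(\<integral>\<^sup>+t. N t * indicator {a..b} t \<partial>lborel) = ennreal (LINT x|M. u x * eta_strip \<eta> a b x)" .
  then have "AE t in lborel. N t * indicator {a..b} t \<noteq> \<infinity>"
    by (intro nn_integral_PInf_AE) auto
  then show fin: "AE t in lborel. t \<in> {a..b} \<longrightarrow> N t < \<infinity>"
    by eventually_elim (auto simp: indicator_def less_top)
  have eq: "(\<integral>\<^sup>+t. ennreal (enn2real (N t) * indicator {a..b} t) \<partial>lborel) = ennreal (LINT x|M. u x * eta_strip \<eta> a b x)"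
    unfolding total [symmetric]
    by (rule nn_integral_cong_AE) (use fin in \<open>eventually_elim, auto simp: indicator_def less_top\<close>)
  have "has_bochner_integral lborel (\<lambda>t. enn2real (N t) * indicator {a..b} t) (LINT x|M. u x * eta_strip \<eta> a b x)"
    by (rule has_bochner_integral_nn_integral[OF _ _ _ eq])
      (use u0 eta_strip_nonneg[OF _ ab] in \<open>auto intro!: integral_nonneg_AE AE_I2\<close>)
  then have "((\<lambda>t. enn2real (N t) * indicator {a..b} t) has_integral (LINT x|M. u x * eta_strip \<eta> a b x)) UNIV"
    using has_integral_integral_real[of "\<lambda>t. enn2real (N t) * indicator {a..b} t"]
    by (simp add: has_bochner_integral_iff)
  then have "((\<lambda>t. if t \<in> {a..b} then enn2real (N t) else 0) has_integral (LINT x|M. u x * eta_strip \<eta> a b x)) UNIV"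
    by (rule has_integral_eq[rotated]) (auto simp: indicator_def)
  then show "((\<lambda>t. enn2real (N t)) has_integral (LINT x|M. u x * eta_strip \<eta> a b x)) {a..b}"
    unfolding has_integral_restrict_UNIV .
qed

text \<open>By the mean value theorem. Hence the weight already confines the Krein inner product to
  the time strip.\<close>

lemma eta_strip_support:
  assumes x: "x \<in> S" and ab: "a < b" and nz: "eta_strip \<eta> a b x \<noteq> 0"
  shows "x \<in> time_strip \<rho> \<eta> a b"
proof -
  obtain t where t: "a < t" "t < b" "\<eta> b x - \<eta> a x = (b - a) * theta \<eta> t x"
    using MVT2[OF ab, of "\<lambda>s. \<eta> s x" "\<lambda>s. theta \<eta> s x"] eta_C1(1)[OF x] by auto
  then have "theta \<eta> t x \<noteq> 0"
    using nz unfolding eta_strip_def by auto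
  then have "x \<in> support_M \<rho> (theta \<eta> t)"
    using x closure_subset[of "{x \<in> S. theta \<eta> t x \<noteq> 0}"] unfolding support_M_def by auto
  then show ?thesis
    using t unfolding time_strip_def by auto
qed

end

section \<open>The energy estimate\<close>

text \<open>Young's inequality with two parameters: g will be the multiplier of the energy argument
  and B a constant adjusted to it.\<close>

lemma weighted_AM_GM:
  fixes a b g B :: real
  assumes "0 < B"
  shows "4 * g * (a * b) \<le> 4 * g\<^sup>2 / B * a\<^sup>2 + B * b\<^sup>2"
proof -
  have "0 \<le> (2 * g * a - B * b)\<^sup>2 / B"
    using assms by simp
  also have "\<dots> = 4 * g\<^sup>2 / B * a\<^sup>2 + B * b\<^sup>2 - 4 * g * (a * b)"
    using assms by (simp add: field_simps power2_eq_square)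
  finally show ?thesis by simp
qed

text \<open>The multiplier \<open>g(t) = T tan ((t - a) / T)\<close> solves \<open>g' = 1 + (g / T)\<^sup>2\<close>. It replaces
  Gronwall's inequality for the square root of the energy, which need not be differentiable.\<close>

lemma energy_integration:
  fixes E E' u v :: "real \<Rightarrow> real"
  assumes ab: "a < b" and C: "0 < C"
    and E: "\<And>t. t \<in> {a..b} \<Longrightarrow> (E has_real_derivative E' t) (at t)" "E b = 0"
    and u: "(u has_integral U) {a..b}" "\<And>t. t \<in> {a..b} \<Longrightarrow> u t \<le> C\<^sup>2 * E t"
    and v: "(v has_integral V) {a..b}"
    and E': "AE t in lborel. t \<in> {a..b} \<longrightarrow>
      (\<forall>g B. 0 \<le> g \<longrightarrow> 0 < B \<longrightarrow> g * \<bar>E' t\<bar> \<le> 4 * g\<^sup>2 / B * u t + B * v t)"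
  shows "U \<le> (2 * C\<^sup>2 * (b - a))\<^sup>2 * V"
proof -
  define T where "T = b - a"
  have T: "0 < T" using ab by (simp add: T_def)
  define \<tau> where "\<tau> t = tan ((t - a) / T)" for t
  \<comment> \<open>With g = T \<tau>, this value turns the first term of the bound on g |E'| into
    \<tau>^2 u / C^2 \<le> \<tau>^2 E, which the \<tau>^2 part of g' absorbs. The final constant is
    C^2 B = (2 C^2 T)^2.\<close>
  define B where "B = 4 * C\<^sup>2 * T\<^sup>2"
  have B: "0 < B" using C T by (simp add: B_def)
  \<comment> \<open>The angle stays in [0, 1], below pi/2, so the tangent has no pole on the
    interval.\<close>
  have angle: "0 \<le> (t - a) / T \<and> (t - a) / T < pi / 2" if "t \<in> {a..b}" for t
  proof -
    have "(t - a) / T \<le> 1" "0 \<le> (t - a) / T"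
      using that T by (auto simp: T_def divide_simps)
    then show ?thesis
      using pi_half_gt_zero pi_gt3 by linarith
  qed
  have tau0: "0 \<le> \<tau> t" if "t \<in> {a..b}" for t
    using angle[OF that] tan_gt_zero[of "(t - a) / T"] unfolding \<tau>_def
    by (cases "(t - a) / T = 0") auto
  have dtau: "((\<lambda>t. T * \<tau> t) has_real_derivative 1 + (\<tau> t)\<^sup>2) (at t)" if "t \<in> {a..b}" for t
  proof -
    have cos: "cos ((t - a) / T) \<noteq> 0"
      using angle[OF that] cos_gt_zero_pi[of "(t - a) / T"] by force
    have "((\<lambda>t. T * tan ((t - a) / T)) has_real_derivative T * (inverse ((cos ((t - a) / T))\<^sup>2) * (1 / T))) (at t)"
      using T cos by (auto intro!: derivative_eq_intros simp: divide_inverse)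
    moreover have "T * (inverse ((cos ((t - a) / T))\<^sup>2) * (1 / T)) = 1 + (\<tau> t)\<^sup>2"
      unfolding \<tau>_def tan_sec[OF cos] using T by (simp add: power_inverse)
    ultimately show ?thesis
      unfolding \<tau>_def by simp
  qed
  \<comment> \<open>The derivative of g E with g = T \<tau>. It integrates to zero, since g vanishes
    at \<open>a\<close> and E at \<open>b\<close>.\<close>
  define k' where "k' t = (1 + (\<tau> t)\<^sup>2) * E t + T * \<tau> t * E' t" for t
  have "((\<lambda>t. T * \<tau> t * E t) has_real_derivative k' t) (at t)" if "t \<in> {a..b}" for t
    unfolding k'_def by (rule DERIV_mult'[OF dtau[OF that] E(1)[OF that], THEN DERIV_cong]) (simp add: algebra_simps)
  then have "((\<lambda>t. T * \<tau> t * E t) has_vector_derivative k' t) (at t within {a..b})" if "t \<in> {a..b}" for t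
    using that unfolding has_real_derivative_iff_has_vector_derivative
    by (blast intro: has_vector_derivative_at_within)
  then have "(k' has_integral (T * \<tau> b * E b - T * \<tau> a * E a)) {a..b}"
    using ab by (intro fundamental_theorem_of_calculus) auto
  then have "(k' has_integral 0) {a..b}"
    by (simp add: \<tau>_def E(2))
  from has_integral_add[OF this has_integral_mult_right[OF v, of B]]
  have upper: "((\<lambda>t. k' t + B * v t) has_integral B * V) {a..b}"
    by simp
  \<comment> \<open>The inequality between the integrands is known only for almost every t.
    \<open>m\<close> dominates the left one everywhere and equals the right one almost everywhere,
    so it has the integral of the latter.\<close>
  define m where "m t = (if 1 / C\<^sup>2 * u t \<le> k' t + B * v t then k' t + B * v t else 1 / C\<^sup>2 * u t)" for t
  have "AE t in lborel. t \<in> {a..b} \<longrightarrow> m t = k' t + B * v t"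
    using E'
  proof eventually_elim
    case (elim t)
    show ?case
    proof
      assume t: "t \<in> {a..b}"
      have "T * \<tau> t * \<bar>E' t\<bar> \<le> 4 * (T * \<tau> t)\<^sup>2 / B * u t + B * v t"
        using elim t T tau0[OF t] B by simp
      also have "4 * (T * \<tau> t)\<^sup>2 / B * u t = (\<tau> t)\<^sup>2 * (u t / C\<^sup>2)"
        unfolding B_def using T C by (simp add: power_mult_distrib field_simps)
      also have "\<dots> \<le> (\<tau> t)\<^sup>2 * E t"
        using u(2)[OF t] C by (intro mult_left_mono) (simp_all add: field_simps)
      finally have "T * \<tau> t * \<bar>E' t\<bar> \<le> (\<tau> t)\<^sup>2 * E t + B * v t"
        by simp
      moreover have "- (T * \<tau> t * \<bar>E' t\<bar>) \<le> T * \<tau> t * E' t"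
      proof -
        have "T * \<tau> t * (- \<bar>E' t\<bar>) \<le> T * \<tau> t * E' t"
          using T tau0[OF t] by (intro mult_left_mono) auto
        then show ?thesis by simp
      qed
      moreover have "1 / C\<^sup>2 * u t \<le> E t"
        using u(2)[OF t] C by (simp add: field_simps)
      ultimately have "1 / C\<^sup>2 * u t \<le> k' t + B * v t"
        unfolding k'_def by (simp add: algebra_simps)
      then show "m t = k' t + B * v t"
        unfolding m_def by simp
    qed
  qed
  then have "(m has_integral B * V) {a..b}"
    using upper by (subst has_integral_AE)
  then have "1 / C\<^sup>2 * U \<le> B * V"
    by (rule has_integral_le[OF has_integral_mult_right[OF u(1)]]) (auto simp: m_def)
  then have "U \<le> C\<^sup>2 * (B * V)"
    using C by (simp add: field_simps)
  also have "\<dots> = (2 * C\<^sup>2 * (b - a))\<^sup>2 * V"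
    unfolding B_def T_def by (simp add: power_mult_distrib power2_eq_square)
  finally show ?thesis .
qed

locale dynamical_cfs = foliated_cfs n F \<rho> past \<eta>
  for n :: nat and F :: "'a::separable_complex_hilbert op set" and \<rho> :: "'a op measure"
    and past :: "'a op set set" and \<eta> :: "real \<Rightarrow> 'a op \<Rightarrow> real" +
  fixes Cvary :: "'a wave set" and q :: "'a kernel" and c t0 tmax C :: real
  assumes subspace: "wave_subspace Cvary" and continuous: "Cvary \<subseteq> continuous_waves \<rho>"
    and symmetric: "symmetric_kernel \<rho> q"
    and time_range: "finite_time_range \<rho> \<eta> q c"
    and regular: "surface_form_regular \<rho> \<eta> q c"
    and t0_less: "t0 < tmax"
    and hyperbolic: "hyperbolicity_constant \<rho> \<eta> q c Cvary {t0..tmax} C"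
begin

section \<open>Wave functions as Hilbert space valued sections\<close>

abbreviation sect :: "'a wave \<Rightarrow> 'a op \<Rightarrow> 'a" where
  "sect \<psi> \<equiv> \<lambda>x. blinfun_apply (sqrt_abs x) (\<psi> x)"

lemma spin_scal_sect: "x \<in> S \<Longrightarrow> spin_scal x (\<psi> x) (\<phi> x) = cinner (sect \<psi> x) (sect \<phi> x)"
  using regular_point.spin_scal_eq[OF regular_point] by blast

lemma spin_scal_self: "x \<in> S \<Longrightarrow> spin_scal x (\<psi> x) (\<psi> x) = complex_of_real ((norm (sect \<psi> x))\<^sup>2)"
  by (simp add: spin_scal_sect cinner_self)

lemma L2_strip_iff:
  "\<psi> \<in> L2_strip \<rho> \<eta> a b \<longleftrightarrow> \<psi> \<in> wave_functions \<rho> \<and> sect \<psi> \<in> borel_measurable M \<and>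
     integrable M (\<lambda>x. (norm (sect \<psi> x))\<^sup>2 * eta_strip \<eta> a b x)"
proof -
  have "integrable M (\<lambda>x. spin_scal x (\<psi> x) (\<psi> x) * complex_of_real (eta_strip \<eta> a b x))
    \<longleftrightarrow> integrable M (\<lambda>x. complex_of_real ((norm (sect \<psi> x))\<^sup>2 * eta_strip \<eta> a b x))"
    by (intro Bochner_Integration.integrable_cong) (auto simp: spin_scal_self)
  also have "\<dots> \<longleftrightarrow> integrable M (\<lambda>x. (norm (sect \<psi> x))\<^sup>2 * eta_strip \<eta> a b x)"
    by (rule complex_of_real_integrable_eq)
  finally show ?thesis
    unfolding L2_strip_def by simp
qed

lemma L2_inner_self:
  "L2_inner \<rho> \<eta> a b \<psi> \<psi> = complex_of_real (LINT x|M. (norm (sect \<psi> x))\<^sup>2 * eta_strip \<eta> a b x)"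
  unfolding L2_inner_def integral_complex_of_real [symmetric]
  by (rule Bochner_Integration.integral_cong) (auto simp: spin_scal_self)

lemma L2_norm_eq: "L2_norm \<rho> \<eta> a b \<psi> = sqrt (LINT x|M. (norm (sect \<psi> x))\<^sup>2 * eta_strip \<eta> a b x)"
  unfolding L2_norm_def L2_inner_self by simp

lemma spin_prod_sect: "x \<in> S \<Longrightarrow> spin_prod x u v = - cinner (sqrt_abs x u) (sgn_op x (sqrt_abs x v))"
  using regular_point.spin_prod_eq[OF regular_point] .

lemma cmod_spin_prod_le:
  assumes x: "x \<in> S"
  shows "cmod (spin_prod x u v) \<le> norm (sqrt_abs x u) * norm (sqrt_abs x v)"
proof -
  have "cmod (spin_prod x u v) \<le> norm (sqrt_abs x u) * norm (sgn_op x (sqrt_abs x v))"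
    unfolding spin_prod_sect[OF x] norm_minus_cancel by (rule cmod_cinner_le)
  also have "\<dots> \<le> norm (sqrt_abs x u) * norm (sqrt_abs x v)"
    by (intro mult_left_mono regular_point.norm_sgn_op_le[OF regular_point[OF x]]) simp
  finally show ?thesis .
qed

lemma krein_inner_eq:
  "krein_inner \<rho> \<eta> t0 tmax \<phi> \<psi>
    = - (LINT x|M. cinner (sect \<phi> x) (sgn_op x (sect \<psi> x)) * complex_of_real (eta_strip \<eta> t0 tmax x))"
  unfolding krein_inner_def set_lebesgue_integral_def Bochner_Integration.integral_minus [symmetric]
proof (rule Bochner_Integration.integral_cong[OF refl])
  fix x assume "x \<in> space M"
  then have x: "x \<in> S" by simp
  show "indicator (time_strip \<rho> \<eta> t0 tmax) x *\<^sub>R (spin_prod x (\<phi> x) (\<psi> x) * complex_of_real (eta_strip \<eta> t0 tmax x))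
    = - (cinner (sect \<phi> x) (sgn_op x (sect \<psi> x)) * complex_of_real (eta_strip \<eta> t0 tmax x))"
    using eta_strip_support[OF x t0_less] spin_prod_sect[OF x, of "\<phi> x" "\<psi> x"]
    by (cases "eta_strip \<eta> t0 tmax x = 0") (auto simp: indicator_def)
qed

lemma compact_finite_measure:
  assumes K: "compact K" "K \<subseteq> S"
  shows "K \<in> sets M" and "emeasure M K < \<infinity>"
proof -
  have Ksets: "K \<in> sets \<rho>"
    using K spacetime_subset compact_imp_closed[OF K(1)]
    unfolding sets_rho sets_restrict_space by (auto intro!: image_eqI[of _ _ K])
  then show "K \<in> sets M"
    using K spacetime_sets by (simp add: sets_restrict_space_iff spacetime_subset space_rho Int_absorb2)
  have "\<forall>x\<in>K. \<exists>U. open U \<and> x \<in> U \<and> emeasure \<rho> (U \<inter> F) < \<infinity>"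
    using locally_finite_rho K(2) spacetime_subset unfolding locally_finite_def space_rho by blast
  then obtain U where U: "\<And>x. x \<in> K \<Longrightarrow> open (U x) \<and> x \<in> U x \<and> emeasure \<rho> (U x \<inter> F) < \<infinity>"
    by metis
  obtain D where D: "D \<subseteq> K" "finite D" "K \<subseteq> (\<Union>x\<in>D. U x)"
    using compactE_image[OF K(1), of K U] U by (metis UN_I subsetI)
  have Us: "(\<lambda>x. U x \<inter> F) ` D \<subseteq> sets \<rho>"
  proof (rule image_subsetI)
    fix x assume "x \<in> D"
    then have "U x \<in> sets borel"
      using U[of x] D(1) by (simp add: subset_iff)
    then show "U x \<inter> F \<in> sets \<rho>"
      unfolding sets_rho sets_restrict_space by (metis Int_commute image_eqI)
  qed
  have KU: "K \<subseteq> (\<Union>x\<in>D. U x \<inter> F)"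
    using D(3) K(2) spacetime_subset by blast
  have "(\<Union>x\<in>D. U x \<inter> F) \<in> sets \<rho>"
    using Us D(2) by (intro sets.finite_UN) auto
  with KU have "emeasure \<rho> K \<le> emeasure \<rho> (\<Union>x\<in>D. U x \<inter> F)"
    by (rule emeasure_mono)
  also have "\<dots> \<le> (\<Sum>x\<in>D. emeasure \<rho> (U x \<inter> F))"
    by (rule emeasure_subadditive_finite[OF D(2) Us])
  also have "\<dots> < \<infinity>"
  proof -
    have "emeasure \<rho> (U x \<inter> F) < top" if "x \<in> D" for x
      using U[of x] D(1) that by (simp add: subset_iff)
    then show ?thesis
      using D(2) by (simp add: ennreal_sum_less_top)
  qed
  finally have "emeasure \<rho> K < \<infinity>" .
  then show "emeasure M K < \<infinity>"
    using K(2) spacetime_sets by (simp add: emeasure_restrict_space)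
qed

lemma Cvary_continuous:
  assumes "\<phi> \<in> Cvary"
  shows "\<phi> \<in> wave_functions \<rho>" and "continuous_on S (sect \<phi>)"
  using assms continuous unfolding continuous_waves_def by blast+

text \<open>On the compact support the continuous section is bounded; the support has finite measure
  by local finiteness, and the weight is at most 1.\<close>

lemma compactly_supported_L2_loc:
  assumes "\<phi> \<in> compactly_supported \<rho> Cvary"
  shows "\<phi> \<in> L2_loc_t \<rho> \<eta>"
  unfolding L2_loc_t_def
proof (intro CollectI allI impI)
  fix a b :: real assume ab: "a < b"
  have phi: "\<phi> \<in> Cvary" and K: "compact (support_M \<rho> \<phi>)"
    using assms unfolding compactly_supported_def by auto
  let ?K = "support_M \<rho> \<phi>"
  have KS: "?K \<subseteq> S"
    unfolding support_M_def by auto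
  have out: "\<phi> x = 0" if "x \<in> S" "x \<notin> ?K" for x
    using that closure_subset[of "{x \<in> S. \<phi> x \<noteq> 0}"] unfolding support_M_def by auto
  have cont: "continuous_on ?K (sect \<phi>)"
    using Cvary_continuous(2)[OF phi] KS by (rule continuous_on_subset)
  then have "bounded (sect \<phi> ` ?K)"
    by (intro compact_imp_bounded compact_continuous_image K)
  then obtain d where d: "\<And>x. x \<in> ?K \<Longrightarrow> norm (sect \<phi> x) \<le> d"
    unfolding bounded_iff by auto
  have meas: "sect \<phi> \<in> borel_measurable M"
    by (rule borel_measurable_M_continuous[OF Cvary_continuous(2)[OF phi]])
  have "integrable M (\<lambda>x. (norm (sect \<phi> x))\<^sup>2 * eta_strip \<eta> a b x)"
  proof (rule Bochner_Integration.integrable_bound[where f = "\<lambda>x. d\<^sup>2 * indicator ?K x"])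
    show "integrable M (\<lambda>x. d\<^sup>2 * indicator ?K x)"
      using compact_finite_measure[OF K KS] by (intro integrable_mult_right) simp
    show "(\<lambda>x. (norm (sect \<phi> x))\<^sup>2 * eta_strip \<eta> a b x) \<in> borel_measurable M"
      using meas by measurable
    show "AE x in M. norm ((norm (sect \<phi> x))\<^sup>2 * eta_strip \<eta> a b x) \<le> norm (d\<^sup>2 * indicator ?K x)"
    proof (rule AE_I2)
      fix x assume "x \<in> space M"
      then have x: "x \<in> S" by simp
      show "norm ((norm (sect \<phi> x))\<^sup>2 * eta_strip \<eta> a b x) \<le> norm (d\<^sup>2 * indicator ?K x)"
      proof (cases "x \<in> ?K")
        case True
        have "(norm (sect \<phi> x))\<^sup>2 * eta_strip \<eta> a b x \<le> d\<^sup>2 * 1"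
          using d[OF True] eta_strip_nonneg[OF x] eta_strip_le_1[OF x] ab by (intro mult_mono power_mono) auto
        then show ?thesis
          using True eta_strip_nonneg[OF x, of a b] ab by simp
      qed (use out[OF x] in simp)
    qed
  qed
  then show "\<phi> \<in> L2_strip \<rho> \<eta> a b"
    unfolding L2_strip_iff using meas Cvary_continuous(1)[OF phi] by blast
qed

section \<open>The time derivative of the energy\<close>

abbreviation "Q \<equiv> Q_apply \<rho> q c"
abbreviation energy :: "real \<Rightarrow> 'a wave \<Rightarrow> real" where
  "energy t \<phi> \<equiv> Re (surface_form \<rho> \<eta> q c t \<phi> \<phi>)"
abbreviation kernel_form :: "'a wave \<Rightarrow> 'a op \<Rightarrow> 'a op \<Rightarrow> complex" where
  "kernel_form \<phi> x y \<equiv> spin_prod x (\<phi> x) (q x y (\<phi> y))"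

lemma regularD:
  assumes "\<phi> \<in> L2_loc_t \<rho> \<eta>"
  shows "integrable (M \<Otimes>\<^sub>M M) (\<lambda>(x, y). complex_of_real (soft_weight \<eta> t x y) * kernel_form \<phi> x y)"
    and "integrable (M \<Otimes>\<^sub>M M) (\<lambda>(x, y). complex_of_real (theta \<eta> t x) * kernel_form \<phi> x y)"
    and "((\<lambda>s. surface_form \<rho> \<eta> q c s \<phi> \<phi>) has_vector_derivative
       weighted_form \<rho> q c (\<lambda>x y. deriv (\<lambda>s. soft_weight \<eta> s x y) t) \<phi> \<phi>) (at t)"
proof -
  note reg = regular[unfolded surface_form_regular_def, THEN bspec, OF assms, THEN bspec, OF assms, THEN spec, of t]
  show "integrable (M \<Otimes>\<^sub>M M) (\<lambda>(x, y). complex_of_real (soft_weight \<eta> t x y) * kernel_form \<phi> x y)"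
    by (rule conjunct1[OF reg])
  show "integrable (M \<Otimes>\<^sub>M M) (\<lambda>(x, y). complex_of_real (theta \<eta> t x) * kernel_form \<phi> x y)"
    by (rule conjunct1[OF conjunct2[OF reg]])
  show "((\<lambda>s. surface_form \<rho> \<eta> q c s \<phi> \<phi>) has_vector_derivative
       weighted_form \<rho> q c (\<lambda>x y. deriv (\<lambda>s. soft_weight \<eta> s x y) t) \<phi> \<phi>) (at t)"
    by (rule conjunct2[OF conjunct2[OF reg]])
qed

lemma L2_loc_strip: "\<phi> \<in> L2_loc_t \<rho> \<eta> \<Longrightarrow> \<phi> \<in> L2_strip \<rho> \<eta> t0 tmax"
  unfolding L2_loc_t_def using t0_less by simp

lemma L2_loc_spin:
  assumes "\<phi> \<in> L2_loc_t \<rho> \<eta>" "x \<in> S"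
  shows "\<phi> x \<in> spin_space x"
proof -
  have "\<phi> \<in> wave_functions \<rho>"
    using L2_loc_strip[OF assms(1)] unfolding L2_strip_iff by (rule conjunct1)
  then show ?thesis
    using assms(2) unfolding wave_functions_def by simp
qed

lemma spin_prod_commute:
  assumes "x \<in> S"
  shows "spin_prod x u v = cnj (spin_prod x v u)"
proof -
  have "selfadjoint x"
    using regular_point[OF assms] by (simp add: regular_point_def)
  then have "cinner (x u) v = cinner u (x v)"
    unfolding selfadjoint_def by simp
  then show ?thesis
    unfolding spin_prod_def using cinner_commute[of "x u" v] by simp
qed

lemma kernel_form_commute:
  assumes phi: "\<phi> \<in> L2_loc_t \<rho> \<eta>" and xy: "x \<in> S" "y \<in> S"
  shows "kernel_form \<phi> x y = cnj (kernel_form \<phi> y x)"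
proof -
  have sym: "\<forall>u\<in>spin_space x. \<forall>v\<in>spin_space y. spin_prod x u (q x y v) = spin_prod y (q y x u) v"
    using symmetric xy unfolding symmetric_kernel_def by blast
  have "kernel_form \<phi> x y = spin_prod y (q y x (\<phi> x)) (\<phi> y)"
    by (rule bspec[OF bspec[OF sym L2_loc_spin[OF phi xy(1)]] L2_loc_spin[OF phi xy(2)]])
  also have "\<dots> = cnj (kernel_form \<phi> y x)"
    by (rule spin_prod_commute[OF xy(2)])
  finally show ?thesis .
qed

text \<open>The weight vanishes on the diagonal, which removes the delta term; absolute
  integrability turns the iterated integral into one over the product.\<close>

lemma surface_form_eq:
  assumes "\<phi> \<in> L2_loc_t \<rho> \<eta>"
  shows "surface_form \<rho> \<eta> q c t \<phi> \<phi> = - 2 * \<i> *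
    integral\<^sup>L (M \<Otimes>\<^sub>M M) (\<lambda>(x, y). complex_of_real (soft_weight \<eta> t x y) * kernel_form \<phi> x y)"
proof -
  have "soft_weight \<eta> t x x = 0" for x
    unfolding soft_weight_def by simp
  then show ?thesis
    unfolding surface_form_def weighted_form_def
    using MM.integral_fst'[OF regularD(1)[OF assms, of t]] by simp
qed

text \<open>The integral of <\<phi>|Q \<phi>> against \<open>\<rho>\<^sub>t\<close> without the
  contribution of the delta distribution, which is real and does not affect the imaginary
  part.\<close>

definition flux :: "'a wave \<Rightarrow> real \<Rightarrow> complex" where
  "flux \<phi> t = integral\<^sup>L (M \<Otimes>\<^sub>M M) (\<lambda>(x, y). complex_of_real (theta \<eta> t x) * kernel_form \<phi> x y)"

text \<open>The weight has the time derivative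
  \<open>\<theta>\<^sub>t(x) - \<theta>\<^sub>t(y)\<close>. By the symmetry of the kernel,
  exchanging x and y turns the second term into the complex conjugate of the first, and -2i (z - cnj
  z) = 4 Im z.\<close>

lemma energy_derivative:
  assumes phi: "\<phi> \<in> L2_loc_t \<rho> \<eta>"
  shows "((\<lambda>s. energy s \<phi>) has_real_derivative 4 * Im (flux \<phi> t)) (at t)"
proof -
  define f1 where "f1 = (\<lambda>(x, y). complex_of_real (theta \<eta> t x) * kernel_form \<phi> x y)"
  define f2 where "f2 = (\<lambda>(x, y). cnj (f1 (y, x)))"
  have f1: "integrable (M \<Otimes>\<^sub>M M) f1"
    unfolding f1_def by (rule regularD(2)[OF phi])
  have swap: "integrable (M \<Otimes>\<^sub>M M) (\<lambda>(x, y). f1 (y, x))"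
    by (rule MM.integrable_product_swap[OF f1])
  have f2': "f2 = (\<lambda>p. cnj ((\<lambda>(x, y). f1 (y, x)) p))"
    unfolding f2_def by auto
  have f2: "integrable (M \<Otimes>\<^sub>M M) f2"
    unfolding f2' using swap by (rule integrable_cnj)
  have int2: "integral\<^sup>L (M \<Otimes>\<^sub>M M) f2 = cnj (flux \<phi> t)"
    unfolding f2' Bochner_Integration.integral_cnj flux_def f1_def [symmetric]
    by (subst MM.integral_product_swap) (use f1 in auto)
  have sw: "deriv (\<lambda>s. soft_weight \<eta> s x y) t = theta \<eta> t x - theta \<eta> t y" if "x \<in> S" "y \<in> S" for x y
  proof -
    have "(\<lambda>s. soft_weight \<eta> s x y) = (\<lambda>s. \<eta> s x - \<eta> s y)"
      unfolding soft_weight_def by (auto simp: algebra_simps)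
    then show ?thesis
      using DERIV_imp_deriv[OF DERIV_diff[OF eta_C1(1)[OF that(1)] eta_C1(1)[OF that(2)]]] by simp
  qed
  have "weighted_form \<rho> q c (\<lambda>x y. deriv (\<lambda>s. soft_weight \<eta> s x y) t) \<phi> \<phi>
      = - 2 * \<i> * (LINT x|M. LINT y|M. f1 (x, y) - f2 (x, y))"
    unfolding weighted_form_def
  proof (intro arg_cong[where f = "\<lambda>z. - 2 * \<i> * z"] Bochner_Integration.integral_cong refl)
    fix x assume "x \<in> space M"
    then have x: "x \<in> S" by simp
    have "(LINT y|M. complex_of_real (deriv (\<lambda>s. soft_weight \<eta> s x y) t) * kernel_form \<phi> x y)
        = (LINT y|M. f1 (x, y) - f2 (x, y))"
    proof (rule Bochner_Integration.integral_cong[OF refl])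
      fix y assume "y \<in> space M"
      then have y: "y \<in> S" by simp
      have "f2 (x, y) = complex_of_real (theta \<eta> t y) * kernel_form \<phi> x y"
        unfolding f2_def f1_def using kernel_form_commute[OF phi y x] by simp
      then show "complex_of_real (deriv (\<lambda>s. soft_weight \<eta> s x y) t) * kernel_form \<phi> x y = f1 (x, y) - f2 (x, y)"
        unfolding sw[OF x y] f1_def by (simp add: algebra_simps)
    qed
    then show "(LINT y|M. complex_of_real (deriv (\<lambda>s. soft_weight \<eta> s x y) t) * kernel_form \<phi> x y)
        + complex_of_real (c * deriv (\<lambda>s. soft_weight \<eta> s x x) t) * spin_prod x (\<phi> x) (\<phi> x)
        = (LINT y|M. f1 (x, y) - f2 (x, y))"
      unfolding sw[OF x x] by simp
  qed
  also have "\<dots> = - 2 * \<i> * (flux \<phi> t - cnj (flux \<phi> t))"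
    using MM.integral_fst'[OF Bochner_Integration.integrable_diff[OF f1 f2]] f1 f2 int2
    unfolding flux_def f1_def [symmetric] by simp
  also have "\<dots> = complex_of_real (4 * Im (flux \<phi> t))"
    by (simp add: complex_eq_iff)
  finally have "((\<lambda>s. surface_form \<rho> \<eta> q c s \<phi> \<phi>) has_vector_derivative complex_of_real (4 * Im (flux \<phi> t))) (at t)"
    using regularD(3)[OF phi, of t] by simp
  from bounded_linear.has_vector_derivative[OF bounded_linear_Re this]
  show ?thesis
    unfolding has_real_derivative_iff_has_vector_derivative Re_complex_of_real .
qed

lemma Q_L2_loc:
  assumes "\<phi> \<in> L2_loc_t \<rho> \<eta>"
  shows "AE x in M. integrable M (\<lambda>y. q x y (\<phi> y))" and "Q \<phi> \<in> L2_loc_t \<rho> \<eta>"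
proof -
  note * = time_range[unfolded finite_time_range_def, THEN conjunct2, THEN bspec, OF assms]
  show "AE x in M. integrable M (\<lambda>y. q x y (\<phi> y))"
    by (rule conjunct1[OF *])
  show "Q \<phi> \<in> L2_loc_t \<rho> \<eta>"
    by (rule conjunct2[OF *])
qed

text \<open>The kernel integral is \<open>Q \<phi> x - c *\<^sub>R \<phi> x\<close>, and the spin
  inner product of \<phi> with the term in c is real, so only <\<phi>|Q \<phi>> contributes. The
  density k is retained because Young's inequality is applied to it pointwise, before
  integration.\<close>

lemma flux_bound:
  assumes phi: "\<phi> \<in> L2_loc_t \<rho> \<eta>"
  obtains k where "integrable M k" "Im (flux \<phi> t) = (LINT x|M. k x)"
    "AE x in M. \<bar>k x\<bar> \<le> theta \<eta> t x * (norm (sect \<phi> x) * norm (sect (Q \<phi>) x))"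
proof -
  define f1 where "f1 = (\<lambda>(x, y). complex_of_real (theta \<eta> t x) * kernel_form \<phi> x y)"
  have f1: "integrable (M \<Otimes>\<^sub>M M) f1"
    unfolding f1_def by (rule regularD(2)[OF phi])
  define k where "k x = Im (LINT y|M. f1 (x, y))" for x
  have int: "integrable M k"
    unfolding k_def by (intro integrable_Im MM.integrable_fst' f1)
  have eq: "Im (flux \<phi> t) = (LINT x|M. k x)"
    using Bochner_Integration.integral_Im[OF MM.integrable_fst'[OF f1]] MM.integral_fst'[OF f1]
    unfolding k_def flux_def f1_def [symmetric] by simp
  have "AE x in M. x \<in> S"
    by (rule AE_I2) simp
  then have "AE x in M. \<bar>k x\<bar> \<le> theta \<eta> t x * (norm (sect \<phi> x) * norm (sect (Q \<phi>) x))"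
    using Q_L2_loc(1)[OF phi]
  proof eventually_elim
    case (elim x)
    have bl: "bounded_linear (\<lambda>v. spin_prod x (\<phi> x) v)"
      unfolding spin_prod_def
      by (intro bounded_linear_minus bounded_linear_compose[OF cinner.bounded_linear_right] blinfun.bounded_linear_right)
    have "(LINT y|M. f1 (x, y)) = complex_of_real (theta \<eta> t x) * (LINT y|M. kernel_form \<phi> x y)"
      unfolding f1_def by simp
    also have "(LINT y|M. kernel_form \<phi> x y) = spin_prod x (\<phi> x) (LINT y|M. q x y (\<phi> y))"
      by (rule integral_bounded_linear[OF bl elim(2)])
    also have "(LINT y|M. q x y (\<phi> y)) = Q \<phi> x - c *\<^sub>R \<phi> x"
      unfolding Q_apply_def using elim(1) by simp
    also have "spin_prod x (\<phi> x) (Q \<phi> x - c *\<^sub>R \<phi> x) = spin_prod x (\<phi> x) (Q \<phi> x) - c *\<^sub>R spin_prod x (\<phi> x) (\<phi> x)"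
      using linear_diff[OF bounded_linear.linear[OF bl]] linear_cmul[OF bounded_linear.linear[OF bl]] by simp
    finally have "k x = theta \<eta> t x * Im (spin_prod x (\<phi> x) (Q \<phi> x) - c *\<^sub>R spin_prod x (\<phi> x) (\<phi> x))"
      unfolding k_def by simp
    moreover have "Im (spin_prod x (\<phi> x) (\<phi> x)) = 0"
      using spin_prod_commute[OF elim(1), of "\<phi> x" "\<phi> x"] by (simp add: complex_eq_iff)
    ultimately have "\<bar>k x\<bar> = theta \<eta> t x * \<bar>Im (spin_prod x (\<phi> x) (Q \<phi> x))\<bar>"
      using theta_nonneg[OF elim(1)] by (simp add: abs_mult)
    also have "\<dots> \<le> theta \<eta> t x * (norm (sect \<phi> x) * norm (sect (Q \<phi>) x))"
      using theta_nonneg[OF elim(1)] abs_Im_le_cmod[of "spin_prod x (\<phi> x) (Q \<phi> x)"]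
        cmod_spin_prod_le[OF elim(1), of "\<phi> x" "Q \<phi> x"]
      by (intro mult_left_mono) linarith+
    finally show ?case .
  qed
  then show ?thesis
    using that int eq by blast
qed

lemma hyperbolicD:
  assumes "t \<in> {t0..tmax}" "\<phi> \<in> Cvary" "\<phi> \<in> L2_loc_t \<rho> \<eta>"
  shows "integrable M (\<lambda>x. theta \<eta> t x * (norm (sect \<phi> x))\<^sup>2)"
    and "(LINT x|M. theta \<eta> t x * (norm (sect \<phi> x))\<^sup>2) \<le> C\<^sup>2 * energy t \<phi>"
    and "0 \<le> energy t \<phi>"
proof -
  have C: "0 < C"
    using hyperbolic unfolding hyperbolicity_constant_def by blast
  have h: "integrable (rho_t \<rho> \<eta> t) (\<lambda>x. Re (spin_scal x (\<phi> x) (\<phi> x)))"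
    "1 / C\<^sup>2 * (LINT x|rho_t \<rho> \<eta> t. Re (spin_scal x (\<phi> x) (\<phi> x))) \<le> energy t \<phi>"
    using hyperbolic assms unfolding hyperbolicity_constant_def by blast+
  have meas: "sect \<phi> \<in> borel_measurable M"
    by (rule borel_measurable_M_continuous[OF Cvary_continuous(2)[OF assms(2)]])
  then have m: "(\<lambda>x. (norm (sect \<phi> x))\<^sup>2) \<in> borel_measurable M"
    by measurable
  have th: "AE x in M. 0 \<le> theta \<eta> t x"
    by (rule AE_I2) (simp add: theta_nonneg)
  have sp: "space (rho_t \<rho> \<eta> t) = S"
    unfolding rho_t_def by simp
  have i: "integrable (rho_t \<rho> \<eta> t) (\<lambda>x. (norm (sect \<phi> x))\<^sup>2)"
    using h(1) by (rule Bochner_Integration.integrable_cong[OF refl, THEN iffD1, rotated])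
      (simp add: sp spin_scal_self)
  have e: "(LINT x|rho_t \<rho> \<eta> t. Re (spin_scal x (\<phi> x) (\<phi> x))) = (LINT x|rho_t \<rho> \<eta> t. (norm (sect \<phi> x))\<^sup>2)"
    by (rule Bochner_Integration.integral_cong) (simp_all add: sp spin_scal_self)
  show "integrable M (\<lambda>x. theta \<eta> t x * (norm (sect \<phi> x))\<^sup>2)"
    using i unfolding rho_t_def integrable_real_density[OF measurable_theta th m] .
  have e2: "(LINT x|rho_t \<rho> \<eta> t. (norm (sect \<phi> x))\<^sup>2) = (LINT x|M. theta \<eta> t x * (norm (sect \<phi> x))\<^sup>2)"
    unfolding rho_t_def by (rule integral_real_density[OF measurable_theta th m])
  show le: "(LINT x|M. theta \<eta> t x * (norm (sect \<phi> x))\<^sup>2) \<le> C\<^sup>2 * energy t \<phi>"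
    using h(2) C unfolding e e2 by (simp add: field_simps)
  have "0 \<le> (LINT x|M. theta \<eta> t x * (norm (sect \<phi> x))\<^sup>2)"
    using theta_nonneg by (intro integral_nonneg_AE AE_I2) auto
  then have "0 \<le> C\<^sup>2 * energy t \<phi>"
    using le by (rule order_trans)
  then show "0 \<le> energy t \<phi>"
    using C by (simp add: zero_le_mult_iff)
qed

definition null_waves :: "'a wave set" where
  "null_waves = {\<phi> \<in> compactly_supported \<rho> Cvary. energy tmax \<phi> = 0}"

lemma null_waves_L2_loc: "\<phi> \<in> null_waves \<Longrightarrow> \<phi> \<in> L2_loc_t \<rho> \<eta>"
  unfolding null_waves_def using compactly_supported_L2_loc by blast

lemma null_waves_Cvary: "\<phi> \<in> null_waves \<Longrightarrow> \<phi> \<in> Cvary"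
  unfolding null_waves_def compactly_supported_def by blast

lemma test_space_subset: "test_space \<rho> \<eta> q c Cvary tmax \<subseteq> null_waves"
proof
  fix \<phi> assume "\<phi> \<in> test_space \<rho> \<eta> q c Cvary tmax"
  then have "\<phi> \<in> compactly_supported \<rho> Cvary" "surface_norm \<rho> \<eta> q c tmax \<phi> = 0"
    unfolding test_space_def by blast+
  then show "\<phi> \<in> null_waves"
    unfolding null_waves_def surface_norm_def by simp
qed

lemma energy_estimate:
  assumes phi: "\<phi> \<in> null_waves"
  shows "L2_norm \<rho> \<eta> t0 tmax \<phi> \<le> (2 * C\<^sup>2 * (tmax - t0)) * L2_norm \<rho> \<eta> t0 tmax (Q \<phi>)"
proof -
  have loc: "\<phi> \<in> L2_loc_t \<rho> \<eta>" and var: "\<phi> \<in> Cvary"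
    using null_waves_L2_loc[OF phi] null_waves_Cvary[OF phi] .
  have C: "0 < C"
    using hyperbolic unfolding hyperbolicity_constant_def by blast
  have strip: "\<phi> \<in> L2_strip \<rho> \<eta> t0 tmax" "Q \<phi> \<in> L2_strip \<rho> \<eta> t0 tmax"
    using L2_loc_strip loc Q_L2_loc(2)[OF loc] by blast+
  have mf: "sect \<phi> \<in> borel_measurable M" and mh: "sect (Q \<phi>) \<in> borel_measurable M"
    and intf: "integrable M (\<lambda>x. (norm (sect \<phi> x))\<^sup>2 * eta_strip \<eta> t0 tmax x)"
    and inth: "integrable M (\<lambda>x. (norm (sect (Q \<phi>) x))\<^sup>2 * eta_strip \<eta> t0 tmax x)"
    using strip unfolding L2_strip_iff by blast+
  have mf2: "(\<lambda>x. (norm (sect \<phi> x))\<^sup>2) \<in> borel_measurable M"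
    and mh2: "(\<lambda>x. (norm (sect (Q \<phi>) x))\<^sup>2) \<in> borel_measurable M"
    using mf mh by measurable
  define u where "u t = enn2real (\<integral>\<^sup>+x. ennreal (theta \<eta> t x * (norm (sect \<phi> x))\<^sup>2) \<partial>M)" for t
  define v where "v t = enn2real (\<integral>\<^sup>+x. ennreal (theta \<eta> t x * (norm (sect (Q \<phi>) x))\<^sup>2) \<partial>M)" for t
  have th0: "AE x in M. 0 \<le> theta \<eta> t x * (norm (sect \<psi> x))\<^sup>2" for t \<psi>
    by (rule AE_I2) (simp add: theta_nonneg)
  \<comment> \<open>Should the integral be infinite, \<open>enn2real\<close> and the Bochner
    integral both give 0, so the equation holds at every time.\<close>
  have u_eq: "u t = (LINT x|M. theta \<eta> t x * (norm (sect \<phi> x))\<^sup>2)" for t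
    unfolding u_def using mf2 by (intro integral_eq_nn_integral [symmetric] th0 borel_measurable_times measurable_theta)
  have v_eq: "v t = (LINT x|M. theta \<eta> t x * (norm (sect (Q \<phi>) x))\<^sup>2)" for t
    unfolding v_def using mh2 by (intro integral_eq_nn_integral [symmetric] th0 borel_measurable_times measurable_theta)
  define U where "U = (LINT x|M. (norm (sect \<phi> x))\<^sup>2 * eta_strip \<eta> t0 tmax x)"
  define V where "V = (LINT x|M. (norm (sect (Q \<phi>) x))\<^sup>2 * eta_strip \<eta> t0 tmax x)"
  have "U \<le> (2 * C\<^sup>2 * (tmax - t0))\<^sup>2 * V"
  proof (rule energy_integration[OF t0_less C energy_derivative[OF loc]])
    show "energy tmax \<phi> = 0"
      using phi unfolding null_waves_def by blast
    show "(u has_integral U) {t0..tmax}"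
      unfolding u_def U_def using foliation_Tonelli(2)[OF mf2 _ _ intf] t0_less by simp
    show "(v has_integral V) {t0..tmax}"
      unfolding v_def V_def using foliation_Tonelli(2)[OF mh2 _ _ inth] t0_less by simp
    show "u t \<le> C\<^sup>2 * energy t \<phi>" if "t \<in> {t0..tmax}" for t
      unfolding u_eq by (rule hyperbolicD(2)[OF that var loc])
    \<comment> \<open>The norm of \<open>Q \<phi>\<close> with respect to
      \<open>\<rho>\<^sub>t\<close> is known to be finite only for almost every t, by Tonelli; for
      \<phi> itself hyperbolicity provides finiteness at every t of the interval.\<close>
    have "AE t in lborel. t \<in> {t0..tmax} \<longrightarrow> (\<integral>\<^sup>+x. ennreal (theta \<eta> t x * (norm (sect (Q \<phi>) x))\<^sup>2) \<partial>M) < \<infinity>"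
      using foliation_Tonelli(1)[OF mh2 _ _ inth] t0_less by simp
    then show "AE t in lborel. t \<in> {t0..tmax} \<longrightarrow> (\<forall>g B. 0 \<le> g \<longrightarrow> 0 < B \<longrightarrow>
        g * \<bar>4 * Im (flux \<phi> t)\<bar> \<le> 4 * g\<^sup>2 / B * u t + B * v t)"
    proof eventually_elim
      case (elim t)
      show ?case
      proof (intro impI allI)
        fix g B :: real
        assume t: "t \<in> {t0..tmax}" and g: "0 \<le> g" and B: "0 < B"
        have ih: "integrable M (\<lambda>x. theta \<eta> t x * (norm (sect (Q \<phi>) x))\<^sup>2)"
        proof (rule integrableI_nonneg[OF _ th0])
          show "(\<lambda>x. theta \<eta> t x * (norm (sect (Q \<phi>) x))\<^sup>2) \<in> borel_measurable M"
            using mh2 by (intro borel_measurable_times measurable_theta)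
          show "(\<integral>\<^sup>+x. ennreal (theta \<eta> t x * (norm (sect (Q \<phi>) x))\<^sup>2) \<partial>M) < \<infinity>"
            using elim t by blast
        qed
        note iu = hyperbolicD(1)[OF t var loc]
        obtain k where k: "integrable M k" "Im (flux \<phi> t) = (LINT x|M. k x)"
          "AE x in M. \<bar>k x\<bar> \<le> theta \<eta> t x * (norm (sect \<phi> x) * norm (sect (Q \<phi>) x))"
          by (rule flux_bound[OF loc])
        have "g * \<bar>4 * Im (flux \<phi> t)\<bar> = 4 * g * \<bar>LINT x|M. k x\<bar>"
          unfolding k(2) by (simp add: abs_mult)
        also have "\<dots> \<le> 4 * g * (LINT x|M. \<bar>k x\<bar>)"
          using g by (intro mult_left_mono integral_abs_bound) auto
        also have "\<dots> = (LINT x|M. 4 * g * \<bar>k x\<bar>)"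
          by simp
        also have "\<dots> \<le> (LINT x|M. 4 * g\<^sup>2 / B * (theta \<eta> t x * (norm (sect \<phi> x))\<^sup>2)
            + B * (theta \<eta> t x * (norm (sect (Q \<phi>) x))\<^sup>2))"
        proof (rule integral_mono_AE)
          show "integrable M (\<lambda>x. 4 * g * \<bar>k x\<bar>)"
            using k(1) by simp
          show "integrable M (\<lambda>x. 4 * g\<^sup>2 / B * (theta \<eta> t x * (norm (sect \<phi> x))\<^sup>2)
            + B * (theta \<eta> t x * (norm (sect (Q \<phi>) x))\<^sup>2))"
            using iu ih by (intro Bochner_Integration.integrable_add integrable_mult_right) auto
          have "AE x in M. 0 \<le> theta \<eta> t x"
            by (rule AE_I2) (simp add: theta_nonneg)
          then show "AE x in M. 4 * g * \<bar>k x\<bar> \<le> 4 * g\<^sup>2 / B * (theta \<eta> t x * (norm (sect \<phi> x))\<^sup>2)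
            + B * (theta \<eta> t x * (norm (sect (Q \<phi>) x))\<^sup>2)"
            using k(3)
          proof eventually_elim
            case (elim x)
            have "4 * g * \<bar>k x\<bar> \<le> 4 * g * (theta \<eta> t x * (norm (sect \<phi> x) * norm (sect (Q \<phi>) x)))"
              using g elim by (intro mult_left_mono) auto
            also have "\<dots> = theta \<eta> t x * (4 * g * (norm (sect \<phi> x) * norm (sect (Q \<phi>) x)))"
              by simp
            also have "\<dots> \<le> theta \<eta> t x * (4 * g\<^sup>2 / B * (norm (sect \<phi> x))\<^sup>2 + B * (norm (sect (Q \<phi>) x))\<^sup>2)"
              using elim by (intro mult_left_mono weighted_AM_GM B) auto
            finally show ?case
              by (simp add: algebra_simps)
          qed
        qed
        also have "\<dots> = 4 * g\<^sup>2 / B * u t + B * v t"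
          unfolding u_eq v_eq
          by (subst Bochner_Integration.integral_add) (use iu ih in auto)
        finally show "g * \<bar>4 * Im (flux \<phi> t)\<bar> \<le> 4 * g\<^sup>2 / B * u t + B * v t" .
      qed
    qed
  qed
  then have "sqrt U \<le> sqrt ((2 * C\<^sup>2 * (tmax - t0))\<^sup>2 * V)"
    by simp
  also have "\<dots> = (2 * C\<^sup>2 * (tmax - t0)) * sqrt V"
    using t0_less by (simp add: real_sqrt_mult)
  finally show ?thesis
    unfolding L2_norm_eq U_def V_def .
qed

section \<open>Linearity of the space of null waves and of the operator\<close>

lemma compactly_supported_combination:
  assumes "\<phi> \<in> compactly_supported \<rho> Cvary" "\<psi> \<in> compactly_supported \<rho> Cvary"
  shows "(\<lambda>x. a *\<^sub>C \<phi> x + b *\<^sub>C \<psi> x) \<in> compactly_supported \<rho> Cvary"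
proof -
  let ?\<zeta> = "\<lambda>x. a *\<^sub>C \<phi> x + b *\<^sub>C \<psi> x"
  let ?K = "support_M \<rho> \<phi> \<union> support_M \<rho> \<psi>"
  have K: "compact ?K" and mem: "\<phi> \<in> Cvary" "\<psi> \<in> Cvary"
    using assms unfolding compactly_supported_def by auto
  have sub: "{x \<in> S. ?\<zeta> x \<noteq> 0} \<subseteq> ?K"
  proof
    fix x assume "x \<in> {x \<in> S. ?\<zeta> x \<noteq> 0}"
    then have "x \<in> S" "\<phi> x \<noteq> 0 \<or> \<psi> x \<noteq> 0"
      by auto
    then show "x \<in> ?K"
      using closure_subset[of "{x \<in> S. \<phi> x \<noteq> 0}"] closure_subset[of "{x \<in> S. \<psi> x \<noteq> 0}"]
      unfolding support_M_def by blast
  qed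
  then have cl: "closure {x \<in> S. ?\<zeta> x \<noteq> 0} \<subseteq> ?K"
    by (rule closure_minimal[OF _ compact_imp_closed[OF K]])
  have "?K \<subseteq> S"
    unfolding support_M_def by blast
  then have "support_M \<rho> ?\<zeta> = ?K \<inter> closure {x \<in> S. ?\<zeta> x \<noteq> 0}"
    using cl unfolding support_M_def by blast
  then have "compact (support_M \<rho> ?\<zeta>)"
    using K by (simp add: compact_Int_closed)
  moreover have "?\<zeta> \<in> Cvary"
  proof -
    have sum: "\<forall>\<psi>\<in>Cvary. \<forall>\<phi>\<in>Cvary. (\<lambda>x. \<psi> x + \<phi> x) \<in> Cvary"
      and "(\<lambda>x. a *\<^sub>C \<phi> x) \<in> Cvary" "(\<lambda>x. b *\<^sub>C \<psi> x) \<in> Cvary"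
      using subspace mem unfolding wave_subspace_def by blast+
    then show ?thesis
      using bspec[OF bspec[OF sum]] by blast
  qed
  ultimately show ?thesis
    unfolding compactly_supported_def by blast
qed

lemma kernel_linear:
  assumes "x \<in> S" "y \<in> S" "u \<in> spin_space y" "v \<in> spin_space y"
  shows "q x y (a *\<^sub>C u + b *\<^sub>C v) = a *\<^sub>C q x y u + b *\<^sub>C q x y v"
proof -
  have sc: "d *\<^sub>C w \<in> spin_space y" if w: "w \<in> spin_space y" for d w
  proof -
    obtain z where "w = y z"
      using w by blast
    then have "d *\<^sub>C w = y (d *\<^sub>C z)"
      using selfadjoint_scaleC[of y d z] regular_point[OF assms(2)] by (simp add: regular_point_def)
    then show ?thesis by (simp only: rangeI)
  qed
  note sym = symmetric[unfolded symmetric_kernel_def, THEN bspec, OF assms(1), THEN bspec, OF assms(2)]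
  have add: "\<forall>v\<in>spin_space y. \<forall>w\<in>spin_space y. q x y (v + w) = q x y v + q x y w"
    by (rule conjunct1[OF conjunct2[OF sym]])
  have scale: "\<forall>a. \<forall>v\<in>spin_space y. q x y (a *\<^sub>C v) = a *\<^sub>C q x y v"
    by (rule conjunct1[OF conjunct2[OF conjunct2[OF sym]]])
  show ?thesis
    unfolding bspec[OF bspec[OF add sc[OF assms(3)]] sc[OF assms(4)]]
      bspec[OF spec[OF scale] assms(3)] bspec[OF spec[OF scale] assms(4)] ..
qed

lemma spin_prod_combination:
  "spin_prod x (a *\<^sub>C u + b *\<^sub>C v) (a *\<^sub>C w + b *\<^sub>C z)
    = (cnj a * a) * spin_prod x u w + (cnj a * b) * spin_prod x u z
      + (cnj b * a) * spin_prod x v w + (cnj b * b) * spin_prod x v z" if "x \<in> S"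
proof -
  have "selfadjoint x"
    using regular_point[OF that] by (simp add: regular_point_def)
  then show ?thesis
    unfolding spin_prod_def
    by (simp add: blinfun.add_right selfadjoint_scaleC cinner.add_left cinner.add_right
        cinner_scaleC_left cinner_scaleC_right algebra_simps)
qed

text \<open>The terms mixing \<phi> and \<psi> cancel pointwise under the integral. All four waves
  are compactly supported, so each of the integrals exists separately.\<close>

lemma energy_parallelogram:
  assumes phi: "\<phi> \<in> compactly_supported \<rho> Cvary" "\<psi> \<in> compactly_supported \<rho> Cvary"
  shows "energy t (\<lambda>x. a *\<^sub>C \<phi> x + b *\<^sub>C \<psi> x) + energy t (\<lambda>x. a *\<^sub>C \<phi> x + (- b) *\<^sub>C \<psi> x)
    = 2 * (cmod a)\<^sup>2 * energy t \<phi> + 2 * (cmod b)\<^sup>2 * energy t \<psi>"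
proof -
  let ?P = "\<lambda>x. a *\<^sub>C \<phi> x + b *\<^sub>C \<psi> x" and ?N = "\<lambda>x. a *\<^sub>C \<phi> x + (- b) *\<^sub>C \<psi> x"
  define W where "W \<zeta> = (\<lambda>(x, y). complex_of_real (soft_weight \<eta> t x y) * kernel_form \<zeta> x y)" for \<zeta>
  note loc = compactly_supported_L2_loc
  have P: "?P \<in> L2_loc_t \<rho> \<eta>" and N: "?N \<in> L2_loc_t \<rho> \<eta>"
    and loc': "\<phi> \<in> L2_loc_t \<rho> \<eta>" "\<psi> \<in> L2_loc_t \<rho> \<eta>"
    using loc compactly_supported_combination[OF phi] phi by blast+
  have W: "integrable (M \<Otimes>\<^sub>M M) (W \<zeta>)" if "\<zeta> \<in> L2_loc_t \<rho> \<eta>" for \<zeta>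
    unfolding W_def by (rule regularD(1)[OF that])
  have "W ?P p + W ?N p = complex_of_real (2 * (cmod a)\<^sup>2) * W \<phi> p + complex_of_real (2 * (cmod b)\<^sup>2) * W \<psi> p"
    if pM: "p \<in> space (M \<Otimes>\<^sub>M M)" for p
  proof -
    obtain x y where p: "p = (x, y)" "x \<in> S" "y \<in> S"
      using pM by (auto simp: space_pair_measure)
    have sp: "\<phi> y \<in> spin_space y" "\<psi> y \<in> spin_space y"
      using L2_loc_spin loc' p by blast+
    have "kernel_form ?P x y + kernel_form ?N x y
        = 2 * (cnj a * a) * kernel_form \<phi> x y + 2 * (cnj b * b) * kernel_form \<psi> x y"
      unfolding kernel_linear[OF p(2,3) sp] spin_prod_combination[OF p(2)] by (simp add: algebra_simps)
    moreover have "cnj a * a = complex_of_real ((cmod a)\<^sup>2)" "cnj b * b = complex_of_real ((cmod b)\<^sup>2)"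
      by (simp_all only: complex_norm_square mult.commute)
    ultimately have "kernel_form ?P x y + kernel_form ?N x y
        = complex_of_real (2 * (cmod a)\<^sup>2) * kernel_form \<phi> x y + complex_of_real (2 * (cmod b)\<^sup>2) * kernel_form \<psi> x y"
      by simp
    then have "complex_of_real (soft_weight \<eta> t x y) * (kernel_form ?P x y + kernel_form ?N x y)
        = complex_of_real (soft_weight \<eta> t x y) *
          (complex_of_real (2 * (cmod a)\<^sup>2) * kernel_form \<phi> x y + complex_of_real (2 * (cmod b)\<^sup>2) * kernel_form \<psi> x y)"
      by (rule arg_cong)
    then show ?thesis
      unfolding W_def p(1) by (simp only: prod.case distrib_left mult_ac)
  qed
  then have "(LINT p|(M \<Otimes>\<^sub>M M). W ?P p + W ?N p)
      = (LINT p|(M \<Otimes>\<^sub>M M). complex_of_real (2 * (cmod a)\<^sup>2) * W \<phi> p + complex_of_real (2 * (cmod b)\<^sup>2) * W \<psi> p)"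
    by (rule Bochner_Integration.integral_cong[OF refl])
  then have "integral\<^sup>L (M \<Otimes>\<^sub>M M) (W ?P) + integral\<^sup>L (M \<Otimes>\<^sub>M M) (W ?N)
      = complex_of_real (2 * (cmod a)\<^sup>2) * integral\<^sup>L (M \<Otimes>\<^sub>M M) (W \<phi>)
        + complex_of_real (2 * (cmod b)\<^sup>2) * integral\<^sup>L (M \<Otimes>\<^sub>M M) (W \<psi>)"
    using W P N loc' by simp
  moreover have "energy t \<zeta> = 2 * Im (integral\<^sup>L (M \<Otimes>\<^sub>M M) (W \<zeta>))" if "\<zeta> \<in> L2_loc_t \<rho> \<eta>" for \<zeta>
    unfolding surface_form_eq[OF that] W_def by simp
  ultimately show ?thesis
    using P N loc' by (simp add: complex_eq_iff)
qed

text \<open>By the parallelogram identity, the energies of the combination and of its counterpart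
  with - b add up to zero. Hyperbolicity at \<open>tmax\<close> makes both nonnegative, so each
  vanishes.\<close>

lemma null_waves_combination:
  assumes "\<phi> \<in> null_waves" "\<psi> \<in> null_waves"
  shows "(\<lambda>x. a *\<^sub>C \<phi> x + b *\<^sub>C \<psi> x) \<in> null_waves"
proof -
  have cs: "\<phi> \<in> compactly_supported \<rho> Cvary" "\<psi> \<in> compactly_supported \<rho> Cvary"
    and "energy tmax \<phi> = 0" "energy tmax \<psi> = 0"
    using assms unfolding null_waves_def by auto
  then have sum: "energy tmax (\<lambda>x. a *\<^sub>C \<phi> x + b *\<^sub>C \<psi> x) + energy tmax (\<lambda>x. a *\<^sub>C \<phi> x + (- b) *\<^sub>C \<psi> x) = 0"
    using energy_parallelogram[OF cs] by simp
  have nonneg: "0 \<le> energy tmax \<zeta>" if "\<zeta> \<in> compactly_supported \<rho> Cvary" for \<zeta>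
  proof (rule hyperbolicD(3))
    show "\<zeta> \<in> Cvary"
      using that unfolding compactly_supported_def by blast
    show "\<zeta> \<in> L2_loc_t \<rho> \<eta>"
      by (rule compactly_supported_L2_loc[OF that])
  qed (use t0_less in simp)
  have "energy tmax (\<lambda>x. a *\<^sub>C \<phi> x + b *\<^sub>C \<psi> x) = 0"
    using nonneg[OF compactly_supported_combination[OF cs, of a b]]
      nonneg[OF compactly_supported_combination[OF cs, of a "- b"]] sum by linarith
  then show ?thesis
    using compactly_supported_combination[OF cs, of a b] unfolding null_waves_def by blast
qed

text \<open>On a null set the integrals defining \<open>Q\<close> may fail to exist and default to
  0, which can break additivity; elsewhere linearity of the kernel passes to the integral.\<close>

lemma Q_combination:
  assumes "\<phi> \<in> L2_loc_t \<rho> \<eta>" "\<psi> \<in> L2_loc_t \<rho> \<eta>"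
  shows "AE x in M. Q (\<lambda>x. a *\<^sub>C \<phi> x + b *\<^sub>C \<psi> x) x = a *\<^sub>C Q \<phi> x + b *\<^sub>C Q \<psi> x"
proof -
  have "AE x in M. x \<in> S"
    by (rule AE_I2) simp
  then show ?thesis
    using Q_L2_loc(1)[OF assms(1)] Q_L2_loc(1)[OF assms(2)]
  proof eventually_elim
    case (elim x)
    have "(LINT y|M. q x y (a *\<^sub>C \<phi> y + b *\<^sub>C \<psi> y)) = (LINT y|M. a *\<^sub>C q x y (\<phi> y) + b *\<^sub>C q x y (\<psi> y))"
      by (rule Bochner_Integration.integral_cong[OF refl])
        (use kernel_linear[OF elim(1)] L2_loc_spin assms in simp)
    also have "\<dots> = a *\<^sub>C (LINT y|M. q x y (\<phi> y)) + b *\<^sub>C (LINT y|M. q x y (\<psi> y))"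
      using elim
      by (subst Bochner_Integration.integral_add)
        (auto simp: integral_bounded_linear[OF bounded_linear_scaleC]
          intro: integrable_bounded_linear[OF bounded_linear_scaleC])
    finally show ?case
      unfolding Q_apply_def using elim(1)
      by (simp add: scaleC_add_right scaleR_add_right scaleR_scaleC scaleC_scaleC mult.commute)
  qed
qed

end

section \<open>Weak solutions\<close>

context dynamical_cfs
begin

text \<open>With the weight absorbed into the measure, membership in \<open>L2_strip\<close> becomes
  plain square integrability of the section.\<close>

definition strip_measure :: "'a op measure" where
  "strip_measure = density M (\<lambda>x. ennreal (eta_strip \<eta> t0 tmax x))"

lemma space_strip_measure [simp]: "space strip_measure = S"
  unfolding strip_measure_def by simp

lemma measurable_strip_measure: "borel_measurable strip_measure = borel_measurable M"
  unfolding strip_measure_def by (rule measurable_cong_sets) simp_all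

lemma eta_strip_AE: "AE x in M. 0 \<le> eta_strip \<eta> t0 tmax x"
  by (rule AE_I2) (use eta_strip_nonneg t0_less in simp)

lemma AE_strip_measure: "AE x in M. P x \<Longrightarrow> AE x in strip_measure. P x"
  unfolding strip_measure_def by (subst AE_density) (auto elim: eventually_mono)

lemma sq_integrable_strip_measure:
  "sq_integrable strip_measure f \<longleftrightarrow>
    f \<in> borel_measurable M \<and> integrable M (\<lambda>x. (norm (f x))\<^sup>2 * eta_strip \<eta> t0 tmax x)"
proof -
  have "integrable strip_measure (\<lambda>x. (norm (f x))\<^sup>2) \<longleftrightarrow> integrable M (\<lambda>x. (norm (f x))\<^sup>2 * eta_strip \<eta> t0 tmax x)"
    if f: "f \<in> borel_measurable M"
  proof -
    have m: "(\<lambda>x. (norm (f x))\<^sup>2) \<in> borel_measurable M"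
      using f by measurable
    show ?thesis
      unfolding strip_measure_def integrable_real_density[OF measurable_eta_strip eta_strip_AE m]
      by (simp add: mult.commute)
  qed
  then show ?thesis
    unfolding sq_integrable_def measurable_strip_measure by blast
qed

lemma L2_strip_sq_integrable:
  "\<psi> \<in> L2_strip \<rho> \<eta> t0 tmax \<longleftrightarrow> \<psi> \<in> wave_functions \<rho> \<and> sq_integrable strip_measure (sect \<psi>)"
  unfolding L2_strip_iff sq_integrable_strip_measure ..

lemma L2_norm_l2_ip:
  assumes "sect \<psi> \<in> borel_measurable M"
  shows "L2_norm \<rho> \<eta> t0 tmax \<psi> = sqrt (l2_ip strip_measure (sect \<psi>) (sect \<psi>))"
proof -
  have m: "(\<lambda>x. (norm (sect \<psi> x))\<^sup>2) \<in> borel_measurable M"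
    using assms by measurable
  show ?thesis
    unfolding L2_norm_eq l2_ip_self strip_measure_def integral_real_density[OF measurable_eta_strip eta_strip_AE m]
    by (simp add: mult.commute)
qed

lemma krein_inner_strip_measure:
  assumes "sect \<phi> \<in> borel_measurable M" "sect \<psi> \<in> borel_measurable M"
  shows "krein_inner \<rho> \<eta> t0 tmax \<phi> \<psi> = - (LINT x|strip_measure. cinner (sect \<phi> x) (sgn_op x (sect \<psi> x)))"
proof -
  have "(\<lambda>x. cinner (sect \<phi> x) (sgn_op x (sect \<psi> x))) \<in> borel_measurable M"
    using assms by (intro borel_measurable_cinner measurable_sgn_section)
  then show ?thesis
    unfolding krein_inner_eq strip_measure_def
    by (subst integral_density) (auto simp: eta_strip_AE scaleR_conv_of_real mult.commute)
qed

lemma sq_integrable_sgn_op: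
  assumes "sq_integrable strip_measure f"
  shows "sq_integrable strip_measure (\<lambda>x. sgn_op x (f x))"
    and "l2_ip strip_measure (\<lambda>x. sgn_op x (f x)) (\<lambda>x. sgn_op x (f x)) \<le> l2_ip strip_measure f f"
proof -
  have f: "f \<in> borel_measurable M" "integrable strip_measure (\<lambda>x. (norm (f x))\<^sup>2)"
    using assms unfolding sq_integrable_def measurable_strip_measure by auto
  have m: "(\<lambda>x. sgn_op x (f x)) \<in> borel_measurable strip_measure"
    unfolding measurable_strip_measure by (rule measurable_sgn_section[OF f(1)])
  have le: "(norm (sgn_op x (f x)))\<^sup>2 \<le> (norm (f x))\<^sup>2" if "x \<in> S" for x
    by (intro power_mono regular_point.norm_sgn_op_le[OF regular_point[OF that]]) simp
  have int: "integrable strip_measure (\<lambda>x. (norm (sgn_op x (f x)))\<^sup>2)"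
  proof (rule Bochner_Integration.integrable_bound[OF f(2)])
    show "(\<lambda>x. (norm (sgn_op x (f x)))\<^sup>2) \<in> borel_measurable strip_measure"
      using m by measurable
    show "AE x in strip_measure. norm ((norm (sgn_op x (f x)))\<^sup>2) \<le> norm ((norm (f x))\<^sup>2)"
      by (rule AE_I2) (use le in simp)
  qed
  then show "sq_integrable strip_measure (\<lambda>x. sgn_op x (f x))"
    unfolding sq_integrable_def using m by blast
  show "l2_ip strip_measure (\<lambda>x. sgn_op x (f x)) (\<lambda>x. sgn_op x (f x)) \<le> l2_ip strip_measure f f"
    unfolding l2_ip_self by (rule integral_mono[OF int f(2)]) (use le in simp)
qed

lemma L2_loc_sq_integrable: "\<phi> \<in> L2_loc_t \<rho> \<eta> \<Longrightarrow> sq_integrable strip_measure (sect \<phi>)"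
  using L2_loc_strip unfolding L2_strip_sq_integrable by blast

lemma sect_combination:
  assumes "x \<in> S"
  shows "sqrt_abs x (a *\<^sub>C u + b *\<^sub>C v) = a *\<^sub>C sqrt_abs x u + b *\<^sub>C sqrt_abs x v"
  using regular_point.sqrt_abs_scaleC[OF regular_point[OF assms]] by (simp add: blinfun.add_right)

lemma krein_inner_combination:
  assumes "\<phi> \<in> L2_loc_t \<rho> \<eta>" "\<psi> \<in> L2_loc_t \<rho> \<eta>" "(\<lambda>x. a *\<^sub>C \<phi> x + b *\<^sub>C \<psi> x) \<in> L2_loc_t \<rho> \<eta>"
    and w: "w \<in> L2_strip \<rho> \<eta> t0 tmax"
  shows "krein_inner \<rho> \<eta> t0 tmax (\<lambda>x. a *\<^sub>C \<phi> x + b *\<^sub>C \<psi> x) w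
    = cnj a * krein_inner \<rho> \<eta> t0 tmax \<phi> w + cnj b * krein_inner \<rho> \<eta> t0 tmax \<psi> w"
proof -
  define g where "g = (\<lambda>x. sgn_op x (sect w x))"
  have sw: "sq_integrable strip_measure (sect w)"
    using w unfolding L2_strip_sq_integrable by blast
  have g: "sq_integrable strip_measure g"
    unfolding g_def by (rule sq_integrable_sgn_op(1)[OF sw])
  note sq = L2_loc_sq_integrable[OF assms(1)] L2_loc_sq_integrable[OF assms(2)] L2_loc_sq_integrable[OF assms(3)]
  have meas: "sect \<zeta> \<in> borel_measurable M" if "sq_integrable strip_measure (sect \<zeta>)" for \<zeta>
    using that unfolding sq_integrable_def measurable_strip_measure by blast
  have "(LINT x|strip_measure. cinner (sect (\<lambda>x. a *\<^sub>C \<phi> x + b *\<^sub>C \<psi> x) x) (g x))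
      = (LINT x|strip_measure. cnj a * cinner (sect \<phi> x) (g x) + cnj b * cinner (sect \<psi> x) (g x))"
    by (rule Bochner_Integration.integral_cong)
      (simp_all add: sect_combination cinner.add_left cinner_scaleC_left)
  also have "\<dots> = cnj a * (LINT x|strip_measure. cinner (sect \<phi> x) (g x)) + cnj b * (LINT x|strip_measure. cinner (sect \<psi> x) (g x))"
    using sq_integrable_cinner[OF sq(1) g] sq_integrable_cinner[OF sq(2) g] by simp
  finally show ?thesis
    unfolding krein_inner_strip_measure[OF meas[OF sq(1)] meas[OF sw]]
      krein_inner_strip_measure[OF meas[OF sq(2)] meas[OF sw]]
      krein_inner_strip_measure[OF meas[OF sq(3)] meas[OF sw]] g_def [symmetric]
    by (simp add: g_def)
qed

text \<open>The signature operators are pointwise contractions, so the indefinite product inherits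
  the Cauchy-Schwarz bound of the scalar product.\<close>

lemma Re_krein_inner_le:
  assumes "\<phi> \<in> L2_loc_t \<rho> \<eta>" and w: "w \<in> L2_strip \<rho> \<eta> t0 tmax"
  shows "Re (krein_inner \<rho> \<eta> t0 tmax \<phi> w) \<le> L2_norm \<rho> \<eta> t0 tmax \<phi> * L2_norm \<rho> \<eta> t0 tmax w"
proof -
  define g where "g = (\<lambda>x. sgn_op x (sect w x))"
  have sq: "sq_integrable strip_measure (sect \<phi>)" and sw: "sq_integrable strip_measure (sect w)"
    using L2_loc_sq_integrable[OF assms(1)] w unfolding L2_strip_sq_integrable by blast+
  have g: "sq_integrable strip_measure g" "l2_ip strip_measure g g \<le> l2_ip strip_measure (sect w) (sect w)"
    unfolding g_def using sq_integrable_sgn_op[OF sw] .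
  have meas: "sect \<phi> \<in> borel_measurable M" "sect w \<in> borel_measurable M"
    using sq sw unfolding sq_integrable_def measurable_strip_measure by blast+
  have "Re (krein_inner \<rho> \<eta> t0 tmax \<phi> w) = - l2_ip strip_measure (sect \<phi>) g"
    unfolding krein_inner_strip_measure[OF meas] l2_ip_def g_def
    using Bochner_Integration.integral_Re[OF sq_integrable_cinner[OF sq g(1)]] unfolding g_def by simp
  also have "\<dots> \<le> sqrt (l2_ip strip_measure (sect \<phi>) (sect \<phi>)) * sqrt (l2_ip strip_measure g g)"
    using l2_Cauchy_Schwarz[OF sq g(1)] by linarith
  also have "\<dots> \<le> sqrt (l2_ip strip_measure (sect \<phi>) (sect \<phi>)) * sqrt (l2_ip strip_measure (sect w) (sect w))"
    using g(2) l2_ip_self_nonneg by (intro mult_left_mono) auto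
  finally show ?thesis
    unfolding L2_norm_l2_ip[OF meas(1)] L2_norm_l2_ip[OF meas(2)] .
qed

text \<open>The energy estimate also makes the functional well defined: if \<open>Q \<phi>\<close>
  vanishes almost everywhere on the strip, then so does the norm of \<phi> and with it the value. A
  linear graph together with the bound is therefore all that \<open>l2_Riesz\<close> has to be
  given.\<close>

lemma weak_solution:
  assumes w: "w \<in> L2_strip \<rho> \<eta> t0 tmax"
  shows "\<exists>\<psi>\<in>L2_strip \<rho> \<eta> t0 tmax.
    (\<forall>\<phi>\<in>null_waves. krein_inner \<rho> \<eta> t0 tmax (Q \<phi>) \<psi> = krein_inner \<rho> \<eta> t0 tmax \<phi> w) \<and>
    L2_norm \<rho> \<eta> t0 tmax \<psi> \<le> (2 * C\<^sup>2 * (tmax - t0)) * L2_norm \<rho> \<eta> t0 tmax w"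
proof -
  let ?\<mu> = strip_measure
  define K where "K = (2 * C\<^sup>2 * (tmax - t0)) * L2_norm \<rho> \<eta> t0 tmax w"
  have wn: "0 \<le> L2_norm \<rho> \<eta> t0 tmax w"
    unfolding L2_norm_eq using eta_strip_AE by (intro real_sqrt_ge_zero integral_nonneg_AE) (auto elim: eventually_mono)
  have K: "0 \<le> K"
    unfolding K_def using wn t0_less by simp
  define G where "G = {(f, l). \<exists>\<phi>\<in>null_waves. f \<in> borel_measurable M \<and>
    (AE x in ?\<mu>. f x = sect (Q \<phi>) x) \<and> l = Re (krein_inner \<rho> \<eta> t0 tmax \<phi> w)}"
  have sqQ: "sq_integrable ?\<mu> (sect (Q \<phi>))" if "\<phi> \<in> null_waves" for \<phi>
    by (rule L2_loc_sq_integrable[OF Q_L2_loc(2)[OF null_waves_L2_loc[OF that]]])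
  have mQ: "sect (Q \<phi>) \<in> borel_measurable M" if "\<phi> \<in> null_waves" for \<phi>
    using sqQ[OF that] unfolding sq_integrable_def measurable_strip_measure by blast
  have in_G: "(f, Re (krein_inner \<rho> \<eta> t0 tmax \<phi> w)) \<in> G"
    if "\<phi> \<in> null_waves" "f \<in> borel_measurable M" "AE x in ?\<mu>. f x = sect (Q \<phi>) x" for \<phi> f
    unfolding G_def using that by blast
  have G_sq: "sq_integrable ?\<mu> f" "l2_ip ?\<mu> f f = l2_ip ?\<mu> (sect (Q \<phi>)) (sect (Q \<phi>))"
    if "\<phi> \<in> null_waves" "f \<in> borel_measurable M" "AE x in ?\<mu>. f x = sect (Q \<phi>) x" for f \<phi>
  proof -
    have eq: "AE x in ?\<mu>. (norm (f x))\<^sup>2 = (norm (sect (Q \<phi>) x))\<^sup>2"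
      using that(3) by eventually_elim simp
    have m: "(\<lambda>x. (norm (f x))\<^sup>2) \<in> borel_measurable ?\<mu>" "(\<lambda>x. (norm (sect (Q \<phi>) x))\<^sup>2) \<in> borel_measurable ?\<mu>"
      unfolding measurable_strip_measure using that(2) mQ[OF that(1)] by measurable
    show "sq_integrable ?\<mu> f"
      using integrable_cong_AE[OF m eq] sqQ[OF that(1)] that(2)
      unfolding sq_integrable_def measurable_strip_measure by blast
    show "l2_ip ?\<mu> f f = l2_ip ?\<mu> (sect (Q \<phi>)) (sect (Q \<phi>))"
      unfolding l2_ip_self by (rule integral_cong_AE[OF m eq])
  qed
  have GE: thesis' if "(f, l) \<in> G" "\<And>\<phi>. \<phi> \<in> null_waves \<Longrightarrow> f \<in> borel_measurable M \<Longrightarrow>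
    (AE x in ?\<mu>. f x = sect (Q \<phi>) x) \<Longrightarrow> l = Re (krein_inner \<rho> \<eta> t0 tmax \<phi> w) \<Longrightarrow> thesis'" for f l thesis'
    using that unfolding G_def by blast
  have comb: "AE x in ?\<mu>. sect (Q (\<lambda>x. a *\<^sub>C \<phi> x + b *\<^sub>C \<psi> x)) x = a *\<^sub>C sect (Q \<phi>) x + b *\<^sub>C sect (Q \<psi>) x"
    if "\<phi> \<in> null_waves" "\<psi> \<in> null_waves" for \<phi> \<psi> a b
  proof (rule AE_strip_measure)
    have "AE x in M. x \<in> S"
      by (rule AE_I2) simp
    then show "AE x in M. sect (Q (\<lambda>x. a *\<^sub>C \<phi> x + b *\<^sub>C \<psi> x)) x = a *\<^sub>C sect (Q \<phi>) x + b *\<^sub>C sect (Q \<psi>) x"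
      using Q_combination[OF null_waves_L2_loc[OF that(1)] null_waves_L2_loc[OF that(2)], of a b]
      by eventually_elim (simp add: sect_combination)
  qed
  have kcomb: "krein_inner \<rho> \<eta> t0 tmax (\<lambda>x. a *\<^sub>C \<phi> x + b *\<^sub>C \<psi> x) w
    = cnj a * krein_inner \<rho> \<eta> t0 tmax \<phi> w + cnj b * krein_inner \<rho> \<eta> t0 tmax \<psi> w"
    if "\<phi> \<in> null_waves" "\<psi> \<in> null_waves" for \<phi> \<psi> a b
    by (rule krein_inner_combination[OF null_waves_L2_loc[OF that(1)] null_waves_L2_loc[OF that(2)]
          null_waves_L2_loc[OF null_waves_combination[OF that]] w])
  have zero: "(\<lambda>x. 0) \<in> null_waves"
  proof -
    have "{x \<in> S. (0 :: 'a) \<noteq> 0} = {}"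
      by blast
    then have "compact (support_M \<rho> (\<lambda>x. 0 :: 'a))"
      unfolding support_M_def by (simp only:) simp
    then have "(\<lambda>x. 0) \<in> compactly_supported \<rho> Cvary"
      using subspace unfolding compactly_supported_def wave_subspace_def by blast
    moreover have "energy tmax (\<lambda>x. 0) = 0"
      using surface_form_eq[OF compactly_supported_L2_loc[OF calculation], of tmax]
      by (simp add: spin_prod_def case_prod_beta')
    ultimately show ?thesis
      unfolding null_waves_def by blast
  qed
  have ne: "(sect (Q (\<lambda>x. 0)), Re (krein_inner \<rho> \<eta> t0 tmax (\<lambda>x. 0) w)) \<in> G"
    by (rule in_G[OF zero mQ[OF zero]]) simp
  have sq: "sq_integrable ?\<mu> f" if "(f, l) \<in> G" for f l
    using that by (rule GE) (rule G_sq(1))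
  have bound: "l \<le> K * sqrt (l2_ip ?\<mu> f f)" if "(f, l) \<in> G" for f l
    using that
  proof (rule GE)
    fix \<phi> assume phi: "\<phi> \<in> null_waves" and f: "f \<in> borel_measurable M" "AE x in ?\<mu>. f x = sect (Q \<phi>) x"
      and l: "l = Re (krein_inner \<rho> \<eta> t0 tmax \<phi> w)"
    have "l \<le> L2_norm \<rho> \<eta> t0 tmax \<phi> * L2_norm \<rho> \<eta> t0 tmax w"
      unfolding l by (rule Re_krein_inner_le[OF null_waves_L2_loc[OF phi] w])
    also have "\<dots> \<le> (2 * C\<^sup>2 * (tmax - t0)) * L2_norm \<rho> \<eta> t0 tmax (Q \<phi>) * L2_norm \<rho> \<eta> t0 tmax w"
      by (rule mult_right_mono[OF energy_estimate[OF phi] wn])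
    also have "\<dots> = K * sqrt (l2_ip ?\<mu> f f)"
      unfolding K_def G_sq(2)[OF phi f] L2_norm_l2_ip[OF mQ[OF phi]] by simp
    finally show "l \<le> K * sqrt (l2_ip ?\<mu> f f)" .
  qed
  have lin: "(\<lambda>x. a *\<^sub>R f x + b *\<^sub>R g x, a * l + b * m) \<in> G" if fl: "(f, l) \<in> G" and gm: "(g, m) \<in> G" for f l g m a b
    using fl
  proof (rule GE)
    fix \<phi> assume phi: "\<phi> \<in> null_waves" "f \<in> borel_measurable M" "AE x in ?\<mu>. f x = sect (Q \<phi>) x"
      "l = Re (krein_inner \<rho> \<eta> t0 tmax \<phi> w)"
    show ?thesis
      using gm
    proof (rule GE)
      fix \<psi> assume psi: "\<psi> \<in> null_waves" "g \<in> borel_measurable M" "AE x in ?\<mu>. g x = sect (Q \<psi>) x"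
        "m = Re (krein_inner \<rho> \<eta> t0 tmax \<psi> w)"
      let ?a = "complex_of_real a" and ?b = "complex_of_real b"
      have "(\<lambda>x. a *\<^sub>R f x + b *\<^sub>R g x, Re (krein_inner \<rho> \<eta> t0 tmax (\<lambda>x. ?a *\<^sub>C \<phi> x + ?b *\<^sub>C \<psi> x) w)) \<in> G"
      proof (rule in_G[OF null_waves_combination[OF phi(1) psi(1)]])
        show "(\<lambda>x. a *\<^sub>R f x + b *\<^sub>R g x) \<in> borel_measurable M"
          using phi(2) psi(2) by (intro borel_measurable_add borel_measurable_scaleR borel_measurable_const)
        show "AE x in ?\<mu>. a *\<^sub>R f x + b *\<^sub>R g x = sect (Q (\<lambda>x. ?a *\<^sub>C \<phi> x + ?b *\<^sub>C \<psi> x)) x"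
          using comb[OF phi(1) psi(1), of ?a ?b] phi(3) psi(3)
          by eventually_elim (simp add: scaleR_scaleC)
      qed
      then show ?thesis
        unfolding kcomb[OF phi(1) psi(1)] phi(4) psi(4) by simp
    qed
  qed
  have "\<exists>V. sq_integrable ?\<mu> V \<and> (\<forall>f l. (f, l) \<in> G \<longrightarrow> l2_ip ?\<mu> f V = l) \<and> sqrt (l2_ip ?\<mu> V V) \<le> K"
  proof (rule l2_Riesz[OF ne _ _ _ K])
    show "sq_integrable ?\<mu> f" "l \<le> K * sqrt (l2_ip ?\<mu> f f)" if "(f, l) \<in> G" for f l
      using sq[OF that] bound[OF that] .
    show "(\<lambda>x. a *\<^sub>R f x + b *\<^sub>R g x, a * l + b * m) \<in> G" if "(f, l) \<in> G" "(g, m) \<in> G" for f l g m a b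
      by (rule lin[OF that])
  qed
  then obtain V where V: "sq_integrable ?\<mu> V" and rep: "\<And>f l. (f, l) \<in> G \<Longrightarrow> l2_ip ?\<mu> f V = l"
    and Vn: "sqrt (l2_ip ?\<mu> V V) \<le> K"
    by blast
  have cinner_V: "(LINT x|?\<mu>. cinner (sect (Q \<phi>) x) (V x)) = krein_inner \<rho> \<eta> t0 tmax \<phi> w"
    if phi: "\<phi> \<in> null_waves" for \<phi>
  proof (rule complex_eqI)
    note int = sq_integrable_cinner[OF sqQ[OF phi] V]
    have "l2_ip ?\<mu> (sect (Q \<phi>)) V = Re (krein_inner \<rho> \<eta> t0 tmax \<phi> w)"
      by (rule rep[OF in_G[OF phi mQ[OF phi]]]) simp
    then show "Re (LINT x|?\<mu>. cinner (sect (Q \<phi>) x) (V x)) = Re (krein_inner \<rho> \<eta> t0 tmax \<phi> w)"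
      unfolding l2_ip_def using Bochner_Integration.integral_Re[OF int] by simp
    \<comment> \<open>So far only real parts are represented. Inserting \<open>\<i>\<close> times
      \<phi>, written as a combination of \<phi> with itself, yields the imaginary parts, because
      both products are antilinear in the first argument.\<close>
    have iphi: "(\<lambda>x. \<i> *\<^sub>C \<phi> x + 0 *\<^sub>C \<phi> x) \<in> null_waves"
      by (rule null_waves_combination[OF phi phi])
    have "l2_ip ?\<mu> (\<lambda>x. \<i> *\<^sub>C sect (Q \<phi>) x) V = Re (krein_inner \<rho> \<eta> t0 tmax (\<lambda>x. \<i> *\<^sub>C \<phi> x + 0 *\<^sub>C \<phi> x) w)"
    proof (rule rep[OF in_G[OF iphi]])
      show "(\<lambda>x. \<i> *\<^sub>C sect (Q \<phi>) x) \<in> borel_measurable M"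
        by (rule measurable_compose[OF mQ[OF phi] borel_measurable_continuous_onI])
          (intro linear_continuous_on bounded_linear_scaleC)
      show "AE x in ?\<mu>. \<i> *\<^sub>C sect (Q \<phi>) x = sect (Q (\<lambda>x. \<i> *\<^sub>C \<phi> x + 0 *\<^sub>C \<phi> x)) x"
        using comb[OF phi phi, of \<i> 0] by eventually_elim simp
    qed
    also have "\<dots> = Im (krein_inner \<rho> \<eta> t0 tmax \<phi> w)"
      unfolding kcomb[OF phi phi] by simp
    also have "l2_ip ?\<mu> (\<lambda>x. \<i> *\<^sub>C sect (Q \<phi>) x) V = (LINT x|?\<mu>. Im (cinner (sect (Q \<phi>) x) (V x)))"
      unfolding l2_ip_def by (simp add: cinner_scaleC_left)
    finally show "Im (LINT x|?\<mu>. cinner (sect (Q \<phi>) x) (V x)) = Im (krein_inner \<rho> \<eta> t0 tmax \<phi> w)"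
      using Bochner_Integration.integral_Im[OF int] by simp
  qed
  \<comment> \<open>The minus sign compensates the one in the spin inner product. The pointwise
    choice does no harm to measurability, which concerns only the prescribed section.\<close>
  define \<psi> where "\<psi> x = (if x \<in> S then SOME v. v \<in> spin_space x \<and> sqrt_abs x v = - sgn_op x (V x) else 0)" for x
  have psi: "\<psi> x \<in> spin_space x \<and> sect \<psi> x = - sgn_op x (V x)" if x: "x \<in> S" for x
  proof -
    have "- sgn_op x (V x) \<in> spin_space x"
      using regular_point.sgn_op_in[OF regular_point[OF x], of "- V x"]
        regular_point.sgn_op_minus[OF regular_point[OF x], of "V x"] by simp
    then have "\<exists>v. v \<in> spin_space x \<and> sqrt_abs x v = - sgn_op x (V x)"
      using regular_point.sqrt_abs_surj[OF regular_point[OF x]] by metis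
    then show ?thesis
      unfolding \<psi>_def using someI_ex[of "\<lambda>v. v \<in> spin_space x \<and> sqrt_abs x v = - sgn_op x (V x)"] x by simp
  qed
  have wave: "\<psi> \<in> wave_functions \<rho>"
    unfolding wave_functions_def using psi by (simp add: \<psi>_def)
  have sV: "sq_integrable ?\<mu> (\<lambda>x. sgn_op x (V x))"
    by (rule sq_integrable_sgn_op(1)[OF V])
  have mV: "(\<lambda>x. - sgn_op x (V x)) \<in> borel_measurable M"
    using sV unfolding sq_integrable_def measurable_strip_measure by (intro borel_measurable_uminus) blast
  have psi_sect: "sect \<psi> x = - sgn_op x (V x)" if "x \<in> S" for x
    using psi[OF that] by (rule conjunct2)
  have mpsi: "sect \<psi> \<in> borel_measurable M"
  proof (rule measurable_cong[THEN iffD2])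
    show "sect \<psi> x = - sgn_op x (V x)" if "x \<in> space M" for x
      using that psi_sect by simp
  qed (rule mV)
  have "integrable ?\<mu> (\<lambda>x. (norm (sgn_op x (V x)))\<^sup>2) \<longleftrightarrow> integrable ?\<mu> (\<lambda>x. (norm (sect \<psi> x))\<^sup>2)"
    by (rule Bochner_Integration.integrable_cong[OF refl]) (simp add: psi_sect)
  then have "integrable ?\<mu> (\<lambda>x. (norm (sect \<psi> x))\<^sup>2)"
    using sV unfolding sq_integrable_def by blast
  then have spsi: "sq_integrable ?\<mu> (sect \<psi>)"
    using mpsi unfolding sq_integrable_def measurable_strip_measure by blast
  show ?thesis
  proof (intro bexI[of _ \<psi>] conjI ballI)
    show "\<psi> \<in> L2_strip \<rho> \<eta> t0 tmax"
      unfolding L2_strip_sq_integrable using wave spsi by blast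
    have "l2_ip ?\<mu> (sect \<psi>) (sect \<psi>) = l2_ip ?\<mu> (\<lambda>x. sgn_op x (V x)) (\<lambda>x. sgn_op x (V x))"
      unfolding l2_ip_self by (rule Bochner_Integration.integral_cong[OF refl]) (simp add: psi_sect)
    also have "\<dots> \<le> l2_ip ?\<mu> V V"
      by (rule sq_integrable_sgn_op(2)[OF V])
    finally have "L2_norm \<rho> \<eta> t0 tmax \<psi> \<le> sqrt (l2_ip ?\<mu> V V)"
      unfolding L2_norm_l2_ip[OF mpsi] by simp
    then show "L2_norm \<rho> \<eta> t0 tmax \<psi> \<le> (2 * C\<^sup>2 * (tmax - t0)) * L2_norm \<rho> \<eta> t0 tmax w"
      using Vn unfolding K_def by linarith
    fix \<phi> assume phi: "\<phi> \<in> null_waves"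
    have "krein_inner \<rho> \<eta> t0 tmax (Q \<phi>) \<psi> = - (LINT x|?\<mu>. cinner (sect (Q \<phi>) x) (sgn_op x (sect \<psi> x)))"
      by (rule krein_inner_strip_measure[OF mQ[OF phi] mpsi])
    also have "(LINT x|?\<mu>. cinner (sect (Q \<phi>) x) (sgn_op x (sect \<psi> x))) = (LINT x|?\<mu>. - cinner (sect (Q \<phi>) x) (V x))"
    proof (rule Bochner_Integration.integral_cong[OF refl])
      fix x assume "x \<in> space ?\<mu>"
      then have x: "x \<in> S" by simp
      interpret x: regular_point x
        by (rule regular_point[OF x])
      \<comment> \<open>\<open>V x\<close> need not lie in the spin space. Both sign operators are
        moved to the other factor, which does, and cancel there.\<close>
      have "cinner (sect (Q \<phi>) x) (sgn_op x (sgn_op x (V x))) = cinner (sgn_op x (sgn_op x (sect (Q \<phi>) x))) (V x)"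
        by (simp only: x.sgn_op_selfadjoint)
      also have "sgn_op x (sgn_op x (sect (Q \<phi>) x)) = sect (Q \<phi>) x"
        by (rule x.sgn_op_sgn_op[OF x.sqrt_abs_in])
      finally show "cinner (sect (Q \<phi>) x) (sgn_op x (sect \<psi> x)) = - cinner (sect (Q \<phi>) x) (V x)"
        by (simp add: psi_sect[OF x] x.sgn_op_minus cinner.minus_right)
    qed
    finally show "krein_inner \<rho> \<eta> t0 tmax (Q \<phi>) \<psi> = krein_inner \<rho> \<eta> t0 tmax \<phi> w"
      using cinner_V[OF phi] by simp
  qed
qed

end

theorem theorem6p13:
  fixes n :: nat
    and F :: "'a::separable_complex_hilbert op set"
    and \<rho> :: "'a op measure"
    and \<kappa> :: real
    and Hf :: "'a set"
    and \<Omega>0 :: "'a op set"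
    and Cvary :: "'a wave set"
    and q :: "'a kernel" and c :: real
    and \<eta> :: "real \<Rightarrow> 'a op \<Rightarrow> real"
    and t0 tmax C :: real
  assumes "causal_fermion_system n F \<rho>"
    and "0 < \<kappa>" and "finite_dim_csubspace Hf" and "distinguished_past \<rho> n \<kappa> Hf \<Omega>0"
    and "wave_subspace Cvary" and "Cvary \<subseteq> continuous_waves \<rho>"
    and "symmetric_kernel \<rho> q"
    and "global_foliation \<rho> (past_sets \<rho> n \<kappa> Hf \<Omega>0) \<eta>"
    and "finite_time_range \<rho> \<eta> q c"
    and "surface_form_regular \<rho> \<eta> q c"
    and "hyperbolicity_condition \<rho> \<eta> q c Cvary"
    and "t0 < tmax"
    and "hyperbolicity_constant \<rho> \<eta> q c Cvary {t0..tmax} C"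
  shows "\<forall>w\<in>L2_strip \<rho> \<eta> t0 tmax. \<exists>\<psi>\<in>L2_strip \<rho> \<eta> t0 tmax.
    (\<forall>\<phi>\<in>test_space \<rho> \<eta> q c Cvary tmax.
       krein_inner \<rho> \<eta> t0 tmax (Q_apply \<rho> q c \<phi>) \<psi> = krein_inner \<rho> \<eta> t0 tmax \<phi> w) \<and>
    L2_norm \<rho> \<eta> t0 tmax \<psi> \<le> (2 * C\<^sup>2 * (tmax - t0)) * L2_norm \<rho> \<eta> t0 tmax w"
proof -
  interpret dynamical_cfs n F \<rho> "past_sets \<rho> n \<kappa> Hf \<Omega>0" \<eta> Cvary q c t0 tmax C
    by unfold_locales (use assms in blast)+
  show ?thesis
    using weak_solution test_space_subset by (meson subsetD)
qed

end
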